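(* Let $r$ be a rational number with $0 \le r \le 1$. Then there exists a polynomial $P \in \mathbb{Z}[x]$ such that $\delta(S(P)) = r$.
   Context: For $P \in \mathbb{Z}[x]$, $S(P)$ denotes the set of primes $p$ such that $p \mid P(k)$ for some integer $k$. For a set $S$ of primes, $\delta(S) = \lim_{x\to\infty} \frac{|\{p \le x : p \in S\}|}{|\{p \le x : p \text{ prime}\}|}$ is its natural density. *)

theory Defs
  imports Complex_Main "HOL-Computational_Algebra.Polynomial" "HOL-Computational_Algebra.Primes"
begin

definition prime_divisors_of_values :: "int poly \<Rightarrow> nat set" where
  "prime_divisors_of_values P = {p. prime p \<and> (\<exists>k::int. int p dvd poly P k)}"

text \<open>The density is a relation, so that asserting a value includes the existence of the limit.\<close>

definition has_natural_density :: "nat set \<Rightarrow> real \<Rightarrow> bool" where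
  "has_natural_density S d \<longleftrightarrow>
     ((\<lambda>x::real. real (card {p. prime p \<and> real p \<le> x \<and> p \<in> S})
        / real (card {p::nat. prime p \<and> real p \<le> x})) \<longlongrightarrow> d) at_top"

end

theory Submission
  imports Defs "HOL-Complex_Analysis.Complex_Analysis" "HOL-Number_Theory.Number_Theory"
    "HOL-Real_Asymp.Real_Asymp" "HOL-Computational_Algebra.Polynomial_Factorial"
begin

text \<open>
  Write $1 - r = k/n$; the product of $1 - 1/m$ over $k < m \le n$ telescopes to $k/n$. Choose distinct primes
  $q_m \equiv 1$ modulo $m$ and a Dirichlet character $\chi_m$ of order $m$ modulo $q_m$. There is an integer
  polynomial $P_m$ (of Gaussian period type) such that, up to finitely many exceptions, a prime $p$ divides a value
  of $P_m$ iff $\chi_m(p) = 1$. For $P = \prod P_m$ the primes outside $S(P)$ are essentially those with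
  $\chi_m(p) \ne 1$ for all $m$, and by independence of the $\chi_m$ they have density $k/n$.

  The equidistribution used here is the prime number theorem for Dirichlet characters. It follows from a Tauberian
  theorem for Dirichlet series (smoothing with the Fejer kernel) and the non-vanishing of $L(s, \chi)$ on the line
  Re $s = 1$ (the 3-4-1 inequality, and Monsky's argument for real characters at $s = 1$).
\<close>

section \<open>Dirichlet series\<close>

text \<open>The primes outside S(P) are counted because S of a product of polynomials is a union,
  while independence multiplies densities of intersections; a character of order m takes the value 1
  on a proportion 1/m of the primes, so each factor removes exactly that proportion. Distinct moduli
  make the characters independent through the Chinese remainder theorem. P_m generates the subfield
  of the q_m-th cyclotomic field fixed by the kernel of the character. That field is Galois, so
  outside finitely many primes one root modulo p already forces complete splitting, and this is why
  divisibility of a single value detects the character. Natural density, unlike Dirichlet density,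
  needs the L-functions on the whole line Re s = 1 and not only at s = 1. The Tauberian theorem asks
  for real coefficients bounded below, which the values of a complex character do not offer; it is
  therefore applied once, to an indicator function expanded in characters, and the poles of the
  trivial characters add up to the expected mean.\<close>

lemma norm_of_nat_powr: "n > 0 \<Longrightarrow> norm (of_nat n powr a :: complex) = real n powr Re a"
  by (simp add: norm_powr_real_powr)

text \<open>Mean value inequality on the real segment from x to y: the derivative of z^a has modulus
  |a| r^(Re a - 1), which for Re a \<le> 1 is largest at the left end.\<close>

lemma norm_diff_powr_le:
  fixes a :: complex
  assumes "0 < x" "x \<le> y" "Re a \<le> 1"
  shows "norm (of_real y powr a - of_real x powr a) \<le> norm a * x powr (Re a - 1) * (y - x)"
proof -
  let ?S = "closed_segment (of_real x) (of_real y) :: complex set"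
  have el: "\<exists>r. z = of_real r \<and> x \<le> r \<and> r \<le> y" if "z \<in> ?S" for z
    using that assms by (auto simp: closed_segment_of_real closed_segment_eq_real_ivl)
  have "norm (of_real y powr a - of_real x powr a) \<le> (norm a * x powr (Re a - 1)) * norm (of_real y - of_real x :: complex)"
  proof (rule field_differentiable_bound[where S = ?S and f' = "\<lambda>z. a * z powr (a - 1)"])
    fix z assume "z \<in> ?S"
    then obtain r where r: "z = of_real r" "x \<le> r" "r \<le> y" using el by blast
    have "z \<notin> \<real>\<^sub>\<le>\<^sub>0" using r assms by auto
    then show "((\<lambda>z. z powr a) has_field_derivative a * z powr (a - 1)) (at z within ?S)"
      by (rule has_field_derivative_at_within[OF has_field_derivative_powr])
    have "norm (z powr (a - 1)) = r powr (Re a - 1)"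
      unfolding r(1) using r(2) assms(1) by (subst norm_powr_real_powr) auto
    also have "\<dots> \<le> x powr (Re a - 1)"
      using r assms by (intro powr_mono2') auto
    finally show "norm (a * z powr (a - 1)) \<le> norm a * x powr (Re a - 1)"
      by (simp add: norm_mult mult_left_mono)
  qed (rule convex_closed_segment ends_in_segment)+
  also have "norm (of_real y - of_real x :: complex) = y - x"
    unfolding of_real_diff[symmetric] norm_of_real using assms by simp
  finally show ?thesis .
qed

lemma norm_diff_powr_Suc_le:
  assumes "n > 0" "Re a \<le> 1"
  shows "norm (of_nat n powr a - of_nat (Suc n) powr a :: complex) \<le> norm a * real n powr (Re a - 1)"
proof -
  have eq: "real (Suc n) - real n = 1" by simp
  have "norm (of_real (real (Suc n)) powr a - of_real (real n) powr a) \<le> norm a * real n powr (Re a - 1) * (real (Suc n) - real n)"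
    using assms by (intro norm_diff_powr_le) auto
  then show ?thesis
    unfolding of_real_of_nat_eq eq mult_1_right norm_minus_commute[of "of_nat n powr a"] .
qed

text \<open>Error of the tangent at n over a unit step. The derivative of \<open>h\<close> is itself
  a difference of two powers with exponent a - 1, so the first-order estimate bounds it and one
  further power of n is gained.\<close>

lemma norm_diff2_powr_Suc_le:
  assumes "n > 0" "Re a \<le> 2"
  shows "norm (a * of_nat n powr (a - 1) - (of_nat (Suc n) powr a - of_nat n powr a) :: complex)
           \<le> norm a * norm (a - 1) * real n powr (Re a - 2)"
proof -
  let ?S = "closed_segment (of_nat n) (of_nat (Suc n)) :: complex set"
  define h where "h = (\<lambda>z::complex. a * of_nat n powr (a - 1) * z - z powr a)"
  have el: "\<exists>r. z = of_real r \<and> real n \<le> r \<and> r \<le> real n + 1" if "z \<in> ?S" for z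
    using that closed_segment_of_real[of "real n" "real (Suc n)", where 'a = complex] by (auto simp: closed_segment_eq_real_ivl)
  have "norm (h (of_nat (Suc n)) - h (of_nat n)) \<le> (norm a * norm (a - 1) * real n powr (Re a - 2)) * norm (of_nat (Suc n) - of_nat n :: complex)"
  proof (rule field_differentiable_bound[where S = ?S and f' = "\<lambda>z. a * of_nat n powr (a - 1) - a * z powr (a - 1)"])
    fix z assume "z \<in> ?S"
    then obtain r where r: "z = of_real r" "real n \<le> r" "r \<le> real n + 1" using el by blast
    have "z \<notin> \<real>\<^sub>\<le>\<^sub>0" using r assms by auto
    then show "(h has_field_derivative a * of_nat n powr (a - 1) - a * z powr (a - 1)) (at z within ?S)"
      unfolding h_def by (intro DERIV_diff has_field_derivative_at_within[OF has_field_derivative_powr]) (auto intro!: derivative_eq_intros)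
    have "norm (a * of_nat n powr (a - 1) - a * z powr (a - 1)) = norm a * norm (of_real r powr (a-1) - of_real (real n) powr (a-1))"
      by (simp add: r right_diff_distrib[symmetric] norm_mult norm_minus_commute)
    also have "\<dots> \<le> norm a * (norm (a - 1) * real n powr (Re (a-1) - 1) * (r - real n))"
      using assms r by (intro mult_left_mono norm_diff_powr_le) auto
    also have "\<dots> \<le> norm a * (norm (a - 1) * real n powr (Re (a-1) - 1) * 1)"
      using r by (intro mult_left_mono) auto
    finally show "norm (a * of_nat n powr (a - 1) - a * z powr (a - 1)) \<le> norm a * norm (a - 1) * real n powr (Re a - 2)"
      by (simp add: mult_ac)
  qed (rule convex_closed_segment ends_in_segment)+
  moreover have "h (of_nat (Suc n)) - h (of_nat n) = a * of_nat n powr (a - 1) - (of_nat (Suc n) powr a - of_nat n powr a)"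
    by (simp add: h_def algebra_simps)
  ultimately show ?thesis by simp
qed

section \<open>Holomorphy of Dirichlet series and partial summation\<close>

lemma holomorphic_suminf_local:
  fixes f :: "nat \<Rightarrow> complex \<Rightarrow> complex"
  assumes "open S" and hol: "\<And>n. f n holomorphic_on S"
    and bd: "\<And>z. z \<in> S \<Longrightarrow> \<exists>d>0. \<exists>h. cball z d \<subseteq> S \<and> summable h \<and> (\<forall>n. \<forall>w\<in>cball z d. norm (f n w) \<le> h n)"
  shows "(\<lambda>z. \<Sum>n. f n z) holomorphic_on S"
proof (rule holomorphic_uniform_sequence[OF \<open>open S\<close>])
  show "(\<lambda>z. \<Sum>i<n. f i z) holomorphic_on S" for n
    by (intro holomorphic_intros hol)
  fix z assume "z \<in> S"
  from bd[OF this] obtain d h where d: "d > 0" "cball z d \<subseteq> S" "summable h" "\<And>n w. w \<in> cball z d \<Longrightarrow> norm (f n w) \<le> h n"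
    by blast
  have "uniform_limit (cball z d) (\<lambda>n x. \<Sum>i<n. f i x) (\<lambda>x. suminf (\<lambda>i. f i x)) sequentially"
    by (rule Weierstrass_m_test) (use d in auto)
  then show "\<exists>d>0. cball z d \<subseteq> S \<and> uniform_limit (cball z d) (\<lambda>n z. \<Sum>i<n. f i z) (\<lambda>z. \<Sum>n. f n z) sequentially"
    using d by auto
qed

lemma open_Re_gt: "open {s::complex. Re s > c}"
  by (simp add: open_halfspace_Re_gt)

text \<open>The factor \<open>B (norm s)\<close> admits the polynomial growth in s that partial
  summation produces; being monotone, it can be frozen at its largest value on a small disc, which
  leaves a summable majorant.\<close>

lemma holomorphic_suminf_Re_gt:
  fixes f :: "nat \<Rightarrow> complex \<Rightarrow> complex" and B :: "real \<Rightarrow> real"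
  assumes hol: "\<And>n. f n holomorphic_on {s. Re s > c}"
    and bd: "\<And>n s. Re s > c \<Longrightarrow> norm (f n s) \<le> B (norm s) * real n powr (c - 1 - Re s)"
    and B: "\<And>x y. 0 \<le> x \<Longrightarrow> x \<le> y \<Longrightarrow> 0 \<le> B x \<and> B x \<le> B y"
  shows "(\<lambda>s. \<Sum>n. f n s) holomorphic_on {s. Re s > c}"
proof (rule holomorphic_suminf_local[OF open_Re_gt hol])
  fix z :: complex assume z: "z \<in> {s. Re s > c}"
  \<comment> \<open>Half the distance to the boundary line: on the disc Re w \<ge> c + d, so the
    exponent stays below -1 by at least d.\<close>
  define d where "d = (Re z - c) / 2"
  have d: "d > 0" using z by (simp add: d_def)
  define h where "h = (\<lambda>n. B (norm z + d) * real n powr (-1 - d))"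
  have re: "Re w \<ge> c + d" if "w \<in> cball z d" for w
  proof -
    have "Re z - Re w \<le> norm (z - w)" by (metis complex_Re_le_cmod minus_complex.simps(1))
    then show ?thesis using that by (simp add: dist_norm d_def field_simps)
  qed
  have nw: "norm w \<le> norm z + d" if "w \<in> cball z d" for w
    using that norm_triangle_sub[of w z] by (simp add: dist_norm norm_minus_commute)
  have "norm (f n w) \<le> h n" if w: "w \<in> cball z d" for n w
  proof -
    have "norm (f n w) \<le> B (norm w) * real n powr (c - 1 - Re w)"
      using re[OF w] d by (intro bd) auto
    also have "\<dots> \<le> B (norm z + d) * real n powr (-1 - d)"
    \<comment> \<open>Since \<open>0 powr x = 0\<close>, the hypothesis forces the term at n = 0 to
      vanish.\<close>
    proof (cases "n = 0")
      case False
      have "real n powr (c - 1 - Re w) \<le> real n powr (-1 - d)"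
        using False re[OF w] by (intro powr_mono) auto
      then show ?thesis using B[of "norm w" "norm z + d"] nw[OF w] by (intro mult_mono) auto
    qed simp
    finally show ?thesis by (simp add: h_def)
  qed
  moreover have "summable h"
    unfolding h_def using d by (intro summable_mult) (simp add: summable_real_powr_iff)
  moreover have "cball z d \<subseteq> {s. Re s > c}" using re d by fastforce
  ultimately show "\<exists>d>0. \<exists>h. cball z d \<subseteq> {s. c < Re s} \<and> summable h \<and> (\<forall>n. \<forall>w\<in>cball z d. norm (f n w) \<le> h n)"
    using d by blast
qed

text \<open>Abel summation. Against partial sums of size n^\<kappa> the differences of n^(-s) leave
  terms of size n^(\<kappa> - Re s - 1), and the boundary term tends to 0. It is used with \<kappa>
  = 1 for sums of linear growth and with \<kappa> = 0 for bounded sums.\<close>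

lemma abel_dirichlet:
  fixes \<alpha> :: "nat \<Rightarrow> complex"
  assumes bd: "\<And>n. norm (sum \<alpha> {1..n}) \<le> C * real n powr \<kappa>" and s: "Re s > \<kappa>" "\<kappa> \<ge> 0"
  shows "summable (\<lambda>n. norm (sum \<alpha> {1..n} * (of_nat n powr (-s) - of_nat (Suc n) powr (-s))))"
    and "(\<lambda>n. \<alpha> n * of_nat n powr (-s)) sums (\<Sum>n. sum \<alpha> {1..n} * (of_nat n powr (-s) - of_nat (Suc n) powr (-s)))"
proof -
  define A where "A n = sum \<alpha> {1..n}" for n
  define t where "t n = A n * (of_nat n powr (-s) - of_nat (Suc n) powr (-s))" for n
  have C: "C \<ge> 0" using order_trans[OF norm_ge_zero bd[of 1]] by simp
  have tb: "norm (t n) \<le> C * norm s * real n powr (\<kappa> - Re s - 1)" for n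
  proof (cases "n = 0")
    case True then show ?thesis by (simp add: t_def A_def)
  next
    case False
    have "norm (t n) \<le> (C * real n powr \<kappa>) * (norm (-s) * real n powr (Re (-s) - 1))"
      unfolding t_def norm_mult A_def using False s C
      by (intro mult_mono bd norm_diff_powr_Suc_le) auto
    also have "\<dots> = C * norm s * (real n powr \<kappa> * real n powr (Re (-s) - 1))" by simp
    also have "real n powr \<kappa> * real n powr (Re (-s) - 1) = real n powr (\<kappa> - Re s - 1)"
      unfolding powr_add[symmetric] by (rule arg_cong[where f = "(powr) (real n)"]) simp
    finally show ?thesis .
  qed
  show 1: "summable (\<lambda>n. norm (sum \<alpha> {1..n} * (of_nat n powr (-s) - of_nat (Suc n) powr (-s))))"
    unfolding A_def[symmetric] t_def[symmetric]
  proof (rule summable_comparison_test'[where N = 0])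
    show "summable (\<lambda>n. C * norm s * real n powr (\<kappa> - Re s - 1))"
      using s by (intro summable_mult) (simp add: summable_real_powr_iff)
    show "norm (norm (t n)) \<le> C * norm s * real n powr (\<kappa> - Re s - 1)" if "n \<ge> 0" for n using tb by simp
  qed
  have part: "(\<Sum>n<Suc K. \<alpha> n * of_nat n powr (-s)) = A K * of_nat (Suc K) powr (-s) + (\<Sum>n<Suc K. t n)" for K
  proof (induction K)
    case 0 show ?case by (simp add: A_def t_def)
  next
    case (Suc K)
    have "A (Suc K) = A K + \<alpha> (Suc K)" by (simp add: A_def)
    moreover have "t (Suc K) = A (Suc K) * of_nat (Suc K) powr (-s) - A (Suc K) * of_nat (Suc (Suc K)) powr (-s)"
      by (simp add: t_def right_diff_distrib)
    ultimately show ?case unfolding sum.lessThan_Suc[of _ "Suc K"] Suc by (simp add: ring_distribs)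
  qed
  have "(\<lambda>K. A K * of_nat (Suc K) powr (-s)) \<longlonglongrightarrow> 0"
  proof (rule Lim_null_comparison)
    show "\<forall>\<^sub>F K in sequentially. norm (A K * of_nat (Suc K) powr (-s)) \<le> C * real K powr (\<kappa> - Re s)"
      using eventually_gt_at_top[of 0]
    proof eventually_elim
      case (elim K)
      have "norm (A K * of_nat (Suc K) powr (-s)) \<le> (C * real K powr \<kappa>) * real (Suc K) powr (- Re s)"
        unfolding norm_mult A_def using bd[of K] C norm_of_nat_powr[of "Suc K" "-s"] by (intro mult_mono) (auto simp del: of_nat_Suc)
      also have "\<dots> \<le> (C * real K powr \<kappa>) * real K powr (- Re s)"
        using C s elim by (intro mult_left_mono powr_mono2') auto
      also have "\<dots> = C * real K powr (\<kappa> - Re s)" by (simp add: powr_add[symmetric])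
      finally show ?case .
    qed
    have "(\<lambda>K. real K powr (\<kappa> - Re s)) \<longlonglongrightarrow> 0" using s
      by (intro tendsto_neg_powr) (auto intro: filterlim_real_sequentially)
    then show "(\<lambda>K. C * real K powr (\<kappa> - Re s)) \<longlonglongrightarrow> 0" by (rule tendsto_mult_right_zero)
  qed
  moreover have "(\<lambda>K. \<Sum>n<Suc K. t n) \<longlonglongrightarrow> (\<Sum>n. t n)"
  proof -
    have "summable t" using 1 unfolding A_def[symmetric] t_def[symmetric] by (rule summable_norm_cancel)
    then show ?thesis by (rule LIMSEQ_Suc[OF summable_LIMSEQ])
  qed
  ultimately have "(\<lambda>K. \<Sum>n<Suc K. \<alpha> n * of_nat n powr (-s)) \<longlonglongrightarrow> 0 + (\<Sum>n. t n)"
    unfolding part by (rule tendsto_add)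
  then have "(\<lambda>K. \<Sum>n<K. \<alpha> n * of_nat n powr (-s)) \<longlonglongrightarrow> (\<Sum>n. t n)"
    by (simp only: add_0_left) (rule LIMSEQ_imp_Suc)
  then show "(\<lambda>n. \<alpha> n * of_nat n powr (-s)) sums (\<Sum>n. sum \<alpha> {1..n} * (of_nat n powr (-s) - of_nat (Suc n) powr (-s)))"
    unfolding sums_def A_def[symmetric] t_def[symmetric] .
qed

lemma of_nat_powr_eq_cis:
  assumes "n > 0"
  shows "of_nat n powr (- s) = of_real (real n powr (- Re s)) * cis (- Im s * ln (real n))"
proof -
  have "Ln (of_nat n) = of_real (ln (real n))"
    using assms by (metis Ln_of_real of_nat_0_less_iff of_real_of_nat_eq)
  then show ?thesis
    using assms by (simp add: powr_def exp_eq_polar)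
qed

section \<open>A Tauberian theorem\<close>

text \<open>The Fourier transform of the triangular weight $\max(0, 1 - |t|/w)$.\<close>

definition fejer :: "real \<Rightarrow> real \<Rightarrow> real" where
  "fejer w u = (if u = 0 then w else 2 * (1 - cos (w * u)) / (w * u\<^sup>2))"

section \<open>Integral formula and bounds for the Fejer kernel\<close>

text \<open>The triangular weight is even, so its transform is twice the cosine integral over the
  right half. Only t \<ge> 0 then occurs, and for real coefficients real parts suffice.\<close>

lemma fejer_has_integral:
  assumes "w > 0"
  shows "((\<lambda>t. 2 * (1 - t / w) * cos (t * u)) has_integral fejer w u) {0..w}"
proof (cases "u = 0")
  case True
  have "((\<lambda>t. 2 * (1 - t / w)) has_integral ((2 * w - w\<^sup>2 / w) - (2 * 0 - 0\<^sup>2 / w))) {0..w}"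
    using assms
    by (intro fundamental_theorem_of_calculus)
       (auto intro!: derivative_eq_intros simp: has_real_derivative_iff_has_vector_derivative[symmetric] field_simps)
  then show ?thesis using True assms by (simp add: fejer_def power2_eq_square)
next
  case False
  define F where "F t = 2 * ((1 - t / w) * sin (t * u) / u - cos (t * u) / (w * u\<^sup>2))" for t
  have "((\<lambda>t. 2 * (1 - t / w) * cos (t * u)) has_integral (F w - F 0)) {0..w}"
  proof (rule fundamental_theorem_of_calculus)
    fix x assume "x \<in> {0..w}"
    have "(F has_real_derivative 2 * (1 - x / w) * cos (x * u)) (at x within {0..w})"
      unfolding F_def using False assms
      by (auto intro!: derivative_eq_intros simp: field_simps power2_eq_square)
    then show "(F has_vector_derivative 2 * (1 - x / w) * cos (x * u)) (at x within {0..w})"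
      by (simp add: has_real_derivative_iff_has_vector_derivative)
  qed (use assms in auto)
  moreover have "F w - F 0 = fejer w u"
    using False assms by (simp add: F_def fejer_def field_simps)
  ultimately show ?thesis by simp
qed

lemma fejer_nonneg: "w > 0 \<Longrightarrow> fejer w u \<ge> 0"
  by (simp add: fejer_def)

lemma fejer_le:
  assumes "w > 0" "u \<noteq> 0"
  shows "fejer w u \<le> 4 / (w * u\<^sup>2)"
proof -
  have "2 * (1 - cos (w * u)) \<le> 4" by (smt (verit) cos_ge_minus_one)
  then show ?thesis using assms by (simp add: fejer_def divide_right_mono)
qed

lemma cos_ge_quadratic: "cos x \<ge> 1 - x\<^sup>2 / 2" for x :: real
proof -
  have "(sin (x/2))\<^sup>2 \<le> (x/2)\<^sup>2"
    using abs_sin_x_le_abs_x[of "x/2"] by (simp only: abs_le_square_iff)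
  moreover have "cos x = 1 - 2 * (sin (x/2))\<^sup>2" using cos_double_sin[of "x/2"] by simp
  ultimately show ?thesis by (simp add: power_divide)
qed

text \<open>For |t u| \<le> 1 the cosine is at least 1/2, and the weight 1 - t/w has mass w/2.
  Comparing integrals avoids expanding the closed formula near u = 0.\<close>

lemma fejer_ge:
  assumes "w > 0" "\<bar>w * u\<bar> \<le> 1"
  shows "fejer w u \<ge> w / 2"
proof (rule has_integral_le)
  have "((\<lambda>t. 2 * (1 - t / w) * cos (t * 0)) has_integral fejer w 0) {0..w}"
    by (rule fejer_has_integral) fact
  from has_integral_mult_left[OF this, of "1/2"]
  show "((\<lambda>t. (1 - t / w)) has_integral w / 2) {0..w}" by (simp add: fejer_def diff_divide_distrib)
  show "((\<lambda>t. 2 * (1 - t / w) * cos (t * u)) has_integral fejer w u) {0..w}"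
    by (rule fejer_has_integral) fact
  fix t assume t: "t \<in> {0..w}"
  have "\<bar>t * u\<bar> \<le> \<bar>w * u\<bar>" using t by (simp add: abs_mult mult_right_mono)
  then have "(t * u)\<^sup>2 \<le> 1" using assms by (simp add: abs_square_le_1)
  then have "cos (t * u) \<ge> 1/2" using cos_ge_quadratic[of "t * u"] by linarith
  moreover have "1 - t / w \<ge> 0" using t assms by simp
  ultimately have "(1 - t / w) * (2 * cos (t * u)) \<ge> (1 - t / w) * 1" by (intro mult_left_mono) auto
  then show "1 - t / w \<le> 2 * (1 - t / w) * cos (t * u)" by (simp add: algebra_simps)
qed

section \<open>Smoothed sums as oscillatory integrals\<close>

text \<open>Multiplying the series at 1 + \<epsilon> + it by N^(it) turns n^(-it) into a phase with
  frequency ln N - ln n, and integrating against the triangular weight gives the kernel. For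
  \<epsilon> > 0 the series converges uniformly in t, which permits the interchange.\<close>

lemma fejer_sum_eq_integral:
  fixes b :: "nat \<Rightarrow> real" and g :: "complex \<Rightarrow> complex"
  assumes b: "\<And>n. \<bar>b n\<bar> \<le> C" and \<epsilon>: "\<epsilon> > 0" and w: "w > 0" and N: "N > 0"
    and g: "\<And>s. Re s > 1 \<Longrightarrow> (\<lambda>n. of_real (b n) * of_nat n powr (-s)) sums g s"
  shows "\<exists>J. (\<lambda>n. b n * real n powr (-1-\<epsilon>) * fejer w (ln (real N) - ln (real n))) sums J \<and>
     ((\<lambda>t. Re (cis (ln (real N) * t) * (of_real (2 * (1 - t / w)) * g (Complex (1+\<epsilon>) t)))) has_integral J) {0..w}"
proof -
  define f where "f n t = b n * real n powr (-1-\<epsilon>) * (2 * (1 - t / w) * cos (t * (ln (real N) - ln (real n))))" for n t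
  define g1 where "g1 t = Re (cis (ln (real N) * t) * (of_real (2 * (1 - t / w)) * g (Complex (1+\<epsilon>) t)))" for t
  have C: "C \<ge> 0" using b[of 0] by linarith
  have fs: "(\<lambda>n. f n t) sums g1 t" for t
  proof -
    have "(\<lambda>n. Re (cis (ln (real N) * t) * (of_real (2 * (1 - t / w)) * (of_real (b n) * of_nat n powr (-(Complex (1+\<epsilon>) t)))))) sums g1 t"
      unfolding g1_def using \<epsilon> by (intro sums_Re sums_mult g) auto
    moreover have "Re (cis (ln (real N) * t) * (of_real (2 * (1 - t / w)) * (of_real (b n) * of_nat n powr (-(Complex (1+\<epsilon>) t))))) = f n t" for n
    proof (cases "n = 0")
      case True then show ?thesis by (simp add: f_def)
    next
      case False
      have "cis (ln (real N) * t) * (of_real (2 * (1 - t / w)) * (of_real (b n) * of_nat n powr (-(Complex (1+\<epsilon>) t))))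
         = of_real (2 * (1 - t / w) * b n * real n powr (- (1 + \<epsilon>))) * (cis (ln (real N) * t) * cis (- t * ln (real n)))"
        using False by (subst of_nat_powr_eq_cis) auto
      also have "cis (ln (real N) * t) * cis (- t * ln (real n)) = cis (t * (ln (real N) - ln (real n)))"
        by (simp add: cis_mult algebra_simps)
      finally have "Re (cis (ln (real N) * t) * (of_real (2 * (1 - t / w)) * (of_real (b n) * of_nat n powr (-(Complex (1+\<epsilon>) t)))))
          = 2 * (1 - t / w) * b n * real n powr (- (1 + \<epsilon>)) * cos (t * (ln (real N) - ln (real n)))"
        by (simp only: Re_complex_of_real times_complex.sel Im_complex_of_real cis.sel mult_zero_left diff_zero)
      moreover have "- (1 + \<epsilon>) = -1 - \<epsilon>" by simp
      ultimately show ?thesis unfolding f_def by (simp only: mult_ac)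
    qed
    ultimately show ?thesis by simp
  qed
  have fb: "norm (f n t) \<le> 2 * C * real n powr (-1-\<epsilon>)" if "t \<in> {0..w}" for n t
  proof -
    have "\<bar>2 * (1 - t / w) * cos (t * (ln (real N) - ln (real n)))\<bar> \<le> 2 * 1"
      unfolding abs_mult using that w by (intro mult_mono) auto
    then have "\<bar>f n t\<bar> \<le> C * real n powr (-1-\<epsilon>) * 2"
      unfolding f_def abs_mult[of "b n * real n powr (-1-\<epsilon>)"] using b[of n] C
      by (intro mult_mono) (auto simp: abs_mult mult_right_mono)
    then show ?thesis by simp
  qed
  have "summable (\<lambda>n. 2 * C * real n powr (-1-\<epsilon>))"
    using \<epsilon> by (intro summable_mult) (simp add: summable_real_powr_iff)
  then have "uniform_limit {0..w} (\<lambda>n t. \<Sum>i<n. f i t) (\<lambda>t. \<Sum>i. f i t) sequentially"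
    using fb by (intro Weierstrass_m_test[where M = "\<lambda>n. 2 * C * real n powr (-1-\<epsilon>)"])
  also have "(\<lambda>t. \<Sum>i. f i t) = g1" using fs by (simp add: sums_iff fun_eq_iff)
  finally have u: "uniform_limit {0..w} (\<lambda>n t. \<Sum>i<n. f i t) g1 sequentially" .
  have "continuous_on {0..w} (\<lambda>t. \<Sum>i<n. f i t)" for n
    unfolding f_def using w by (intro continuous_intros) auto
  from uniform_limit_integral[OF u this] obtain I J where
    IJ: "\<And>n. ((\<lambda>t. \<Sum>i<n. f i t) has_integral I n) {0..w}" "(g1 has_integral J) {0..w}" "I \<longlonglongrightarrow> J"
    by auto
  have "I n = (\<Sum>i<n. b i * real i powr (-1-\<epsilon>) * fejer w (ln (real N) - ln (real i)))" for n
  proof (rule has_integral_unique[OF IJ(1)])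
    show "((\<lambda>t. \<Sum>i<n. f i t) has_integral (\<Sum>i<n. b i * real i powr (-1-\<epsilon>) * fejer w (ln (real N) - ln (real i)))) {0..w}"
      unfolding f_def by (intro has_integral_sum has_integral_mult_right fejer_has_integral w) auto
  qed
  then have "(\<lambda>n. b n * real n powr (-1-\<epsilon>) * fejer w (ln (real N) - ln (real n))) sums J"
    unfolding sums_def using IJ(3) by presburger
  with IJ(2) show ?thesis unfolding g1_def by blast
qed

text \<open>Quantitative Riemann-Lebesgue lemma: one integration by parts gains 1/L. Only the
  suprema of G and G' enter, so the bound is uniform over families of such functions.\<close>

lemma oscillatory_integral_bound:
  fixes G G' :: "real \<Rightarrow> complex"
  assumes "L > 0" "a \<le> c" and der: "\<And>t. t \<in> {a..c} \<Longrightarrow> (G has_vector_derivative G' t) (at t within {a..c})"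
    and cont: "continuous_on {a..c} G'"
    and B: "\<And>t. t \<in> {a..c} \<Longrightarrow> norm (G t) \<le> B" and B': "\<And>t. t \<in> {a..c} \<Longrightarrow> norm (G' t) \<le> B'"
  shows "norm (integral {a..c} (\<lambda>t. cis (L * t) * G t)) \<le> (2 * B + B' * (c - a)) / L"
proof -
  define F where "F t = cis (L * t) * G t / (\<i> * of_real L)" for t
  have F: "((\<lambda>t. cis (L * t) * G t + cis (L * t) * G' t / (\<i> * of_real L)) has_integral (F c - F a)) {a..c}"
  proof (rule fundamental_theorem_of_calculus)
    fix t assume t: "t \<in> {a..c}"
    have "((\<lambda>t. cis (L * t)) has_vector_derivative (\<i> * of_real L * cis (L * t))) (at t within {a..c})"
    proof -
      have "((\<lambda>z. exp (\<i> * of_real L * z)) has_field_derivative (\<i> * of_real L * exp (\<i> * of_real L * of_real t))) (at (of_real t))"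
        by (auto intro!: derivative_eq_intros)
      from has_vector_derivative_real_field[OF this] show ?thesis
        by (simp add: cis_conv_exp mult_ac)
    qed
    then have "(F has_vector_derivative ((\<i> * of_real L * cis (L * t)) * G t + cis (L * t) * G' t) / (\<i> * of_real L)) (at t within {a..c})"
      unfolding F_def by (auto intro!: derivative_eq_intros der[OF t] has_vector_derivative_divide simp: algebra_simps)
    then show "(F has_vector_derivative cis (L * t) * G t + cis (L * t) * G' t / (\<i> * of_real L)) (at t within {a..c})"
      using \<open>L > 0\<close> by (simp add: add_divide_distrib)
  qed fact
  have cG: "continuous_on {a..c} (\<lambda>t. cis (L * t) * G' t / (\<i> * of_real L))"
    using cont \<open>L > 0\<close> by (intro continuous_intros) auto
  then have int: "((\<lambda>t. cis (L * t) * G' t / (\<i> * of_real L)) has_integral integral {a..c} (\<lambda>t. cis (L * t) * G' t / (\<i> * of_real L))) {a..c}"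
    by (intro integrable_integral integrable_continuous_real)
  have "norm (integral {a..c} (\<lambda>t. cis (L * t) * G' t / (\<i> * of_real L))) \<le> B' / L * (c - a)"
    using \<open>L > 0\<close> B' by (intro integral_bound cG) (auto simp: norm_divide norm_mult intro!: divide_right_mono assms)
  moreover have "integral {a..c} (\<lambda>t. cis (L * t) * G t) = (F c - F a) - integral {a..c} (\<lambda>t. cis (L * t) * G' t / (\<i> * of_real L))"
    using has_integral_diff[OF F int] by (intro integral_unique) simp
  moreover have "norm (F t) \<le> B / L" if "t \<in> {a..c}" for t
    using B[OF that] \<open>L > 0\<close> by (simp add: F_def norm_divide norm_mult divide_right_mono)
  then have "norm (F c) \<le> B / L" "norm (F a) \<le> B / L" using \<open>a \<le> c\<close> by auto
  ultimately have "norm (integral {a..c} (\<lambda>t. cis (L * t) * G t)) \<le> B / L + B / L + B' / L * (c - a)"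
    by (smt (verit) norm_triangle_ineq4)
  then show ?thesis using \<open>L > 0\<close> by (simp add: field_simps)
qed

section \<open>Tails of the logarithmic kernel\<close>

lemma ln_diff_ge: "0 < x \<Longrightarrow> x \<le> y \<Longrightarrow> ln y - ln x \<ge> (y - x) / (y::real)"
proof -
  assume a: "0 < x" "x \<le> y"
  have "ln (x / y) \<le> x / y - 1" using a by (intro ln_le_minus_one) auto
  then show ?thesis using a by (simp add: ln_div diff_divide_distrib)
qed

text \<open>Discrete form of integrating dx / (x (ln(x/N))^2): since 1/n \<le> ln n - ln(n-1), each
  term is at most a difference of consecutive values of \<open>\<phi>\<close>, and the sum
  telescopes.\<close>

lemma log_kernel_upper_tail:
  assumes "0 < N" "N < real a"
  shows "(\<Sum>n=Suc a..<m. 1 / (real n * (ln N - ln (real n))\<^sup>2)) \<le> 1 / (ln (real a) - ln N)"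
proof -
  define \<phi> where "\<phi> n = 1 / (ln (real n) - ln N)" for n :: nat
  have pos: "ln (real n) - ln N > 0" if "n \<ge> a" for n
    using that assms by simp
  have step: "1 / (real n * (ln N - ln (real n))\<^sup>2) \<le> \<phi> (n - 1) - \<phi> n" if "n \<in> {Suc a..<m}" for n
  proof -
    define x where "x = ln (real (n-1)) - ln N"
    define y where "y = ln (real n) - ln N"
    have n: "n - 1 \<ge> a" "n \<ge> 1" "real (n - 1) > 0" using that assms by auto
    have xy: "0 < x" "x \<le> y" using pos[of "n-1"] n by (auto simp: x_def y_def)
    have d: "y - x \<ge> 1 / real n"
      using ln_diff_ge[of "real (n-1)" "real n"] n by (simp add: x_def y_def)
    have "1 / (real n * y\<^sup>2) = (1 / real n) / (y * y)" by (simp add: power2_eq_square)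
    also have "\<dots> \<le> (y - x) / (x * y)"
      using d xy n by (intro frac_le mult_right_mono) auto
    also have "\<dots> = 1 / x - 1 / y" using xy by (simp add: field_simps)
    finally have "1 / (real n * y\<^sup>2) \<le> \<phi> (n-1) - \<phi> n" by (simp add: \<phi>_def x_def y_def)
    then show ?thesis by (simp add: y_def power2_commute)
  qed
  have "(\<Sum>n=Suc a..<m. 1 / (real n * (ln N - ln (real n))\<^sup>2)) \<le> (\<Sum>n=Suc a..<m. \<phi> (n - 1) - \<phi> n)"
    by (intro sum_mono step)
  also have "\<dots> \<le> \<phi> a"
  proof (cases "a < m")
    case True
    have "(\<Sum>n=Suc a..<m. \<phi> (n - 1) - \<phi> n) = \<phi> a - \<phi> (m - 1)"
      using True
    proof (induction m)
      case (Suc m)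
      show ?case
      proof (cases "a < m")
        case True
        then have "sum (\<lambda>n. \<phi> (n - 1) - \<phi> n) {Suc a..<Suc m} = sum (\<lambda>n. \<phi> (n - 1) - \<phi> n) {Suc a..<m} + (\<phi> (m - 1) - \<phi> m)"
          by (subst sum.atLeastLessThan_Suc) auto
        with Suc.IH[OF True] show ?thesis by simp
      next
        case False
        then have "m = a" using Suc.prems by simp
        then show ?thesis by simp
      qed
    qed simp
    moreover have "\<phi> (m-1) \<ge> 0" using pos[of "m-1"] True by (simp add: \<phi>_def less_imp_le)
    ultimately show ?thesis by simp
  next
    case False
    then show ?thesis using pos[of a] by (simp add: \<phi>_def less_imp_le)
  qed
  finally show ?thesis by (simp add: \<phi>_def)
qed

text \<open>The same comparison below N. Here the increment of the logarithm controls 1/(a+1) while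
  the term carries 1/a, and 1/a \<le> 2/(a+1) accounts for the factor 2.\<close>

lemma log_kernel_lower_tail:
  assumes "real a < N" "a > 0"
  shows "(\<Sum>n=1..<a. 1 / (real n * (ln N - ln (real n))\<^sup>2)) \<le> 2 / (ln N - ln (real a))"
  using assms
proof (induction a)
  case (Suc a)
  show ?case
  proof (cases "a = 0")
    case True
    then show ?thesis using Suc.prems by simp
  next
    case False
    define x where "x = ln N - ln (real (Suc a))"
    define y where "y = ln N - ln (real a)"
    have xy: "0 < x" "x \<le> y" using False Suc.prems by (auto simp: x_def y_def simp del: of_nat_Suc)
    have d: "y - x \<ge> 1 / real (Suc a)"
      using ln_diff_ge[of "real a" "real (Suc a)"] False by (simp add: x_def y_def)
    have "1 / real a \<le> 2 / real (Suc a)" using False by (simp add: field_simps)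
    also have "\<dots> \<le> 2 * (y - x)" using d by simp
    finally have d2: "1 / real a \<le> 2 * (y - x)" .
    have "1 / (real a * y\<^sup>2) = (1 / real a) / (y * y)" by (simp add: power2_eq_square)
    also have "\<dots> \<le> 2 * (y - x) / (x * y)"
      using d2 xy False by (intro frac_le mult_right_mono) auto
    also have "\<dots> = 2 / x - 2 / y" using xy by (simp add: field_simps)
    finally have "1 / (real a * y\<^sup>2) \<le> 2 / x - 2 / y" .
    moreover have "(\<Sum>n=1..<a. 1 / (real n * (ln N - ln (real n))\<^sup>2)) \<le> 2 / y"
      using Suc False by (simp add: y_def)
    moreover have "(\<Sum>n=1..<Suc a. 1 / (real n * (ln N - ln (real n))\<^sup>2)) = (\<Sum>n=1..<a. 1 / (real n * (ln N - ln (real n))\<^sup>2)) + 1 / (real a * y\<^sup>2)"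
      using False by (subst sum.atLeastLessThan_Suc) (auto simp: y_def)
    ultimately show ?thesis by (simp add: x_def)
  qed
qed simp

text \<open>A relative distance \<delta> between n and N keeps |ln n - ln N| above a constant
  depending only on \<delta>, so both telescoped tails are bounded independently of N and of the
  cutoff m.\<close>

lemma log_kernel_tail:
  assumes "\<delta> > 0" "\<delta> \<le> 1/2"
  shows "\<exists>D\<ge>0. \<forall>\<^sub>F N in sequentially. \<forall>m. (\<Sum>n | n \<in> {1..<m} \<and> \<bar>real n - real N\<bar> > \<delta> * real N. 1 / (real n * (ln (real N) - ln (real n))\<^sup>2)) \<le> D"
proof -
  define D where "D = 2 / (- ln (1 - \<delta>/2)) + 1 / ln (1 + \<delta>/2)"
  have p1: "ln (1 - \<delta>/2) < 0" using assms by (intro ln_less_zero) auto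
  have p2: "ln (1 + \<delta>/2) > 0" using assms by (intro ln_gt_zero) auto
  have "D \<ge> 0" unfolding D_def using p1 p2 by (intro add_nonneg_nonneg divide_nonneg_pos) auto
  moreover have "\<forall>\<^sub>F N in sequentially. \<forall>m. (\<Sum>n | n \<in> {1..<m} \<and> \<bar>real n - real N\<bar> > \<delta> * real N. 1 / (real n * (ln (real N) - ln (real n))\<^sup>2)) \<le> D"
    using eventually_ge_at_top[of "nat \<lceil>2 / \<delta>\<rceil> + 1"]
  proof eventually_elim
    case (elim N)
    \<comment> \<open>Rounding an endpoint to an integer then costs at most \<delta> N / 2, which is
      why \<open>D\<close> is built from 1 - \<delta>/2 and 1 + \<delta>/2.\<close>
    have "2 / \<delta> \<le> real N" using elim by linarith
    then have N: "\<delta> * real N \<ge> 2" "N > 0" using assms elim by (auto simp: field_simps)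
    define f where "f n = 1 / (real n * (ln (real N) - ln (real n))\<^sup>2)" for n
    have f0: "f n \<ge> 0" for n by (simp add: f_def)
    define a where "a = nat \<lfloor>(1 + \<delta>) * real N\<rfloor>"
    have a: "real a \<le> (1 + \<delta>) * real N" "real a \<ge> (1 + \<delta>) * real N - 1"
      using assms by (auto simp: a_def)
    define c where "c = nat \<lceil>(1 - \<delta>) * real N\<rceil>"
    have c: "real c \<ge> (1 - \<delta>) * real N" "real c \<le> (1 - \<delta>) * real N + 1"
      using assms by (auto simp: c_def)
    have "(1 - \<delta>) * real N > 0" using assms N by (intro mult_pos_pos) auto
    then have c0: "c > 0" using c(1) by linarith
    have c2: "real c \<le> (1 - \<delta>/2) * real N" using c(2) N by (simp add: algebra_simps)
    have a2: "real a \<ge> (1 + \<delta>/2) * real N" using a(2) N by (simp add: algebra_simps)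
    show "\<forall>m. sum f {n. n \<in> {1..<m} \<and> \<bar>real n - real N\<bar> > \<delta> * real N} \<le> D"
    proof
      fix m
      have sub: "{n. n \<in> {1..<m} \<and> \<bar>real n - real N\<bar> > \<delta> * real N} \<subseteq> {1..<c} \<union> {Suc a..<m}"
      proof
        fix n assume n: "n \<in> {n. n \<in> {1..<m} \<and> \<bar>real n - real N\<bar> > \<delta> * real N}"
        then consider "real n < (1 - \<delta>) * real N" | "real n > (1 + \<delta>) * real N"
          by (auto simp: algebra_simps abs_if split: if_splits)
        then show "n \<in> {1..<c} \<union> {Suc a..<m}"
        proof cases
          case 1
          then have "n < c" using c(1) by linarith
          then show ?thesis using n by simp
        next
          case 2
          then have "a < n" using a(1) by linarith
          then show ?thesis using n by simp
        qed
      qed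
      have "sum f {n. n \<in> {1..<m} \<and> \<bar>real n - real N\<bar> > \<delta> * real N} \<le> sum f ({1..<c} \<union> {Suc a..<m})"
        by (rule sum_mono2[OF _ sub]) (use f0 in auto)
      also have "\<dots> \<le> sum f {1..<c} + sum f {Suc a..<m}"
        using sum.union_inter[of "{1..<c}" "{Suc a..<m}" f] sum_nonneg[of "{1..<c} \<inter> {Suc a..<m}" f] f0 by simp
      also have "sum f {1..<c} \<le> 2 / (ln (real N) - ln (real c))"
        unfolding f_def
      proof (rule log_kernel_lower_tail)
        have "(1 - \<delta>/2) * real N < real N" using assms N by (simp add: algebra_simps)
        then show "real c < real N" using c2 by linarith
      qed (fact c0)
      also have "\<dots> \<le> 2 / (- ln (1 - \<delta>/2))"
      proof (intro frac_le)
        have "ln (real c) \<le> ln ((1 - \<delta>/2) * real N)"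
          using c0 c2 by simp
        also have "\<dots> = ln (1 - \<delta>/2) + ln (real N)" using assms N by (intro ln_mult_pos) auto
        finally show "- ln (1 - \<delta>/2) \<le> ln (real N) - ln (real c)" by simp
      qed (use p1 in auto)
      also have "sum f {Suc a..<m} \<le> 1 / (ln (real a) - ln (real N))"
        unfolding f_def
      proof (rule log_kernel_upper_tail)
        have "(1 + \<delta>/2) * real N > real N" using assms N by (simp add: algebra_simps)
        then show "real N < real a" using a2 by linarith
      qed (use N in auto)
      also have "\<dots> \<le> 1 / ln (1 + \<delta>/2)"
      proof (intro frac_le)
        have "ln (1 + \<delta>/2) + ln (real N) = ln ((1 + \<delta>/2) * real N)"
          using assms N by (intro ln_mult_pos[symmetric]) auto
        also have "\<dots> \<le> ln (real a)"
          using a2 assms N by (intro ln_mono) auto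
        finally show "ln (1 + \<delta>/2) \<le> ln (real a) - ln (real N)" by simp
      qed (use p2 in auto)
      finally show "sum f {n. n \<in> {1..<m} \<and> \<bar>real n - real N\<bar> > \<delta> * real N} \<le> D"
        by (simp add: D_def)
    qed
  qed
  ultimately show ?thesis by blast
qed

text \<open>The bound on the smoothed sum is uniform in $\epsilon$, so no passage to the limit $\epsilon \to 0$ is needed
  inside the infinite sum.\<close>

lemma fejer_sum_bound:
  fixes b :: "nat \<Rightarrow> real" and g :: "complex \<Rightarrow> complex"
  assumes b: "\<And>n. \<bar>b n\<bar> \<le> C" and w: "w > 0"
    and U: "open U" "{s. Re s \<ge> 1} \<subseteq> U" "g holomorphic_on U"
    and g: "\<And>s. Re s > 1 \<Longrightarrow> (\<lambda>n. of_real (b n) * of_nat n powr (-s)) sums g s"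
  shows "\<exists>M. \<forall>N\<ge>2. \<forall>\<epsilon>. 0 < \<epsilon> \<longrightarrow> \<epsilon> \<le> 1 \<longrightarrow>
     (\<exists>J. (\<lambda>n. b n * real n powr (-1-\<epsilon>) * fejer w (ln (real N) - ln (real n))) sums J \<and> \<bar>J\<bar> \<le> M / ln (real N))"
proof -
  \<comment> \<open>A compact rectangle containing every point 1 + \<epsilon> + it with 0 <
    \<epsilon> \<le> 1 and 0 \<le> t \<le> w. Bounds for g and its derivative on it make M
    independent of \<epsilon> and N.\<close>
  define R where "R = cbox (Complex 1 0) (Complex 2 w)"
  have R: "compact R" by (simp add: R_def)
  have RU: "R \<subseteq> U" using U(2) by (auto simp: R_def in_cbox_complex_iff)
  have "continuous_on R g" using U(3) RU holomorphic_on_imp_continuous_on holomorphic_on_subset by blast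
  then have "bounded (g ` R)" using R compact_continuous_image compact_imp_bounded by blast
  then obtain B1 where B1: "\<And>s. s \<in> R \<Longrightarrow> norm (g s) \<le> B1" by (auto simp: bounded_iff)
  have hd: "deriv g holomorphic_on U" using U by (intro holomorphic_deriv)
  have "continuous_on R (deriv g)" using hd RU holomorphic_on_imp_continuous_on holomorphic_on_subset by blast
  then have "bounded (deriv g ` R)" using R compact_continuous_image compact_imp_bounded by blast
  then obtain B2 where B2: "\<And>s. s \<in> R \<Longrightarrow> norm (deriv g s) \<le> B2" by (auto simp: bounded_iff)
  have "Complex 1 0 \<in> R" using w by (simp add: R_def in_cbox_complex_iff)
  then have B0: "B1 \<ge> 0" "B2 \<ge> 0" using B1 B2 norm_ge_zero order_trans by blast+
  define M where "M = 2 * (2 * B1) + (2 * B2 + 2 / w * B1) * (w - 0)"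
  show ?thesis
  proof (rule exI[of _ M], intro allI impI)
    fix N :: nat and \<epsilon> :: real
    assume N: "N \<ge> 2" and \<epsilon>: "0 < \<epsilon>" "\<epsilon> \<le> 1"
    define G where "G t = of_real (2 * (1 - t / w)) * g (Complex (1+\<epsilon>) t)" for t
    define G' where "G' t = of_real (2 * (1 - t / w)) * (\<i> * deriv g (Complex (1+\<epsilon>) t)) - of_real (2 / w) * g (Complex (1+\<epsilon>) t)" for t
    have inR: "Complex (1+\<epsilon>) t \<in> R" if "t \<in> {0..w}" for t
      using that \<epsilon> by (simp add: R_def in_cbox_complex_iff)
    have path: "((\<lambda>t. Complex (1+\<epsilon>) t) has_vector_derivative \<i>) (at t within X)" for t X
    proof -
      have "((\<lambda>t. of_real (1+\<epsilon>) + of_real t * \<i>) has_vector_derivative \<i>) (at t within X)"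
        by (rule has_vector_derivative_real_field) (auto intro!: derivative_eq_intros)
      moreover have "(\<lambda>t. of_real (1+\<epsilon>) + of_real t * \<i>) = (\<lambda>t. Complex (1+\<epsilon>) t)"
        by (auto simp: complex_eq_iff)
      ultimately show ?thesis by simp
    qed
    have gd: "((\<lambda>t. g (Complex (1+\<epsilon>) t)) has_vector_derivative (\<i> * deriv g (Complex (1+\<epsilon>) t))) (at t within {0..w})" if "t \<in> {0..w}" for t
    proof -
      have "(g has_field_derivative deriv g (Complex (1+\<epsilon>) t)) (at (Complex (1+\<epsilon>) t))"
        by (rule holomorphic_derivI[OF U(3,1)]) (use RU inR[OF that] in auto)
      then have "(g has_field_derivative deriv g (Complex (1+\<epsilon>) t)) (at (Complex (1+\<epsilon>) t) within (\<lambda>t. Complex (1+\<epsilon>) t) ` {0..w})"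
        by (rule has_field_derivative_at_within)
      from field_vector_diff_chain_within[OF path this] show ?thesis by (simp add: o_def)
    qed
    have Gd: "(G has_vector_derivative G' t) (at t within {0..w})" if "t \<in> {0..w}" for t
    proof -
      have "((\<lambda>t. of_real (2 * (1 - t / w)) :: complex) has_vector_derivative of_real (- 2 / w)) (at t within {0..w})"
        by (intro has_vector_derivative_of_real) (use w in \<open>auto intro!: derivative_eq_intros\<close>)
      from has_vector_derivative_mult[OF this gd[OF that]]
      show ?thesis unfolding G_def G'_def by (simp add: algebra_simps)
    qed
    have contC: "continuous_on {0..w} (\<lambda>t. Complex (1+\<epsilon>) t)"
      by (rule continuous_on_vector_derivative[OF path])
    have cyc_congr: "continuous_on {0..w} (\<lambda>t. g (Complex (1+\<epsilon>) t))" "continuous_on {0..w} (\<lambda>t. deriv g (Complex (1+\<epsilon>) t))"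
      using inR by (auto intro!: continuous_on_compose2[OF \<open>continuous_on R g\<close> contC] continuous_on_compose2[OF \<open>continuous_on R (deriv g)\<close> contC])
    have cG': "continuous_on {0..w} G'"
      unfolding G'_def using cyc_congr w by (intro continuous_intros) auto
    have lin: "norm (of_real (2 * (1 - t / w)) :: complex) \<le> 2" if "t \<in> {0..w}" for t
    proof -
      have "0 \<le> t / w" "t / w \<le> 1" using that w by auto
      then have "\<bar>1 - t / w\<bar> \<le> 1" by linarith
      then show ?thesis unfolding norm_of_real abs_mult by simp
    qed
    have nG: "norm (G t) \<le> 2 * B1" if "t \<in> {0..w}" for t
      unfolding G_def norm_mult using lin[OF that] B1[OF inR[OF that]] by (intro mult_mono) auto
    have nG': "norm (G' t) \<le> 2 * B2 + 2 / w * B1" if "t \<in> {0..w}" for t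
    proof -
      have "norm (G' t) \<le> norm (of_real (2 * (1 - t / w)) * (\<i> * deriv g (Complex (1+\<epsilon>) t))) + norm (of_real (2 / w) * g (Complex (1+\<epsilon>) t))"
        unfolding G'_def by (rule norm_triangle_ineq4)
      also have "\<dots> \<le> 2 * B2 + 2 / w * B1"
        unfolding norm_mult using lin[OF that] B1[OF inR[OF that]] B2[OF inR[OF that]] w B0
        by (intro add_mono mult_mono) (auto simp: norm_divide)
      finally show ?thesis .
    qed
    have L: "ln (real N) > 0" using N by simp
    have "norm (integral {0..w} (\<lambda>t. cis (ln (real N) * t) * G t)) \<le> (2 * (2 * B1) + (2 * B2 + 2 / w * B1) * (w - 0)) / ln (real N)"
      by (rule oscillatory_integral_bound[OF L _ Gd cG' nG nG']) (use w in auto)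
    then have ib: "norm (integral {0..w} (\<lambda>t. cis (ln (real N) * t) * G t)) \<le> M / ln (real N)"
      by (simp only: M_def)
    from fejer_sum_eq_integral[OF b \<epsilon>(1) w _ g, of N] N obtain J where
      J: "(\<lambda>n. b n * real n powr (-1-\<epsilon>) * fejer w (ln (real N) - ln (real n))) sums J"
         "((\<lambda>t. Re (cis (ln (real N) * t) * G t)) has_integral J) {0..w}"
      unfolding G_def by auto
    have "continuous_on {0..w} (\<lambda>t. cis (ln (real N) * t) * G t)"
      unfolding G_def using cyc_congr(1) w by (intro continuous_intros) auto
    then have "((\<lambda>t. cis (ln (real N) * t) * G t) has_integral integral {0..w} (\<lambda>t. cis (ln (real N) * t) * G t)) {0..w}"
      by (intro integrable_integral integrable_continuous_real)
    from has_integral_linear[OF this bounded_linear_Re]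
    have "((\<lambda>t. Re (cis (ln (real N) * t) * G t)) has_integral Re (integral {0..w} (\<lambda>t. cis (ln (real N) * t) * G t))) {0..w}"
      by (simp only: o_def)
    with J(2) have "J = Re (integral {0..w} (\<lambda>t. cis (ln (real N) * t) * G t))" by (rule has_integral_unique)
    then have "\<bar>J\<bar> \<le> M / ln (real N)" using ib abs_Re_le_cmod order_trans by blast
    with J(1) show "\<exists>J. (\<lambda>n. b n * real n powr (-1-\<epsilon>) * fejer w (ln (real N) - ln (real n))) sums J \<and> \<bar>J\<bar> \<le> M / ln (real N)"
      by blast
  qed
qed

text \<open>If $b_n \ge \eta$ for all $n$ near $N$, then the smoothed sum centred at $N$ is at least a constant multiple of
  $\eta$ once the bandwidth is large, whereas the Riemann-Lebesgue bound lets it tend to zero.\<close>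

lemma eventually_not_locally_bounded_below:
  fixes b :: "nat \<Rightarrow> real" and g :: "complex \<Rightarrow> complex"
  assumes b: "\<And>n. \<bar>b n\<bar> \<le> C"
    and U: "open U" "{s. Re s \<ge> 1} \<subseteq> U" "g holomorphic_on U"
    and g: "\<And>s. Re s > 1 \<Longrightarrow> (\<lambda>n. of_real (b n) * of_nat n powr (-s)) sums g s"
    and \<eta>: "\<eta> > 0" and \<delta>: "0 < \<delta>" "\<delta> \<le> 1/2"
  shows "\<forall>\<^sub>F N in sequentially. \<not> (\<forall>n. \<bar>real n - real N\<bar> \<le> \<delta> * real N \<longrightarrow> b n \<ge> \<eta>)"
proof -
  have C: "C \<ge> 0" using b[of 0] by linarith
  obtain D where D: "D \<ge> 0" and tail: "\<forall>\<^sub>F N in sequentially. \<forall>m. (\<Sum>n | n \<in> {1..<m} \<and> \<bar>real n - real N\<bar> > \<delta> * real N. 1 / (real n * (ln (real N) - ln (real n))\<^sup>2)) \<le> D"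
    using log_kernel_tail[OF \<delta>] by blast
  \<comment> \<open>The second entry keeps the window from N to N + N/(2w) within relative distance
    \<delta> of N; the third makes the tail, at most 4 C D / w, no larger than \<eta>/50.\<close>
  define w where "w = max (max 1 (1 / (2 * \<delta>))) (200 * C * D / \<eta>)"
  have w: "w \<ge> 1" "1 / (2 * \<delta>) \<le> w" "200 * C * D / \<eta> \<le> w" by (auto simp: w_def)
  then have w0: "w > 0" by linarith
  have w1: "1 / (2 * w) \<le> \<delta>" using w(2) w0 \<delta> by (simp add: field_simps)
  have w2: "C * (4 / w) * D \<le> \<eta> / 50" using w(3) w0 \<eta> by (simp add: field_simps)
  from fejer_sum_bound[OF b w0 U g] obtain M where M: "\<forall>N\<ge>2. \<forall>\<epsilon>. 0 < \<epsilon> \<longrightarrow> \<epsilon> \<le> 1 \<longrightarrow>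
     (\<exists>J. (\<lambda>n. b n * real n powr (-1-\<epsilon>) * fejer w (ln (real N) - ln (real n))) sums J \<and> \<bar>J\<bar> \<le> M / ln (real N))" ..
  have "(\<lambda>N. M / ln (real N)) \<longlonglongrightarrow> 0"
    by (intro tendsto_divide_0[OF tendsto_const] filterlim_at_top_imp_at_infinity filterlim_compose[OF ln_at_top] filterlim_real_sequentially)
  then have "\<forall>\<^sub>F N in sequentially. M / ln (real N) < \<eta> / 100"
    using \<eta> by (intro order_tendstoD) auto
  with tail eventually_ge_at_top[of 2] show ?thesis
  proof eventually_elim
    case (elim N)
    have N: "N \<ge> 2" by fact
    show ?case
    proof
      assume hyp: "\<forall>n. \<bar>real n - real N\<bar> \<le> \<delta> * real N \<longrightarrow> b n \<ge> \<eta>"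
      \<comment> \<open>With this choice (2N)^(-\<epsilon>) = 1/e, so the damping factor costs at
        most a factor 3 on [N, 2N].\<close>
      define \<epsilon> where "\<epsilon> = 1 / ln (2 * real N)"
      have "exp 1 \<le> 2 * real N" using exp_le N by linarith
      then have l1: "ln (2 * real N) \<ge> 1" using N by (subst ln_ge_iff) auto
      then have \<epsilon>: "0 < \<epsilon>" "\<epsilon> \<le> 1" by (auto simp: \<epsilon>_def)
      from M[rule_format, OF N \<epsilon>] obtain J where
        J: "(\<lambda>n. b n * real n powr (-1-\<epsilon>) * fejer w (ln (real N) - ln (real n))) sums J" "\<bar>J\<bar> \<le> M / ln (real N)"
        by blast
      define f where "f n = b n * real n powr (-1-\<epsilon>) * fejer w (ln (real N) - ln (real n))" for n
      \<comment> \<open>For N \<le> n \<le> N + K the argument w ln(n/N) is at most 1/2, so the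
        kernel is at least w/2 there. The K + 1 \<ge> N/(2w) terms, each at least \<eta>/(6N) times
        w/2, add up to \<eta>/24.\<close>
      define K where "K = nat \<lfloor>real N / (2 * w)\<rfloor>"
      have K: "real K \<le> real N / (2 * w)" "real N / (2 * w) \<le> real K + 1"
        using w0 by (auto simp: K_def)
      define A where "A = {N..N + K}"
      have KN: "real K \<le> \<delta> * real N"
      proof -
        have "real N / (2 * w) = 1 / (2 * w) * real N" by simp
        also have "\<dots> \<le> \<delta> * real N" by (intro mult_right_mono w1) auto
        finally show ?thesis using K(1) by linarith
      qed
      have K2: "real K \<le> real N" using KN \<delta> mult_right_mono[of \<delta> "1" "real N"] by simp
      have fA: "f n \<ge> \<eta> * (1 / (6 * real N)) * (w / 2)" if "n \<in> A" for n
      proof -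
        have n: "real N \<le> real n" "real n \<le> real N + real K" using that by (auto simp: A_def)
        have n0: "real n > 0" using n N by linarith
        have "\<bar>real n - real N\<bar> \<le> \<delta> * real N" using n KN by linarith
        then have 1: "b n \<ge> \<eta>" using hyp by blast
        have "(2 * real N) powr (-1-\<epsilon>) = (2 * real N) powr (-1) * (2 * real N) powr (-\<epsilon>)"
          by (subst powr_add[symmetric]) simp
        also have "(2 * real N) powr (-\<epsilon>) = exp (-1)" using N l1 by (simp add: powr_def \<epsilon>_def)
        also have "(2 * real N) powr (-1) = 1 / (2 * real N)" using N by (intro powr_neg_one) auto
        finally have "(2 * real N) powr (-1-\<epsilon>) = 1 / (2 * real N) * exp (-1)" .
        moreover have "1 / (2 * real N) * exp (-1) \<ge> 1 / (2 * real N) * (1 / 3)"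
          using exp_le by (intro mult_left_mono) (auto simp: exp_minus field_simps)
        moreover have "real n powr (-1-\<epsilon>) \<ge> (2 * real N) powr (-1-\<epsilon>)"
          using n K2 n0 \<epsilon> by (intro powr_mono2') auto
        ultimately have 2: "real n powr (-1-\<epsilon>) \<ge> 1 / (6 * real N)" by simp
        have "\<bar>w * (ln (real N) - ln (real n))\<bar> = w * ln (real n / real N)"
          using n n0 N w0 by (simp add: abs_mult ln_div)
        also have "\<dots> \<le> w * (real n / real N - 1)"
          using n0 N w0 by (intro mult_left_mono ln_le_minus_one) auto
        also have "\<dots> \<le> w * (real K / real N)"
        proof (intro mult_left_mono)
          have "(real n - real N) / real N \<le> real K / real N" using n by (intro divide_right_mono) auto
          then show "real n / real N - 1 \<le> real K / real N" using N by (simp add: diff_divide_distrib)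
        qed (use w0 in auto)
        also have "\<dots> \<le> w * (1 / (2 * w))"
          using K(1) N w0 by (intro mult_left_mono) (auto simp: field_simps)
        also have "\<dots> \<le> 1" using w0 by simp
        finally have 3: "fejer w (ln (real N) - ln (real n)) \<ge> w / 2"
          using w0 by (intro fejer_ge)
        show ?thesis unfolding f_def using 1 2 3 \<eta> w0 by (intro mult_mono) auto
      qed
      have sA: "sum f A \<ge> \<eta> / 24"
      proof -
        have "\<eta> / 24 = (real N / (2 * w)) * (\<eta> * (1 / (6 * real N)) * (w / 2))"
          using N w0 by (simp add: field_simps)
        also have "\<dots> \<le> real (card A) * (\<eta> * (1 / (6 * real N)) * (w / 2))"
          using K(2) \<eta> w0 by (intro mult_right_mono) (auto simp: A_def)
        also have "\<dots> \<le> sum f A"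
          using sum_bounded_below[of A _ f, OF fA] by simp
        finally show ?thesis .
      qed
      \<comment> \<open>Within relative distance \<delta> of N all terms are nonnegative; only those
        farther out can be negative, and they are controlled by the tail bound. The difference
        exceeds \<eta>/100, contradicting the bound on J.\<close>
      have low: "(\<Sum>n<m. f n) \<ge> \<eta> / 24 - \<eta> / 50" if m: "m > N + K" for m
      proof -
        define F where "F = {n. n \<in> {1..<m} \<and> \<bar>real n - real N\<bar> > \<delta> * real N}"
        define E where "E = {n. n \<in> {1..<m} \<and> \<bar>real n - real N\<bar> \<le> \<delta> * real N}"
        have fin: "finite F" "finite E" "F \<inter> E = {}" by (auto simp: F_def E_def)
        have "(\<Sum>n<m. f n) = f 0 + sum f {1..<m}"
          using m sum.atLeast_Suc_lessThan[of 0 m f] by (simp add: lessThan_atLeast0)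
        also have "f 0 = 0" by (simp add: f_def)
        also have "{1..<m} = F \<union> E" by (auto simp: F_def E_def)
        also have "sum f (F \<union> E) = sum f F + sum f E" by (rule sum.union_disjoint) (use fin in auto)
        finally have eq: "(\<Sum>n<m. f n) = sum f F + sum f E" by simp
        have "sum f E \<ge> sum f A"
        proof (rule sum_mono2)
          show "A \<subseteq> E" using m KN N by (auto simp: A_def E_def)
          fix n assume "n \<in> E - A"
          then have "b n \<ge> \<eta>" using hyp by (simp add: E_def)
          then have "b n \<ge> 0" using \<eta> by linarith
          then show "0 \<le> f n" unfolding f_def using fejer_nonneg[OF w0] by simp
        qed (use fin in auto)
        moreover have "- sum f F \<le> C * (4 / w) * D"
        proof -
          have "- sum f F = (\<Sum>n\<in>F. - f n)" by (simp add: sum_negf)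
          also have "\<dots> \<le> (\<Sum>n\<in>F. C * (4 / w) * (1 / (real n * (ln (real N) - ln (real n))\<^sup>2)))"
          proof (rule sum_mono)
            fix n assume n: "n \<in> F"
            have "0 \<le> \<delta> * real N" using \<delta> by simp
            moreover have "\<bar>real n - real N\<bar> > \<delta> * real N" using n by (simp add: F_def)
            ultimately have "\<bar>real n - real N\<bar> > 0" by linarith
            then have n1: "n \<ge> 1" "real n \<noteq> real N" using n by (auto simp: F_def)
            then have u: "ln (real N) - ln (real n) \<noteq> 0" using N by simp
            have p: "real n powr (-1-\<epsilon>) \<le> 1 / real n"
            proof -
              have "real n powr (-1-\<epsilon>) \<le> real n powr (-1)" using n1 \<epsilon> by (intro powr_mono) auto
              also have "\<dots> = 1 / real n" using n1 by (intro powr_neg_one) auto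
              finally show ?thesis .
            qed
            have "- f n \<le> \<bar>f n\<bar>" by simp
            also have "\<dots> = \<bar>b n\<bar> * real n powr (-1-\<epsilon>) * fejer w (ln (real N) - ln (real n))"
              using fejer_nonneg[OF w0] by (simp add: f_def abs_mult)
            also have "\<dots> \<le> C * (1 / real n) * (4 / (w * (ln (real N) - ln (real n))\<^sup>2))"
              using b[of n] p C fejer_nonneg[OF w0] by (intro mult_mono fejer_le w0 u) auto
            also have "\<dots> = C * (4 / w) * (1 / (real n * (ln (real N) - ln (real n))\<^sup>2))" by simp
            finally show "- f n \<le> C * (4 / w) * (1 / (real n * (ln (real N) - ln (real n))\<^sup>2))" .
          qed
          also have "\<dots> = C * (4 / w) * (\<Sum>n\<in>F. 1 / (real n * (ln (real N) - ln (real n))\<^sup>2))"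
            by (rule sum_distrib_left[symmetric])
          also have "\<dots> \<le> C * (4 / w) * D"
            using elim C w0 unfolding F_def by (intro mult_left_mono) auto
          finally show ?thesis .
        qed
        ultimately show ?thesis using eq sA w2 by linarith
      qed
      have "J \<ge> \<eta> / 24 - \<eta> / 50"
      proof (rule LIMSEQ_le_const)
        show "(\<lambda>m. \<Sum>n<m. f n) \<longlonglongrightarrow> J" using J(1) by (simp add: sums_def f_def)
        show "\<exists>m0. \<forall>m\<ge>m0. \<eta> / 24 - \<eta> / 50 \<le> (\<Sum>n<m. f n)"
          using low by (intro exI[of _ "Suc (N + K)"]) auto
      qed
      then show False using J(2) elim \<eta> by (simp add: abs_le_iff)
    qed
  qed
qed

text \<open>Replacing $n^{-s} - (n+1)^{-s}$ by $s n^{-s-1}$ in the partial summation of $\sum \alpha_n n^{-s}$ costs a term that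
  is holomorphic for Re $s > 0$. Hence the series of the means $\frac1n \sum_{k \le n} \alpha_k$ inherits the continuation.\<close>

definition summatory_defect :: "(nat \<Rightarrow> real) \<Rightarrow> complex \<Rightarrow> complex" where
  "summatory_defect \<alpha> s = (\<Sum>n. of_real (sum \<alpha> {1..n}) *
     ((-s) * of_nat n powr (-s-1) - (of_nat (Suc n) powr (-s) - of_nat n powr (-s))))"

section \<open>Means of the coefficients and the Tauberian theorem\<close>

text \<open>A partial sum of size n meets a tangent error of size n^(-Re s - 2), so the defect
  converges locally uniformly for Re s > 0. Removing it from the Abel-summed series leaves s times
  the series of the means.\<close>

lemma summatory_defect_holomorphic_sums:
  fixes \<alpha> :: "nat \<Rightarrow> real"
  assumes bd: "\<And>n. \<bar>sum \<alpha> {1..n}\<bar> \<le> C * real n"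
  shows "summatory_defect \<alpha> holomorphic_on {s. Re s > 0}"
    and "Re s > 1 \<Longrightarrow> (\<lambda>n. of_real (\<alpha> n) * of_nat n powr (-s)) sums G \<Longrightarrow>
      (\<lambda>n. of_real (sum \<alpha> {1..n} / real n) * of_nat n powr (-s)) sums ((G - summatory_defect \<alpha> s) / s)"
proof -
  have C: "C \<ge> 0" using order_trans[OF abs_ge_zero bd[of 1]] by simp
  define S where "S n = sum \<alpha> {1..n}" for n
  define r where "r n s = of_real (S n) * ((-s) * of_nat n powr (-s-1) - (of_nat (Suc n) powr (-s) - of_nat n powr (-s)))" for n and s :: complex
  have H_def: "summatory_defect \<alpha> s = (\<Sum>n. r n s)" for s
    by (simp only: summatory_defect_def r_def S_def)
  have rb: "norm (r n s) \<le> (C * norm s * (norm s + 1)) * real n powr (0 - 1 - Re s)" if "Re s > 0" for n s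
  proof (cases "n = 0")
    case True then show ?thesis by (simp add: r_def S_def)
  next
    case False
    have "norm (r n s) \<le> (C * real n) * (norm (-s) * norm (-s-1) * real n powr (Re (-s) - 2))"
      unfolding r_def norm_mult[of "of_real (S n)"] norm_of_real using False C that
      by (intro mult_mono bd[folded S_def] norm_diff2_powr_Suc_le) auto
    also have "\<dots> \<le> (C * real n) * (norm s * (norm s + 1) * real n powr (Re (-s) - 2))"
      using C norm_triangle_ineq4[of "-s" 1] by (intro mult_left_mono mult_right_mono mult_mono) auto
    also have "\<dots> = (C * norm s * (norm s + 1)) * (real n powr 1 * real n powr (Re (-s) - 2))"
      using False by simp
    also have "real n powr 1 * real n powr (Re (-s) - 2) = real n powr (0 - 1 - Re s)"
      by (subst powr_add[symmetric]) simp
    finally show ?thesis .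
  qed
  have rsum: "summable (\<lambda>n. r n s)" if "Re s > 0" for s
  proof (rule summable_comparison_test'[where N = 0])
    show "summable (\<lambda>n. (C * norm s * (norm s + 1)) * real n powr (0 - 1 - Re s))"
      using that by (intro summable_mult) (simp add: summable_real_powr_iff)
  qed (use rb[OF that] in auto)
  show "summatory_defect \<alpha> holomorphic_on {s. Re s > 0}"
    unfolding H_def[abs_def]
  proof (rule holomorphic_suminf_Re_gt[where B = "\<lambda>x. C * x * (x + 1)"])
    show "r n holomorphic_on {s. 0 < Re s}" for n
      unfolding r_def by (intro holomorphic_intros)
    show "0 \<le> C * x * (x + 1) \<and> C * x * (x + 1) \<le> C * y * (y + 1)" if "0 \<le> x" "x \<le> y" for x y
      using that C by (auto intro!: mult_mono)
  qed (use rb in auto)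
  assume s: "Re s > 1" and G: "(\<lambda>n. of_real (\<alpha> n) * of_nat n powr (-s)) sums G"
  define \<alpha>' where "\<alpha>' n = complex_of_real (\<alpha> n)" for n
  have S': "sum \<alpha>' {1..n} = of_real (S n)" for n by (simp add: \<alpha>'_def S_def)
  have n1: "norm (sum \<alpha>' {1..n}) \<le> C * real n powr 1" for n
    unfolding S' norm_of_real S_def using bd[of n] by (cases "n = 0") auto
  note ab = abel_dirichlet[of \<alpha>' C 1 s, OF n1 s]
  have "(\<lambda>n. of_real (S n) * (of_nat n powr (-s) - of_nat (Suc n) powr (-s))) sums G"
    using ab(1)[THEN summable_norm_cancel, THEN summable_sums] sums_unique2[OF ab(2)] G unfolding S' \<alpha>'_def by simp
  moreover have "(\<lambda>n. r n s) sums summatory_defect \<alpha> s" unfolding H_def using rsum s by (intro summable_sums) auto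
  ultimately have "(\<lambda>n. (of_real (S n) * (of_nat n powr (-s) - of_nat (Suc n) powr (-s)) - r n s) / s) sums ((G - summatory_defect \<alpha> s) / s)"
    by (intro sums_divide sums_diff)
  moreover have "(of_real (S n) * (of_nat n powr (-s) - of_nat (Suc n) powr (-s)) - r n s) / s = of_real (sum \<alpha> {1..n} / real n) * of_nat n powr (-s)" for n
  proof (cases "n = 0")
    case True then show ?thesis by (simp add: r_def S_def)
  next
    case False
    have "(of_real (S n) * (of_nat n powr (-s) - of_nat (Suc n) powr (-s)) - r n s) = s * (of_real (S n) * of_nat n powr (-s-1))"
      by (simp add: r_def algebra_simps)
    moreover have "of_nat n powr (-s-1) = (of_nat n powr (-s) / of_nat n :: complex)"
      using False by (simp add: powr_diff)
    moreover have "s \<noteq> 0" using s by auto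
    ultimately show ?thesis by (simp add: S_def)
  qed
  ultimately show "(\<lambda>n. of_real (sum \<alpha> {1..n} / real n) * of_nat n powr (-s)) sums ((G - summatory_defect \<alpha> s) / s)"
    by simp
qed

text \<open>The one-sided bound on \<alpha> prevents the partial sums from falling quickly. A large
  positive mean at N therefore persists on an interval to the right of N, and a large negative mean
  must already have been present on an interval to the left. Either contradicts the local result at
  the centre of that interval, since the series of the means continues across Re s = 1.\<close>

theorem tauberian_bounded_below:
  fixes \<alpha> :: "nat \<Rightarrow> real"
  assumes low: "\<And>n. \<alpha> n \<ge> -c" "c > 0"
    and bd: "\<And>n. \<bar>sum \<alpha> {1..n}\<bar> \<le> C * real n"
    and U: "open U" "{s. Re s \<ge> 1} \<subseteq> U" "G holomorphic_on U"
    and G: "\<And>s. Re s > 1 \<Longrightarrow> (\<lambda>n. of_real (\<alpha> n) * of_nat n powr (-s)) sums G s"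
  shows "(\<lambda>n. sum \<alpha> {1..n} / real n) \<longlonglongrightarrow> 0"
proof -
  define S where "S n = sum \<alpha> {1..n}" for n
  define b where "b n = S n / real n" for n
  have C: "C \<ge> 0" using order_trans[OF abs_ge_zero bd[of 1]] by simp
  have bb: "\<bar>b n\<bar> \<le> C" for n
    using bd[of n] C by (cases "n = 0") (auto simp: b_def S_def field_simps)
  then have bb': "\<bar>- b n\<bar> \<le> C" for n by simp
  define V where "V = U \<inter> {s. Re s > 0}"
  define g where "g s = (G s - summatory_defect \<alpha> s) / s" for s
  note sd = summatory_defect_holomorphic_sums[of \<alpha>, OF bd]
  have V: "open V" "{s. Re s \<ge> 1} \<subseteq> V" "g holomorphic_on V"
  proof -
    show "open V" unfolding V_def using U open_Re_gt by blast
    show "{s. Re s \<ge> 1} \<subseteq> V" using U by (auto simp: V_def)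
    show "g holomorphic_on V"
      unfolding g_def using U(3) sd(1)
      by (intro holomorphic_intros) (auto simp: V_def intro: holomorphic_on_subset)
  qed
  have gs: "(\<lambda>n. of_real (b n) * of_nat n powr (-s)) sums g s" if "Re s > 1" for s
    unfolding b_def S_def g_def by (rule sd(2)[OF that G[OF that]])
  have gs': "(\<lambda>n. of_real (- b n) * of_nat n powr (-s)) sums (- g s)" if "Re s > 1" for s
    using sums_minus[OF gs[OF that]] by simp
  have V': "(\<lambda>s. - g s) holomorphic_on V" using V by (intro holomorphic_intros)
  have mono: "S n - S m \<ge> - c * (real n - real m)" if "m \<le> n" for m n
  proof -
    have "{1..n} = {1..m} \<union> {m<..n}" using that by auto
    then have "S n = S m + sum \<alpha> {m<..n}" unfolding S_def by (simp only:) (rule sum.union_disjoint, auto)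
    moreover have "sum \<alpha> {m<..n} \<ge> real (card {m<..n}) * (- c)" using low by (intro sum_bounded_below) auto
    ultimately show ?thesis using that by (simp add: of_nat_diff mult.commute)
  qed
  have up: "\<forall>\<^sub>F N in sequentially. b N < \<eta>" if \<eta>: "\<eta> > 0" for \<eta>
  proof -
    \<comment> \<open>Over a stretch of length \<delta> N the partial sum loses at most c \<delta> N
      \<le> \<eta> N / 2, half of what it has at N.\<close>
    define \<delta> where "\<delta> = min 1 (\<eta> / (2 * c))"
    have \<delta>: "0 < \<delta>" "\<delta> \<le> 1" "c * \<delta> \<le> \<eta> / 2" using \<eta> low(2) by (auto simp: \<delta>_def min_def field_simps)
    \<comment> \<open>Midpoint of [N, N + \<delta> N]. As f N \<le> 3N/2, a window of relative
      radius \<delta>/4 about it has radius at most 3 \<delta> N / 8, and \<delta> N \<ge> 8 lets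
      the remaining \<delta> N / 8 absorb the rounding.\<close>
    define f where "f N = N + nat \<lfloor>\<delta> * real N / 2\<rfloor>" for N
    have "filterlim f at_top sequentially"
      by (rule filterlim_at_top_mono[OF filterlim_ident]) (auto simp: f_def)
    moreover have "\<forall>\<^sub>F N in sequentially. \<not> (\<forall>n. \<bar>real n - real N\<bar> \<le> (\<delta>/4) * real N \<longrightarrow> b n \<ge> \<eta>/4)"
      using \<eta> \<delta> by (intro eventually_not_locally_bounded_below[OF bb V gs]) auto
    ultimately have "\<forall>\<^sub>F N in sequentially. \<not> (\<forall>n. \<bar>real n - real (f N)\<bar> \<le> (\<delta>/4) * real (f N) \<longrightarrow> b n \<ge> \<eta>/4)"
      by (rule eventually_compose_filterlim[rotated])
    moreover have "\<forall>\<^sub>F N in sequentially. \<delta> * real N \<ge> 8"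
      using \<delta> by real_asymp
    ultimately show ?thesis using eventually_gt_at_top[of 0]
    proof eventually_elim
      case (elim N)
      show ?case
      proof (rule ccontr)
        assume "\<not> b N < \<eta>"
        then have SN: "S N \<ge> \<eta> * real N" using elim by (simp add: b_def field_simps)
        have f: "real (f N) \<ge> real N + \<delta> * real N / 2 - 1" "real (f N) \<le> real N + \<delta> * real N / 2"
          using \<delta> of_nat_floor[of "\<delta> * real N / 2"] by (auto simp: f_def)
        have d1: "\<delta> * real N \<le> real N" using \<delta> by (simp add: mult_left_le_one_le)
        have "b n \<ge> \<eta>/4" if n: "\<bar>real n - real (f N)\<bar> \<le> (\<delta>/4) * real (f N)" for n
        proof -
          have "(\<delta>/4) * real (f N) \<le> (\<delta>/4) * (3/2 * real N)"
            using f(2) d1 \<delta> by (intro mult_left_mono) auto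
          then have "\<bar>real n - real (f N)\<bar> \<le> 3/8 * (\<delta> * real N)" using n by simp
          then have n2: "real n \<ge> real N" "real n \<le> real N + \<delta> * real N" using f elim by linarith+
          have m: "S n \<ge> S N - c * (real n - real N)" using mono[of N n] n2 by simp
          have "c * (real n - real N) \<le> c * (\<delta> * real N)" using n2 low(2) by (intro mult_left_mono) auto
          also have "\<dots> \<le> \<eta> / 2 * real N" using \<delta>(3) mult_right_mono[of "c * \<delta>" "\<eta>/2" "real N"] by (simp add: mult.assoc)
          finally have "S n \<ge> \<eta> / 2 * real N" using SN m by linarith
          moreover have "\<eta> / 4 * real n \<le> \<eta> / 4 * (2 * real N)" using n2 d1 \<eta> by (intro mult_left_mono) auto
          ultimately have "S n \<ge> \<eta> / 4 * real n" by simp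
          moreover have "real n > 0" using n2 elim by linarith
          ultimately show ?thesis by (simp add: b_def field_simps)
        qed
        then show False using elim by blast
      qed
    qed
  qed
  have dn: "\<forall>\<^sub>F N in sequentially. - b N < \<eta>" if \<eta>: "\<eta> > 0" for \<eta>
  proof -
    define \<delta> where "\<delta> = min 1 (\<eta> / (2 * c))"
    have \<delta>: "0 < \<delta>" "\<delta> \<le> 1" "c * \<delta> \<le> \<eta> / 2" using \<eta> low(2) by (auto simp: \<delta>_def min_def field_simps)
    \<comment> \<open>The mirror image: the midpoint of [N - \<delta> N, N], since a negative mean
      extends to the left.\<close>
    define f where "f N = nat \<lfloor>(1 - \<delta>/2) * real N\<rfloor>" for N
    have "filterlim f at_top sequentially"
    proof (rule filterlim_at_top_mono)
      show "filterlim (\<lambda>N. nat \<lfloor>real N / 2\<rfloor>) at_top sequentially" by real_asymp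
      have "real N / 2 \<le> (1 - \<delta>/2) * real N" for N
        using \<delta> mult_right_mono[of "1/2" "1 - \<delta>/2" "real N"] by simp
      then show "\<forall>\<^sub>F N in sequentially. nat \<lfloor>real N / 2\<rfloor> \<le> f N"
        unfolding f_def by (intro always_eventually allI nat_mono floor_mono)
    qed
    moreover have "\<forall>\<^sub>F N in sequentially. \<not> (\<forall>n. \<bar>real n - real N\<bar> \<le> (\<delta>/4) * real N \<longrightarrow> - b n \<ge> \<eta>/4)"
      using \<eta> \<delta> by (intro eventually_not_locally_bounded_below[OF bb' V(1,2) V' gs']) auto
    ultimately have "\<forall>\<^sub>F N in sequentially. \<not> (\<forall>n. \<bar>real n - real (f N)\<bar> \<le> (\<delta>/4) * real (f N) \<longrightarrow> - b n \<ge> \<eta>/4)"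
      by (rule eventually_compose_filterlim[rotated])
    moreover have "\<forall>\<^sub>F N in sequentially. \<delta> * real N \<ge> 8"
      using \<delta> by real_asymp
    ultimately show ?thesis using eventually_gt_at_top[of 0]
    proof eventually_elim
      case (elim N)
      show ?case
      proof (rule ccontr)
        assume "\<not> - b N < \<eta>"
        then have SN: "S N \<le> - \<eta> * real N" using elim by (simp add: b_def field_simps)
        have d1: "\<delta> * real N \<le> real N" using \<delta> by (simp add: mult_left_le_one_le)
        have "(1 - \<delta>/2) * real N \<ge> 0" using \<delta> by simp
        then have f: "real (f N) \<ge> (1 - \<delta>/2) * real N - 1" "real (f N) \<le> (1 - \<delta>/2) * real N"
          by (auto simp: f_def)
        then have f': "real (f N) \<ge> real N - \<delta> * real N/2 - 1" "real (f N) \<le> real N - \<delta> * real N/2"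
          by (simp_all add: algebra_simps)
        have "- b n \<ge> \<eta>/4" if n: "\<bar>real n - real (f N)\<bar> \<le> (\<delta>/4) * real (f N)" for n
        proof -
          have "(\<delta>/4) * real (f N) \<le> (\<delta>/4) * (real N)"
            using f'(2) \<delta> elim by (intro mult_left_mono) auto
          then have "\<bar>real n - real (f N)\<bar> \<le> 1/4 * (\<delta> * real N)" using n by simp
          then have n2: "real n \<le> real N" "real n \<ge> real N - \<delta> * real N" "real n \<ge> 1" using f' elim d1 by linarith+
          have m: "S n \<le> S N + c * (real N - real n)" using mono[of n N] n2 by simp
          have "c * (real N - real n) \<le> c * (\<delta> * real N)" using n2 low(2) by (intro mult_left_mono) auto
          also have "\<dots> \<le> \<eta> / 2 * real N" using \<delta>(3) mult_right_mono[of "c * \<delta>" "\<eta>/2" "real N"] by (simp add: mult.assoc)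
          finally have "- S n \<ge> \<eta> / 2 * real N" using SN m by linarith
          moreover have "\<eta> / 4 * real n \<le> \<eta> / 2 * real N" using n2 \<eta> by (intro mult_mono) auto
          ultimately have "- S n \<ge> \<eta> / 4 * real n" by simp
          then show ?thesis using n2 by (simp add: b_def field_simps)
        qed
        then show False using elim by blast
      qed
    qed
  qed
  have "b \<longlonglongrightarrow> 0"
  proof (rule tendstoI)
    fix e :: real assume "e > 0"
    from up[OF this] dn[OF this] show "\<forall>\<^sub>F N in sequentially. dist (b N) 0 < e"
      by eventually_elim (auto simp: abs_less_iff)
  qed
  then show ?thesis by (simp add: b_def[abs_def] S_def)
qed

section \<open>L-functions of Dirichlet characters\<close>

text \<open>The continuation of $(s - 1) \zeta(s)$: for constant coefficients the means coincide with the coefficients.\<close>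

definition zeta_reg :: "complex \<Rightarrow> complex" where
  "zeta_reg s = - summatory_defect (\<lambda>_. 1) s"

section \<open>The zeta function and its pole\<close>

lemma summable_norm_powr: "Re s > 1 \<Longrightarrow> summable (\<lambda>n. norm (of_nat n powr (-s) :: complex))"
proof -
  assume s: "Re s > 1"
  have "norm (of_nat n powr (-s) :: complex) = real n powr (- Re s)" for n
    by (cases "n = 0") (auto simp: norm_of_nat_powr)
  then show ?thesis using s by (simp add: summable_real_powr_iff)
qed

lemma zeta_reg_holomorphic: "zeta_reg holomorphic_on {s. Re s > 0}"
  unfolding zeta_reg_def[abs_def]
  by (intro holomorphic_intros summatory_defect_holomorphic_sums(1)[where C = 1]) simp

text \<open>For \<alpha> = 1 the series of the means is the zeta series again, so the general
  formula reads z = (z - H)/s with H the defect; solving this linear equation exhibits the pole at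
  1.\<close>

lemma zeta_sums:
  assumes s: "Re s > 1"
  shows "(\<lambda>n. of_nat n powr (-s)) sums (zeta_reg s / (s - 1))"
proof -
  define z where "z = (\<Sum>n. of_nat n powr (-s) :: complex)"
  have z: "(\<lambda>n. of_nat n powr (-s)) sums z"
    unfolding z_def using summable_norm_powr[OF s] by (intro summable_sums) (rule summable_norm_cancel)
  then have "(\<lambda>n. of_real 1 * of_nat n powr (-s)) sums z" by simp
  from summatory_defect_holomorphic_sums(2)[of "\<lambda>_. 1" 1, OF _ s this]
  have "(\<lambda>n. of_real (sum (\<lambda>_. 1) {1..n} / real n) * of_nat n powr (-s)) sums ((z - summatory_defect (\<lambda>_. 1) s) / s)"
    by simp
  moreover have "of_real (sum (\<lambda>_. 1) {1..n} / real n) * of_nat n powr (-s) = of_nat n powr (-s)" for n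
    by (cases "n = 0") auto
  ultimately have "(\<lambda>n. of_nat n powr (-s)) sums ((z - summatory_defect (\<lambda>_. 1) s) / s)" by (simp only:)
  with z have eq: "z = (z - summatory_defect (\<lambda>_. 1) s) / s" by (rule sums_unique2)
  have s0: "s \<noteq> 0" "s - 1 \<noteq> 0" using s by auto
  have "z * s = z + zeta_reg s" using eq s0 by (simp add: zeta_reg_def nonzero_eq_divide_eq)
  then have "z * (s - 1) = zeta_reg s" by (simp add: algebra_simps)
  then have "z = zeta_reg s / (s - 1)" using s0 by (simp add: nonzero_eq_divide_eq)
  with z show ?thesis by simp
qed

text \<open>At s = 1 each term of the defect collapses to 1/(n+1) - 1/n, so the series telescopes to
  -1. This is the residue 1 of the zeta function.\<close>

lemma zeta_reg_1: "zeta_reg 1 = 1"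
proof -
  \<comment> \<open>The value 1 at n = 0 makes the first difference vanish, as does the summand with
    index 0.\<close>
  define f where "f n = (if n = 0 then 1 else 1 / of_nat n :: complex)" for n :: nat
  have "(\<lambda>n. 1 / of_nat n :: complex) \<longlonglongrightarrow> 0" by (rule lim_1_over_n)
  then have "f \<longlonglongrightarrow> 0"
    by (rule Lim_transform_eventually) (use eventually_gt_at_top[of 0] in eventually_elim, simp add: f_def)
  then have "(\<lambda>n. f (Suc n) - f n) sums (0 - f 0)" by (rule telescope_sums)
  moreover have "f (Suc n) - f n = of_real (sum (\<lambda>_. 1) {1..n}) *
     ((-1) * of_nat n powr (-1-1) - (of_nat (Suc n) powr (-1) - of_nat n powr (-1)))" for n
  proof (cases "n = 0")
    case False
    have p1: "of_nat m powr (-1) = (1 / of_nat m :: complex)" if "m > 0" for m :: nat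
      using that by (simp add: powr_minus divide_inverse)
    have "of_nat n powr (-1-1) = (of_nat n powr (-1) / of_nat n powr 1 :: complex)"
      using False by (subst powr_diff[symmetric]) simp
    then have p2: "of_nat n powr (-1-1) = (1 / of_nat n / of_nat n :: complex)"
      using False p1[of n] by simp
    have nz: "of_nat (Suc n) \<noteq> (0::complex)" "of_nat n \<noteq> (0::complex)" using False by (simp_all del: of_nat_Suc)
    have "n > 0" using False by simp
    have "f (Suc n) - f n = 1 / of_nat (Suc n) - 1 / of_nat n" using False by (simp add: f_def)
    also have "\<dots> = of_nat n * ((-1) * (1 / of_nat n / of_nat n) - (1 / of_nat (Suc n) - 1 / of_nat n))"
    proof -
      have "of_nat (Suc n) = of_nat n + (1::complex)" by simp
      moreover have "1 / (x + 1) - 1 / x = x * ((-1) * (1 / x / x) - (1 / (x + 1) - 1 / x))" if "x \<noteq> 0" "x + 1 \<noteq> 0" for x :: complex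
        using that by (simp add: divide_simps)
      ultimately show ?thesis using nz by metis
    qed
    finally show ?thesis unfolding p2 p1[of "Suc n", OF zero_less_Suc] p1[OF \<open>n > 0\<close>] by simp
  qed (simp add: f_def)
  ultimately have "(\<lambda>n. of_real (sum (\<lambda>_. 1) {1..n}) *
     ((-1) * of_nat n powr (-1-1) - (of_nat (Suc n) powr (-1) - of_nat n powr (-1)))) sums (- (1::complex))"
    by (simp add: f_def)
  then show ?thesis unfolding zeta_reg_def summatory_defect_def by (simp only: sums_iff minus_minus)
qed

section \<open>Rearrangement by divisors and Dirichlet products\<close>

text \<open>Grouping the pairs (d, k) by their product n = d k. It serves the Dirichlet product of
  two series as well as the Lambert series.\<close>

lemma has_sum_divisors_rearrange:
  fixes h :: "nat \<times> nat \<Rightarrow> 'a :: {topological_comm_monoid_add, t3_space}"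
  assumes "(h has_sum S) ({1..} \<times> {1..})"
  shows "((\<lambda>n. \<Sum>d | d dvd n. h (d, n div d)) has_sum S) {1..}"
proof (rule has_sum_SigmaD)
  have "(h has_sum S) ({1..} \<times> {1..}) \<longleftrightarrow> ((\<lambda>(n, d). h (d, n div d)) has_sum S) (Sigma {1..} (\<lambda>n. {d. d dvd n}))"
  proof (rule has_sum_reindex_bij_witness[where i = "\<lambda>(n, d). (d, n div d)" and j = "\<lambda>(d, k). (d * k, d)"], goal_cases)
    case (2 a) then show ?case by (auto simp: Suc_le_eq)
  next
    case (4 b) then show ?case by (auto simp: Suc_le_eq elim!: dvdE)
  qed auto
  with assms show "((\<lambda>(n, d). h (d, n div d)) has_sum S) (Sigma {1..} (\<lambda>n. {d. d dvd n}))" by simp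
  show "((\<lambda>y. case (x, y) of (n, d) \<Rightarrow> h (d, n div d)) has_sum (\<Sum>d | d dvd x. h (d, x div d))) {d. d dvd x}" if "x \<in> {1..}" for x
    using that by (auto intro!: has_sum_finite finite_divisors_nat)
qed

text \<open>Absolute convergence makes the double family summable, and grouping it by products gives
  the convolution. Index 0, which has infinitely many divisors, is left out and returns only as a
  zero term.\<close>

lemma dirichlet_product_sums:
  fixes u v :: "nat \<Rightarrow> complex"
  assumes u: "summable (\<lambda>n. norm (u n * of_nat n powr (-s)))" and v: "summable (\<lambda>n. norm (v n * of_nat n powr (-s)))"
  shows "(\<lambda>n. (\<Sum>d | d dvd n. u d * v (n div d)) * of_nat n powr (-s)) sums
           ((\<Sum>n. u n * of_nat n powr (-s)) * (\<Sum>n. v n * of_nat n powr (-s)))"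
proof -
  define f where "f n = u n * of_nat n powr (-s)" for n
  define g where "g n = v n * of_nat n powr (-s)" for n
  have f: "(f has_sum (\<Sum>n. f n)) {1..}" "summable (\<lambda>n. norm (f n))"
   and g: "(g has_sum (\<Sum>n. g n)) {1..}" "summable (\<lambda>n. norm (g n))"
  proof -
    have gen: "(F has_sum (\<Sum>n. F n)) {1..}" if "summable (\<lambda>n. norm (F n))" "F 0 = 0" for F :: "nat \<Rightarrow> complex"
    proof -
      have "(F has_sum (\<Sum>n. F n)) UNIV"
        by (rule norm_summable_imp_has_sum) (use that summable_norm_cancel[OF that(1)] in \<open>auto intro: summable_sums\<close>)
      then show ?thesis
        by (rule has_sum_cong_neutral[THEN iffD1, rotated -1]) (use that in \<open>auto simp: not_le\<close>)
    qed
    show "summable (\<lambda>n. norm (f n))" "summable (\<lambda>n. norm (g n))" using u v by (simp_all add: f_def g_def)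
    then show "(f has_sum (\<Sum>n. f n)) {1..}" "(g has_sum (\<Sum>n. g n)) {1..}"
      using gen[of f] gen[of g] by (auto simp: f_def g_def)
  qed
  have fa: "(\<lambda>n. norm (f n)) summable_on {1..}" "(\<lambda>n. norm (g n)) summable_on {1..}"
    using norm_summable_imp_summable_on[of "\<lambda>n. norm (f n)"] norm_summable_imp_summable_on[of "\<lambda>n. norm (g n)"] f(2) g(2)
    by (auto intro: summable_on_subset_banach[of _ UNIV])
  have "((\<lambda>(a, b). f a * g b) has_sum ((\<Sum>n. f n) * (\<Sum>n. g n))) ({1..} \<times> {1..})"
  proof (rule has_sum_SigmaI[where g = "\<lambda>a. f a * (\<Sum>n. g n)"])
    show "((\<lambda>b. case (a, b) of (a, b) \<Rightarrow> f a * g b) has_sum f a * (\<Sum>n. g n)) {1..}" for a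
      using has_sum_cmult_right[OF g(1)] by simp
    show "((\<lambda>a. f a * (\<Sum>n. g n)) has_sum (\<Sum>n. f n) * (\<Sum>n. g n)) {1..}"
      by (rule has_sum_cmult_left[OF f(1)])
    show "(\<lambda>(a, b). f a * g b) summable_on {1..} \<times> {1..}"
    proof (rule abs_summable_summable)
      show "(\<lambda>x. norm (case x of (a, b) \<Rightarrow> f a * g b)) summable_on {1..} \<times> {1..}"
        unfolding Infinite_Sum.abs_summable_on_Sigma_iff
        using fa by (auto simp: norm_mult infsum_cmult_right abs_mult intro!: summable_on_cmult_right summable_on_cmult_left)
    qed
  qed
  from has_sum_divisors_rearrange[OF this]
  have "((\<lambda>n. \<Sum>d | d dvd n. f d * g (n div d)) has_sum ((\<Sum>n. f n) * (\<Sum>n. g n))) {1..}" by simp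
  also have "?this \<longleftrightarrow> ((\<lambda>n. (\<Sum>d | d dvd n. u d * v (n div d)) * of_nat n powr (-s)) has_sum ((\<Sum>n. f n) * (\<Sum>n. g n))) UNIV"
  proof (rule has_sum_cong_neutral)
    fix n :: nat assume "n \<in> {1..} \<inter> UNIV"
    then have n: "n > 0" by simp
    have "f d * g (n div d) = u d * v (n div d) * of_nat n powr (-s)" if "d dvd n" for d
    proof -
      have "of_nat d powr (-s) * of_nat (n div d) powr (-s) = (of_nat (d * (n div d)) powr (-s) :: complex)"
        using powr_times_real[of "of_nat d" "of_nat (n div d)" "-s"] by simp
      then show ?thesis using that by (simp add: f_def g_def mult_ac)
    qed
    then show "(\<Sum>d | d dvd n. f d * g (n div d)) = (\<Sum>d | d dvd n. u d * v (n div d)) * of_nat n powr (-s)"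
      by (simp add: sum_distrib_right)
  qed (auto simp: not_le)
  finally show ?thesis unfolding f_def g_def by (rule has_sum_imp_sums)
qed

section \<open>Dirichlet characters and the continuation of their L-series\<close>

text \<open>Full periods contribute nothing, so a sum of any length reduces to fewer than Q
  terms.\<close>

lemma norm_sum_periodic_le:
  fixes f :: "nat \<Rightarrow> complex"
  assumes per: "\<And>n. f (n + Q) = f n" and Q: "Q > 0" and z: "(\<Sum>k<Q. f k) = 0" and B: "\<And>n. norm (f n) \<le> B"
  shows "norm (\<Sum>k<n. f k) \<le> B * real Q"
proof (induction n rule: less_induct)
  case (less n)
  show ?case
  proof (cases "n < Q")
    case True
    have "norm (\<Sum>k<n. f k) \<le> (\<Sum>k<n. B)" by (intro sum_norm_le B)
    also have "\<dots> \<le> B * real Q" using True order_trans[OF norm_ge_zero B[of 0]] by (simp add: mult.commute mult_left_mono)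
    finally show ?thesis .
  next
    case False
    have shift: "(\<Sum>k<Q + m. f k) = (\<Sum>k<m. f k)" for m
    proof (induction m)
      case (Suc m)
      have "f (Q + m) = f m" using per[of m] by (simp add: add.commute)
      then show ?case using Suc by simp
    qed (use z in simp)
    have "(\<Sum>k<n. f k) = (\<Sum>k<n - Q. f k)" using shift[of "n - Q"] False by simp
    then show ?thesis using less.IH[of "n - Q"] Q False by simp
  qed
qed

text \<open>A Dirichlet character as a function on the naturals. Trivial and imprimitive characters
  are included, and Q = 1 yields the zeta function.\<close>

locale dchar =
  fixes Q :: nat and \<xi> :: "nat \<Rightarrow> complex"
  assumes Q_pos: "Q > 0"
    and mult: "\<xi> (m * n) = \<xi> m * \<xi> n"
    and periodic: "\<xi> (n + Q) = \<xi> n"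
    and norm_coprime: "coprime n Q \<Longrightarrow> norm (\<xi> n) = 1"
    and not_coprime: "\<not> coprime n Q \<Longrightarrow> \<xi> n = 0"
begin

lemma norm_le_1: "norm (\<xi> n) \<le> 1"
  by (cases "coprime n Q") (auto simp: norm_coprime not_coprime)

lemma one: "\<xi> 1 = 1"
proof -
  have "\<xi> 1 * \<xi> 1 = \<xi> 1" using mult[of 1 1] by simp
  moreover have "\<xi> 1 \<noteq> 0" using norm_coprime[of 1] by auto
  ultimately show ?thesis by simp
qed

lemma xi_mod: "\<xi> (n mod Q) = \<xi> n"
proof -
  have "\<xi> (m + k * Q) = \<xi> m" for m k
  proof (induction k)
    case (Suc k) then show ?case using periodic[of "m + k * Q"] by (simp add: algebra_simps)
  qed simp
  from this[of "n mod Q" "n div Q"] show ?thesis by simp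
qed

lemma cong_imp_eq: "[m = n] (mod Q) \<Longrightarrow> \<xi> m = \<xi> n"
  by (metis xi_mod cong_def)

definition trivial_char where "trivial_char \<longleftrightarrow> (\<forall>n. coprime n Q \<longrightarrow> \<xi> n = 1)"

text \<open>The residue of the L-series at s = 1. Subtracting it from the coefficients makes their
  partial sums bounded for every character, trivial or not.\<close>

definition mean where "mean = (\<Sum>k<Q. \<xi> k) / of_nat Q"

text \<open>Orthogonality: multiplication by a permutes the residues and multiplies the sum by
  \<xi>(a), which is not 1.\<close>

lemma mean_nontrivial:
  assumes "\<not> trivial_char"
  shows "mean = 0"
proof -
  obtain a where a: "coprime a Q" "\<xi> a \<noteq> 1" using assms by (auto simp: trivial_char_def)
  have inj: "inj_on (\<lambda>k. a * k mod Q) {..<Q}"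
  proof (rule inj_onI)
    fix x y assume xy: "x \<in> {..<Q}" "y \<in> {..<Q}" "a * x mod Q = a * y mod Q"
    then have "[a * x = a * y] (mod Q)" by (simp add: cong_def)
    then have "[x = y] (mod Q)" using a(1) by (simp add: cong_mult_lcancel_nat)
    then show "x = y" using xy by (simp add: cong_def)
  qed
  have "(\<lambda>k. a * k mod Q) ` {..<Q} \<subseteq> {..<Q}" using Q_pos by auto
  then have surj: "(\<lambda>k. a * k mod Q) ` {..<Q} = {..<Q}" using inj by (intro endo_inj_surj) auto
  have "(\<Sum>k<Q. \<xi> k) = (\<Sum>k\<in>(\<lambda>k. a * k mod Q) ` {..<Q}. \<xi> k)" by (simp only: surj)
  also have "\<dots> = (\<Sum>k<Q. \<xi> (a * k))" by (subst sum.reindex[OF inj]) (simp add: xi_mod)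
  also have "\<dots> = \<xi> a * (\<Sum>k<Q. \<xi> k)" by (simp add: mult sum_distrib_left)
  finally have "(1 - \<xi> a) * (\<Sum>k<Q. \<xi> k) = 0" by (simp add: algebra_simps)
  then show ?thesis using a by (simp add: mean_def)
qed

lemma mean_trivial:
  assumes "trivial_char"
  shows "mean \<noteq> 0"
proof -
  have "\<xi> k = (if coprime k Q then 1 else 0)" for k
    using assms not_coprime by (auto simp: trivial_char_def)
  then have "(\<Sum>k<Q. \<xi> k) = of_nat (card {k\<in>{..<Q}. coprime k Q})"
    by (simp add: sum.If_cases Int_def)
  \<comment> \<open>Reduced modulo Q so that Q = 1, where the only residue is 0, is covered.\<close>
  moreover have "1 mod Q \<in> {k\<in>{..<Q}. coprime k Q}" using Q_pos by (auto simp: mod_if)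
  then have "card {k\<in>{..<Q}. coprime k Q} > 0" by (subst card_gt_0_iff) auto
  then have "(of_nat (card {k\<in>{..<Q}. coprime k Q}) :: complex) \<noteq> 0" by (simp only: of_nat_eq_0_iff)
  ultimately have "(\<Sum>k<Q. \<xi> k) \<noteq> 0" by simp
  then show ?thesis using Q_pos by (simp add: mean_def)
qed

definition E where "E n = (\<Sum>k=1..n. \<xi> k - mean)"

lemma norm_E_le: "norm (E n) \<le> 2 * real Q"
proof -
  define f where "f k = \<xi> (Suc k) - mean" for k
  have nm: "norm mean \<le> 1"
  proof -
    have "norm (\<Sum>k<Q. \<xi> k) \<le> (\<Sum>k<Q. 1)" by (intro sum_norm_le norm_le_1)
    then show ?thesis using Q_pos by (simp add: mean_def norm_divide)
  qed
  have "norm (\<Sum>k<n. f k) \<le> 2 * real Q"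
  proof (rule norm_sum_periodic_le)
    show "f (k + Q) = f k" for k using periodic[of "Suc k"] by (simp add: f_def)
    have "(\<Sum>k<Q. \<xi> (Suc k)) = (\<Sum>k<Suc Q. \<xi> k) - \<xi> 0" by (subst sum.lessThan_Suc_shift) simp
    also have "\<dots> = (\<Sum>k<Q. \<xi> k)" using periodic[of 0] by simp
    finally show "(\<Sum>k<Q. f k) = 0" using Q_pos by (simp add: f_def sum_subtractf mean_def)
    show "norm (f k) \<le> 2" for k
      using norm_triangle_ineq4[of "\<xi> (Suc k)" mean] norm_le_1[of "Suc k"] nm by (simp add: f_def)
  qed (rule Q_pos)
  moreover have "(\<Sum>k<n. f k) = E n" unfolding E_def f_def by (rule sum.reindex_bij_witness[of _ "\<lambda>k. k - 1" Suc]) auto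
  ultimately show ?thesis by simp
qed

text \<open>The L-series minus \<open>mean\<close> times the zeta series, in Abel-summed form: the
  bounded sums \<open>E n\<close> make this form converge absolutely and locally uniformly for Re s
  > 0.\<close>

definition Lr where "Lr s = (\<Sum>n. E n * (of_nat n powr (-s) - of_nat (Suc n) powr (-s)))"

lemma Lr_sums: "Re s > 0 \<Longrightarrow> (\<lambda>n. (\<xi> n - mean) * of_nat n powr (-s)) sums Lr s"
proof -
  assume s: "Re s > 0"
  have "norm (sum (\<lambda>k. \<xi> k - mean) {1..n}) \<le> (2 * real Q) * real n powr 0" for n
    using norm_E_le[of n] by (cases "n = 0") (auto simp: E_def)
  from abel_dirichlet(2)[OF this] s show ?thesis unfolding Lr_def E_def by simp
qed

lemma Lr_holomorphic: "Lr holomorphic_on {s. Re s > 0}"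
  unfolding Lr_def
proof (rule holomorphic_suminf_Re_gt[where B = "\<lambda>x. 2 * real Q * x"])
  show "(\<lambda>s. E n * (of_nat n powr (-s) - of_nat (Suc n) powr (-s))) holomorphic_on {s. Re s > 0}" for n
    by (intro holomorphic_intros)
  show "norm (E n * (of_nat n powr (-s) - of_nat (Suc n) powr (-s))) \<le> 2 * real Q * norm s * real n powr (0 - 1 - Re s)" if "Re s > 0" for n s
  proof (cases "n = 0")
    case False
    have "norm (E n * (of_nat n powr (-s) - of_nat (Suc n) powr (-s))) \<le> (2 * real Q) * (norm (-s) * real n powr (Re (-s) - 1))"
      unfolding norm_mult[of "E n"] using False that by (intro mult_mono norm_E_le norm_diff_powr_Suc_le) auto
    also have "Re (-s) - 1 = 0 - 1 - Re s" by simp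
    finally show ?thesis by (simp only: norm_minus_cancel mult.assoc)
  qed (simp add: E_def)
qed (auto intro!: mult_left_mono)

definition L where "L s = (\<Sum>n. \<xi> n * of_nat n powr (-s))"

lemma L_summable:
  assumes "Re s > 1"
  shows "summable (\<lambda>n. norm (\<xi> n * of_nat n powr (-s)))"
  by (rule summable_comparison_test'[OF summable_norm_powr[OF assms], of 0])
     (use norm_le_1 in \<open>auto simp: norm_mult intro: mult_left_le_one_le\<close>)

lemma L_eq:
  assumes s: "Re s > 1"
  shows "L s = Lr s + mean * (zeta_reg s / (s - 1))"
proof -
  have "(\<lambda>n. (\<xi> n - mean) * of_nat n powr (-s) + mean * of_nat n powr (-s)) sums (Lr s + mean * (zeta_reg s / (s - 1)))"
    using s by (intro sums_add Lr_sums sums_mult zeta_sums) auto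
  moreover have "(\<xi> n - mean) * of_nat n powr (-s) + mean * of_nat n powr (-s) = \<xi> n * of_nat n powr (-s)" for n
    by (simp add: algebra_simps)
  ultimately show ?thesis unfolding L_def by (simp add: sums_iff)
qed

text \<open>$L(s, \xi)$ continued to Re $s > 0$, multiplied by $s - 1$ if the character is trivial.\<close>

definition Lx where "Lx s = (if trivial_char then (s - 1) * Lr s + mean * zeta_reg s else Lr s)"

lemma Lx_holomorphic: "Lx holomorphic_on {s. Re s > 0}"
proof (cases trivial_char)
  case True
  then show ?thesis unfolding Lx_def[abs_def] using Lr_holomorphic zeta_reg_holomorphic
    by (auto intro!: holomorphic_intros)
qed (use Lr_holomorphic in \<open>simp add: Lx_def[abs_def]\<close>)

lemma Lx_eq: "Re s > 1 \<Longrightarrow> Lx s = (if trivial_char then s - 1 else 1) * L s"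
proof (cases trivial_char)
  case True
  assume s: "Re s > 1"
  then have "s - 1 \<noteq> 0" by auto
  then show ?thesis using True L_eq[OF s] by (simp add: Lx_def field_simps)
next
  case False
  assume s: "Re s > 1"
  show ?thesis using False L_eq[OF s] mean_nontrivial by (simp add: Lx_def)
qed

lemma Lx_1_trivial: "trivial_char \<Longrightarrow> Lx 1 \<noteq> 0"
  by (simp add: Lx_def zeta_reg_1 mean_trivial)

end

section \<open>Logarithmic derivative and non-vanishing for Re s > 1\<close>

lemma ln_mult_powr_le:
  assumes "\<delta> > 0"
  shows "ln (real n) * real n powr a \<le> (1 / \<delta>) * real n powr (\<delta> + a)"
proof (cases "n = 0")
  case False
  have "ln (real n) \<le> real n powr \<delta> / \<delta>" using False assms by (intro ln_powr_bound) auto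
  then have "ln (real n) * real n powr a \<le> (real n powr \<delta> / \<delta>) * real n powr a" by (intro mult_right_mono) auto
  then show ?thesis by (simp add: powr_add)
qed simp

lemma has_field_derivative_of_nat_powr:
  "((\<lambda>s. of_nat n powr (-s)) has_field_derivative (- of_real (ln (real n)) * of_nat n powr (-s))) (at (s::complex))"
proof (cases "n = 0")
  case False
  have Ln: "Ln (of_nat n) = of_real (ln (real n))"
    using False by (metis Ln_of_real of_nat_0_less_iff of_real_of_nat_eq gr0I)
  show ?thesis using False unfolding powr_def Ln by (auto intro!: derivative_eq_intros)
qed simp

text \<open>A telescoping majorant: the sum of n^(-3) over n \<ge> 2 is at most 1/2, which separates
  L(3) from 0.\<close>

lemma real_powr_m3_le: "real (n + 2) powr (-3) \<le> (1/2) * (1 / real (n + 1) - 1 / real (n + 2))"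
proof -
  have "real (n + 2) powr (-3) = 1 / (real (n + 2) * real (n + 2) * real (n+2))"
    by (simp add: powr_minus powr_numeral power3_eq_cube divide_inverse)
  also have "\<dots> \<le> 1 / (2 * real (n + 1) * real (n+2))"
  proof (rule divide_left_mono)
    have "2 * real (n + 1) * real (n + 2) \<le> (real (n+2) * real (n+2)) * real (n+2)"
      by (intro mult_right_mono) (auto simp: algebra_simps)
    then show "2 * real (n + 1) * real (n + 2) \<le> real (n + 2) * real (n + 2) * real (n+2)" .
  qed auto
  also have "\<dots> = (1/2) * (1 / real (n + 1) - 1 / real (n + 2))" by (simp add: field_simps)
  finally show ?thesis .
qed

context dchar
begin

text \<open>The Dirichlet series of $-L'/L$.\<close>

definition D where "D s = (\<Sum>n. mangoldt n * \<xi> n * of_nat n powr (-s))"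

lemma mangoldt_term_le:
  assumes "\<delta> > 0"
  shows "norm (mangoldt n * \<xi> n * of_nat n powr (-s)) \<le> (1 / \<delta>) * real n powr (\<delta> - Re s)"
proof (cases "n = 0")
  case False
  have "norm (mangoldt n * \<xi> n * of_nat n powr (-s)) \<le> ln (real n) * 1 * real n powr (- Re s)"
    unfolding norm_mult norm_mangoldt using False norm_le_1 mangoldt_le[of n] mangoldt_nonneg[of n]
    by (intro mult_mono) (auto simp: norm_of_nat_powr)
  also have "\<dots> \<le> (1 / \<delta>) * real n powr (\<delta> - Re s)"
    using ln_mult_powr_le[OF assms, of n "- Re s"] by simp
  finally show ?thesis .
qed simp

lemma D_summable:
  assumes "Re s > 1"
  shows "summable (\<lambda>n. norm (mangoldt n * \<xi> n * of_nat n powr (-s)))"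
proof (rule summable_comparison_test'[where N = 0])
  define \<delta> where "\<delta> = (Re s - 1) / 2"
  have \<delta>: "\<delta> > 0" "\<delta> - Re s < - 1" using assms by (auto simp: \<delta>_def field_simps)
  show "summable (\<lambda>n. (1 / \<delta>) * real n powr (\<delta> - Re s))"
    using \<delta> by (intro summable_mult) (simp add: summable_real_powr_iff)
  show "norm (norm (mangoldt n * \<xi> n * of_nat n powr (-s))) \<le> (1 / \<delta>) * real n powr (\<delta> - Re s)" for n
    using mangoldt_term_le[OF \<delta>(1)] by simp
qed

text \<open>The logarithm in the coefficients is absorbed by n^\<delta>, which costs \<delta> in the
  half-plane; the union over \<delta> > 0 recovers Re s > 1.\<close>

lemma D_holomorphic: "D holomorphic_on {s. Re s > 1}"
proof -
  have "D holomorphic_on {s. Re s > 1 + \<delta>}" if "\<delta> > 0" for \<delta>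
    unfolding D_def
  proof (rule holomorphic_suminf_Re_gt[where B = "\<lambda>_. 1 / \<delta>"])
    show "(\<lambda>s. mangoldt n * \<xi> n * of_nat n powr (-s)) holomorphic_on {s. Re s > 1 + \<delta>}" for n
      by (intro holomorphic_intros)
    show "norm (mangoldt n * \<xi> n * of_nat n powr (-s)) \<le> 1 / \<delta> * real n powr (1 + \<delta> - 1 - Re s)" for n s
      using mangoldt_term_le[OF that, of n s] by simp
  qed (use that in auto)
  then have "D holomorphic_on (\<Union>\<delta>\<in>{0<..}. {s. Re s > 1 + \<delta>})"
    by (intro holomorphic_on_UN_open open_Re_gt) auto
  moreover have "(\<Union>\<delta>\<in>{0<..}. {s::complex. Re s > 1 + \<delta>}) = {s. Re s > 1}"
  proof (intro equalityI subsetI)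
    fix s :: complex assume "s \<in> {s. Re s > 1}"
    then show "s \<in> (\<Union>\<delta>\<in>{0<..}. {s. Re s > 1 + \<delta>})" by (intro UN_I[of "(Re s - 1)/2"]) (auto simp: field_simps)
  qed auto
  ultimately show ?thesis by simp
qed

text \<open>The von Mangoldt function sums to ln n over the divisors of n, and complete
  multiplicativity pulls \<xi>(n) out of the convolution.\<close>

lemma D_mult_L_sums:
  assumes s: "Re s > 1"
  shows "(\<lambda>n. \<xi> n * of_real (ln (real n)) * of_nat n powr (-s)) sums (D s * L s)"
proof -
  have "(\<lambda>n. (\<Sum>d | d dvd n. (mangoldt d * \<xi> d) * \<xi> (n div d)) * of_nat n powr (-s)) sums (D s * L s)"
    unfolding D_def L_def by (rule dirichlet_product_sums[OF D_summable[OF s] L_summable[OF s]])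
  moreover have "(\<Sum>d | d dvd n. (mangoldt d * \<xi> d) * \<xi> (n div d)) * of_nat n powr (-s) = \<xi> n * of_real (ln (real n)) * of_nat n powr (-s)" for n
  proof (cases "n = 0")
    case False
    have "(\<Sum>d | d dvd n. (mangoldt d * \<xi> d) * \<xi> (n div d)) = (\<Sum>d | d dvd n. \<xi> n * mangoldt d)"
    proof (rule sum.cong)
      fix d assume "d \<in> {d. d dvd n}"
      then have "\<xi> n = \<xi> d * \<xi> (n div d)" using mult[of d "n div d"] by simp
      then show "(mangoldt d * \<xi> d) * \<xi> (n div d) = \<xi> n * mangoldt d" by simp
    qed simp
    also have "\<dots> = \<xi> n * of_real (ln (real n))" using False by (simp add: sum_distrib_left[symmetric] mangoldt_sum)
    finally show ?thesis by simp
  qed simp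
  ultimately show ?thesis by simp
qed

text \<open>Termwise differentiation produces the coefficients -\<xi>(n) ln n, whose series is -D L
  by the convolution identity. The form without a quotient presupposes no non-vanishing of
  L.\<close>

lemma L_deriv:
  assumes s: "Re s > 1"
  shows "(L has_field_derivative - (D s * L s)) (at s)"
proof -
  define f where "f n s = \<xi> n * of_nat n powr (-s)" for n and s :: complex
  define f' where "f' n s = \<xi> n * (- of_real (ln (real n)) * of_nat n powr (-s))" for n and s :: complex
  have "\<exists>g g'. \<forall>x\<in>{s. Re s > 1}. ((\<lambda>n. f n x) sums g x) \<and> ((\<lambda>n. f' n x) sums g' x) \<and> (g has_field_derivative g' x) (at x)"
  proof (rule series_and_derivative_comparison_complex[OF open_Re_gt])
    show "(f n has_field_derivative f' n x) (at x)" for n x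
      unfolding f_def f'_def by (intro DERIV_cmult has_field_derivative_of_nat_powr)
    fix x :: complex assume x: "x \<in> {s. Re s > 1}"
    define d where "d = (Re x - 1) / 2"
    define h where "h n = (of_real (real n powr (- 1 - d)) :: complex)" for n
    have d: "d > 0" using x by (simp add: d_def)
    have "summable (\<lambda>n. real n powr (- 1 - d))" using d by (simp add: summable_real_powr_iff)
    then have "summable h" unfolding h_def by (rule summable_of_real)
    moreover have "norm (f n y) \<le> norm (h n)" if "y \<in> ball x d" for n y
    proof (cases "n = 0")
      case False
      have "Re x - Re y \<le> norm (x - y)" using complex_Re_le_cmod[of "x - y"] by simp
      then have y: "Re y \<ge> 1 + d" using that by (simp add: dist_norm d_def field_simps)
      have "norm (f n y) \<le> 1 * real n powr (- Re y)"
        unfolding f_def norm_mult using norm_le_1 False by (intro mult_mono) (auto simp: norm_of_nat_powr)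
      also have "\<dots> \<le> real n powr (- 1 - d)" using y False by (auto intro!: powr_mono)
      finally show ?thesis by (simp add: h_def)
    qed (simp add: f_def)
    moreover have "range h \<subseteq> \<real>\<^sub>\<ge>\<^sub>0" by (auto simp: h_def)
    ultimately show "\<exists>d h. 0 < d \<and> summable h \<and> range h \<subseteq> \<real>\<^sub>\<ge>\<^sub>0 \<and> (\<forall>\<^sub>F n in sequentially. \<forall>y\<in>ball x d \<inter> {s. Re s > 1}. cmod (f n y) \<le> cmod (h n))"
      using d by (intro exI[of _ d] exI[of _ h]) auto
  qed
  then obtain g g' where g: "\<And>x. Re x > 1 \<Longrightarrow> (\<lambda>n. f n x) sums g x" "\<And>x. Re x > 1 \<Longrightarrow> (\<lambda>n. f' n x) sums g' x"
    "\<And>x. Re x > 1 \<Longrightarrow> (g has_field_derivative g' x) (at x)" by fastforce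
  have gL: "g x = L x" if "Re x > 1" for x
    using g(1)[OF that] by (simp add: L_def f_def sums_iff)
  have "(\<lambda>n. f' n s) sums (- (D s * L s))"
    using sums_minus[OF D_mult_L_sums[OF s]] by (simp add: f'_def mult.assoc)
  then have "g' s = - (D s * L s)" using g(2)[OF s] sums_unique2 by blast
  then have "(g has_field_derivative - (D s * L s)) (at s)" using g(3)[OF s] by simp
  then show ?thesis
    by (rule has_field_derivative_transform_within_open[where S = "{s. Re s > 1}"]) (use s gL open_Re_gt in auto)
qed

text \<open>The leading term 1 outweighs a tail of modulus at most 1/2. The point 3 only serves as a
  base point for the half-plane.\<close>

lemma L_3_nonzero: "L 3 \<noteq> 0"
proof
  assume L0: "L 3 = 0"
  define f where "f n = \<xi> n * of_nat n powr (-3)" for n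
  have fs: "summable (\<lambda>n. norm (f n))" unfolding f_def using L_summable[of 3] by simp
  have "(\<Sum>n. f n) = (\<Sum>n. f (n + 2)) + (\<Sum>i<2. f i)"
    by (rule suminf_split_initial_segment[OF summable_norm_cancel[OF fs]])
  moreover have "(\<Sum>i<2. f i) = 1" using one by (simp add: f_def numeral_2_eq_2)
  moreover have "(\<Sum>n. f n) = 0" using L0 by (simp add: L_def f_def)
  ultimately have "norm (\<Sum>n. f (n + 2)) = 1" by (metis add_eq_0_iff norm_minus_cancel norm_one)
  moreover have "norm (\<Sum>n. f (n + 2)) \<le> 1/2"
  proof -
    have t: "(\<lambda>n. (1/2) * (1 / real (n + 1) - 1 / real (n + 2))) sums ((1/2) * (1 / real (0 + 1) - 0))"
    proof (rule sums_mult)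
      have "(\<lambda>n. 1 / real (n + 1)) \<longlonglongrightarrow> 0" by real_asymp
      from telescope_sums'[OF this] show "(\<lambda>n. 1 / real (n + 1) - 1 / real (n + 2)) sums (1 / real (0 + 1) - 0)" by simp
    qed
    have le: "norm (f (n + 2)) \<le> (1/2) * (1 / real (n + 1) - 1 / real (n + 2))" for n
    proof -
      have "norm (f (n + 2)) \<le> 1 * real (n + 2) powr (-3)"
        unfolding f_def norm_mult using norm_le_1 norm_of_nat_powr[of "n+2" "-3"] by (intro mult_mono) auto
      then show ?thesis using real_powr_m3_le[of n] by linarith
    qed
    have "norm (\<Sum>n. f (n + 2)) \<le> (\<Sum>n. norm (f (n + 2)))"
      using fs by (intro summable_norm) (rule summable_ignore_initial_segment)
    also have "\<dots> \<le> (\<Sum>n. (1/2) * (1 / real (n + 1) - 1 / real (n + 2)))"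
      by (rule suminf_le[OF le summable_ignore_initial_segment[OF fs, of 2] sums_summable[OF t]])
    also have "\<dots> = 1/2" using t by (simp add: sums_iff)
    finally show ?thesis .
  qed
  ultimately show False by simp
qed

text \<open>In place of an Euler product: with P a primitive of D on the convex half-plane, L exp(P)
  has derivative 0, so it is a constant, and this constant is nonzero at s = 3.\<close>

lemma L_nonzero:
  assumes s: "Re s > 1"
  shows "L s \<noteq> 0"
proof -
  let ?S = "{s::complex. Re s > 1}"
  have cv: "convex ?S" by (rule convex_halfspace_Re_gt)
  obtain P where P: "\<And>z. z \<in> ?S \<Longrightarrow> (P has_field_derivative D z) (at z within ?S)"
    using holomorphic_convex_primitive'[OF cv open_Re_gt D_holomorphic] by blast
  have "((\<lambda>z. L z * exp (P z)) has_field_derivative 0) (at z within ?S)" if z: "z \<in> ?S" for z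
  proof -
    have "(L has_field_derivative - (D z * L z)) (at z within ?S)"
      using L_deriv[of z] z by (auto intro: has_field_derivative_at_within)
    moreover have "((\<lambda>z. exp (P z)) has_field_derivative exp (P z) * D z) (at z within ?S)"
      using P[OF z] by (auto intro!: derivative_eq_intros)
    ultimately have "((\<lambda>z. L z * exp (P z)) has_field_derivative - (D z * L z) * exp (P z) + exp (P z) * D z * L z) (at z within ?S)"
      by (rule DERIV_mult)
    then show ?thesis by (simp add: mult_ac)
  qed
  then obtain c where c: "\<And>z. z \<in> ?S \<Longrightarrow> L z * exp (P z) = c"
    using has_field_derivative_zero_constant[OF cv, of "\<lambda>z. L z * exp (P z)"] by blast
  have "c = L 3 * exp (P 3)" using c[of 3] by simp
  then have "c \<noteq> 0" using L_3_nonzero by simp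
  then show ?thesis using c[of s] s by auto
qed

lemma Lx_nonzero: "Re s > 1 \<Longrightarrow> Lx s \<noteq> 0"
  using Lx_eq[of s] L_nonzero[of s] by (auto split: if_splits)

lemma D_eq:
  assumes s: "Re s > 1"
  shows "D s = (if trivial_char then 1 / (s - 1) else 0) - deriv Lx s / Lx s"
proof -
  define c where "c z = (if trivial_char then z - 1 else 1)" for z :: complex
  define c' where "c' = (if trivial_char then 1 else 0 :: complex)"
  have "(c has_field_derivative c') (at s)"
    unfolding c_def c'_def by (auto intro!: derivative_eq_intros)
  from DERIV_mult[OF this L_deriv[OF s]]
  have "((\<lambda>z. c z * L z) has_field_derivative c' * L s + (- (D s * L s)) * c s) (at s)" .
  then have "(Lx has_field_derivative c' * L s + (- (D s * L s)) * c s) (at s)"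
    by (rule has_field_derivative_transform_within_open[where S = "{s. Re s > 1}"])
       (use s Lx_eq open_Re_gt in \<open>auto simp: c_def\<close>)
  then have "deriv Lx s = c' * L s + (- (D s * L s)) * c s" by (rule DERIV_imp_deriv)
  moreover have "Lx s = c s * L s" using Lx_eq[OF s] by (simp add: c_def)
  moreover have "c s \<noteq> 0" using s by (auto simp: c_def)
  ultimately have "deriv Lx s / Lx s = c' / c s - D s" using L_nonzero[OF s] by (simp add: field_simps)
  then show ?thesis by (simp add: c_def c'_def)
qed

end

section \<open>Non-vanishing on the line Re s = 1\<close>

lemma zero_order_factor:
  fixes f :: "complex \<Rightarrow> complex"
  assumes f: "f holomorphic_on S" "open S" "connected S" and z: "z \<in> S" "z1 \<in> S" "f z1 \<noteq> 0"
  shows "\<exists>(k::nat) g r. r > 0 \<and> ball z r \<subseteq> S \<and> g holomorphic_on ball z r \<and>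
     (\<forall>w\<in>ball z r. f w = (w - z) ^ k * g w \<and> g w \<noteq> 0) \<and> (f z = 0 \<longrightarrow> k > 0)"
proof (cases "f z = 0")
  case True
  then have "\<not> f constant_on S" using z True unfolding constant_on_def by metis
  then show ?thesis
  proof (rule holomorphic_factor_zero_nonconstant[OF f z(1) True])
    fix g r and k :: nat
    assume "0 < k" "0 < r" "ball z r \<subseteq> S" "g holomorphic_on ball z r"
      "\<And>w. w \<in> ball z r \<Longrightarrow> f w = (w - z) ^ k * g w" "\<And>w. w \<in> ball z r \<Longrightarrow> g w \<noteq> 0"
    then show ?thesis by (intro exI[of _ k] exI[of _ g] exI[of _ r]) auto
  qed
next
  case False
  have "continuous_on S f" using f holomorphic_on_imp_continuous_on by blast
  then have "open (S \<inter> f -` (- {0}))" using f(2) by (intro continuous_open_preimage) auto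
  moreover have "z \<in> S \<inter> f -` (- {0})" using z False by auto
  ultimately obtain r where r: "r > 0" "ball z r \<subseteq> S \<inter> f -` (- {0})" using open_contains_ball by blast
  show ?thesis
    by (intro exI[of _ 0] exI[of _ f] exI[of _ r]) (use r f False in \<open>auto intro: holomorphic_on_subset\<close>)
qed

text \<open>Writing f = (w - z)^k g with g nonvanishing gives f'/f = k/(w - z) plus a locally
  bounded term; approaching z from the right makes the first term k/\<epsilon>. The case k = 0
  covers points that are no zeros.\<close>

lemma logderiv_lower:
  fixes f :: "complex \<Rightarrow> complex"
  assumes f: "f holomorphic_on S" "open S" "connected S" and z: "z \<in> S" "z1 \<in> S" "f z1 \<noteq> 0"
  shows "\<exists>(k::nat) C e. e > 0 \<and> (f z = 0 \<longrightarrow> k > 0) \<and>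
     (\<forall>\<epsilon>. 0 < \<epsilon> \<longrightarrow> \<epsilon> < e \<longrightarrow> Re (deriv f (z + of_real \<epsilon>) / f (z + of_real \<epsilon>)) \<ge> real k / \<epsilon> - C)"
proof -
  from zero_order_factor[OF assms] obtain k :: nat and g r where
    r: "r > 0" "ball z r \<subseteq> S" and g: "g holomorphic_on ball z r"
    and fac0: "\<forall>w\<in>ball z r. f w = (w - z) ^ k * g w \<and> g w \<noteq> 0"
    and k: "f z = 0 \<longrightarrow> k > 0" by (elim exE conjE)
  have fac: "f w = (w - z) ^ k * g w" "g w \<noteq> 0" if "w \<in> ball z r" for w using fac0 that by auto
  have dg: "deriv g holomorphic_on ball z r" using g by (intro holomorphic_deriv) auto
  have "(\<lambda>w. deriv g w / g w) holomorphic_on ball z r"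
    using g dg fac(2) by (intro holomorphic_intros) auto
  then have "continuous_on (cball z (r/2)) (\<lambda>w. deriv g w / g w)"
    using r by (intro holomorphic_on_imp_continuous_on) (rule holomorphic_on_subset, auto)
  then have "bounded ((\<lambda>w. deriv g w / g w) ` cball z (r/2))"
    by (intro compact_imp_bounded compact_continuous_image) auto
  then obtain C where "\<forall>y \<in> (\<lambda>w. deriv g w / g w) ` cball z (r/2). norm y \<le> C"
    unfolding bounded_iff by blast
  then have C: "\<And>w. w \<in> cball z (r/2) \<Longrightarrow> norm (deriv g w / g w) \<le> C" by blast
  have "Re (deriv f (z + of_real \<epsilon>) / f (z + of_real \<epsilon>)) \<ge> real k / \<epsilon> - C" if \<epsilon>: "0 < \<epsilon>" "\<epsilon> < r/2" for \<epsilon>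
  proof -
    define w where "w = z + complex_of_real \<epsilon>"
    have w: "w \<in> ball z r" "w \<in> cball z (r/2)" "w - z = of_real \<epsilon>" using \<epsilon> by (auto simp: w_def dist_norm)
    have e0: "complex_of_real \<epsilon> \<noteq> 0" using \<epsilon> by simp
    have "(g has_field_derivative deriv g w) (at w)" using g w(1) by (intro holomorphic_derivI) auto
    moreover have "((\<lambda>w. (w - z) ^ k) has_field_derivative of_nat k * (w - z) ^ (k - 1)) (at w)"
      by (auto intro!: derivative_eq_intros)
    ultimately have "((\<lambda>w. (w - z) ^ k * g w) has_field_derivative of_nat k * (w - z) ^ (k - 1) * g w + deriv g w * (w - z) ^ k) (at w)"
      by (intro DERIV_mult)
    then have "(f has_field_derivative of_nat k * (w - z) ^ (k - 1) * g w + deriv g w * (w - z) ^ k) (at w)"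
      by (rule has_field_derivative_transform_within_open[where S = "ball z r"]) (use fac w in auto)
    then have df: "deriv f w = of_nat k * (w - z) ^ (k - 1) * g w + deriv g w * (w - z) ^ k"
      by (rule DERIV_imp_deriv)
    have "deriv f w / f w = of_nat k / of_real \<epsilon> + deriv g w / g w"
    proof (cases k)
      case 0
      then show ?thesis using df fac[OF w(1)] by simp
    next
      case (Suc j)
      then show ?thesis unfolding df fac(1)[OF w(1)] w(3) using e0 fac(2)[OF w(1)] by (simp add: field_simps)
    qed
    moreover have "of_nat k / of_real \<epsilon> = complex_of_real (real k / \<epsilon>)" by simp
    ultimately have "Re (deriv f w / f w) = real k / \<epsilon> + Re (deriv g w / g w)"
      by (simp only: plus_complex.sel Re_complex_of_real)
    moreover have "\<bar>Re (deriv g w / g w)\<bar> \<le> C" using C[OF w(2)] abs_Re_le_cmod order_trans by blast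
    ultimately show ?thesis by (simp add: w_def)
  qed
  with k r show ?thesis by (intro exI[of _ k] exI[of _ C] exI[of _ "r/2"]) auto
qed

context dchar
begin

text \<open>D is a possible pole term minus the logarithmic derivative of \<open>Lx\<close>. Zeros
  push its real part towards minus infinity, and only the trivial character at z = 1 contributes
  +1/\<epsilon>.\<close>

lemma Re_D_upper:
  assumes z: "Re z = 1"
  shows "\<exists>(k::nat) C e. e > 0 \<and> (Lx z = 0 \<longrightarrow> k > 0) \<and>
     (\<forall>\<epsilon>. 0 < \<epsilon> \<longrightarrow> \<epsilon> < e \<longrightarrow> Re (D (z + of_real \<epsilon>)) \<le> ((if trivial_char \<and> z = 1 then 1 else 0) - real k) / \<epsilon> + C)"
proof -
  have "\<exists>(k::nat) C e. e > 0 \<and> (Lx z = 0 \<longrightarrow> k > 0) \<and>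
     (\<forall>\<epsilon>. 0 < \<epsilon> \<longrightarrow> \<epsilon> < e \<longrightarrow> Re (deriv Lx (z + of_real \<epsilon>) / Lx (z + of_real \<epsilon>)) \<ge> real k / \<epsilon> - C)"
    by (rule logderiv_lower[OF Lx_holomorphic open_Re_gt, of z 2])
       (use z Lx_nonzero[of 2] in \<open>auto intro: convex_connected convex_halfspace_Re_gt\<close>)
  then obtain k :: nat and C e where e: "e > 0" and k: "Lx z = 0 \<longrightarrow> k > 0" and
    low0: "\<forall>\<epsilon>. 0 < \<epsilon> \<longrightarrow> \<epsilon> < e \<longrightarrow> Re (deriv Lx (z + of_real \<epsilon>) / Lx (z + of_real \<epsilon>)) \<ge> real k / \<epsilon> - C" by (elim exE conjE)
  note low = low0[rule_format]
  \<comment> \<open>Away from z = 1 the pole term 1/(s - 1) is bounded, because the imaginary part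
    of s - 1 stays equal to that of z.\<close>
  define c where "c = (if z = 1 then 0 else 1 / \<bar>Im z\<bar>)"
  have "Re (D (z + of_real \<epsilon>)) \<le> ((if trivial_char \<and> z = 1 then 1 else 0) - real k) / \<epsilon> + (C + c)" if \<epsilon>: "0 < \<epsilon>" "\<epsilon> < e" for \<epsilon>
  proof -
    have "Re (if trivial_char then 1 / (z + of_real \<epsilon> - 1) else 0) \<le> (if trivial_char \<and> z = 1 then 1 else 0) / \<epsilon> + c"
    proof (cases "z = 1")
      case True then show ?thesis by (simp add: c_def)
    next
      case False
      have i: "Im z \<noteq> 0" using False z by (auto simp: complex_eq_iff)
      have "Re (1 / (z + of_real \<epsilon> - 1)) \<le> norm (1 / (z + of_real \<epsilon> - 1))" by (rule complex_Re_le_cmod)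
      also have "\<dots> \<le> 1 / \<bar>Im z\<bar>"
        unfolding norm_divide norm_one using i abs_Im_le_cmod[of "z + of_real \<epsilon> - 1"]
        by (intro divide_left_mono) (auto intro!: mult_pos_pos simp: complex_eq_iff)
      finally show ?thesis using False i by (auto simp: c_def)
    qed
    moreover have "Re (z + of_real \<epsilon>) > 1" using z \<epsilon> by simp
    note D_eq[OF this]
    ultimately show ?thesis using low[OF \<epsilon>] by (simp add: diff_divide_distrib)
  qed
  with e k show ?thesis by (intro exI[of _ k] exI[of _ "C + c"] exI[of _ e]) auto
qed

lemma dchar_square: "dchar Q (\<lambda>n. (\<xi> n)\<^sup>2)"
  by standard (auto simp: Q_pos mult power_mult_distrib periodic norm_power norm_coprime not_coprime)

lemma dchar_trivial: "dchar Q (\<lambda>n. if coprime n Q then 1 else 0)"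
proof -
  have "coprime (n + Q) Q \<longleftrightarrow> coprime n Q" for n by (metis coprime_iff_gcd_eq_1 gcd_add1)
  then show ?thesis by unfold_locales (auto simp: Q_pos)
qed

text \<open>Termwise 3 + 4 Re u + Re u^2 = 2 (1 + Re u)^2 for the unimodular u = \<xi>(n) n^(-it),
  with nonnegative weights. At n not coprime to Q all three characters vanish.\<close>

lemma three_four_one:
  assumes \<epsilon>: "\<epsilon> > 0"
  shows "3 * Re (dchar.D (\<lambda>n. if coprime n Q then 1 else 0) (1 + of_real \<epsilon>)) + 4 * Re (D (Complex 1 t + of_real \<epsilon>))
      + Re (dchar.D (\<lambda>n. (\<xi> n)\<^sup>2) (Complex 1 (2 * t) + of_real \<epsilon>)) \<ge> 0"
proof -
  interpret d0: dchar Q "\<lambda>n. if coprime n Q then 1 else 0" by (rule dchar_trivial)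
  interpret d2: dchar Q "\<lambda>n. (\<xi> n)\<^sup>2" by (rule dchar_square)
  define s0 where "s0 = 1 + complex_of_real \<epsilon>"
  define s1 where "s1 = Complex 1 t + complex_of_real \<epsilon>"
  define s2 where "s2 = Complex 1 (2*t) + complex_of_real \<epsilon>"
  have r: "Re s0 > 1" "Re s1 > 1" "Re s2 > 1" using \<epsilon> by (auto simp: s0_def s1_def s2_def)
  have S: "(\<lambda>n. 3 * Re (mangoldt n * (if coprime n Q then 1 else 0) * of_nat n powr (-s0))
    + 4 * Re (mangoldt n * \<xi> n * of_nat n powr (-s1)) + Re (mangoldt n * (\<xi> n)\<^sup>2 * of_nat n powr (-s2)))
    sums (3 * Re (d0.D s0) + 4 * Re (D s1) + Re (d2.D s2))"
    unfolding d0.D_def D_def d2.D_def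
    by (intro sums_add sums_mult sums_Re summable_sums summable_norm_cancel[OF d0.D_summable] summable_norm_cancel[OF D_summable]
        summable_norm_cancel[OF d2.D_summable] r)
  have P: "3 * Re (mangoldt n * (if coprime n Q then 1 else 0) * of_nat n powr (-s0))
    + 4 * Re (mangoldt n * \<xi> n * of_nat n powr (-s1)) + Re (mangoldt n * (\<xi> n)\<^sup>2 * of_nat n powr (-s2)) \<ge> 0" for n
  proof (cases "coprime n Q \<and> n > 0")
    case False
    then show ?thesis using not_coprime[of n] by (cases "n = 0") auto
  next
    case True
    define u where "u = \<xi> n * cis (- t * ln (real n))"
    define a where "a = mangoldt n * real n powr (- 1 - \<epsilon>)"
    have a: "a \<ge> 0" by (simp add: a_def mangoldt_nonneg)
    have nu: "norm u = 1" using norm_coprime True by (simp add: u_def norm_mult)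
    have u2: "u\<^sup>2 = (\<xi> n)\<^sup>2 * cis (- (2 * t) * ln (real n))"
      by (simp add: u_def power_mult_distrib power2_eq_square[of "cis _"] cis_mult mult.assoc)
    have e0: "mangoldt n * (if coprime n Q then 1 else 0) * of_nat n powr (-s0) = complex_of_real a"
      using True of_nat_powr_eq_cis[of n s0] by (simp add: s0_def a_def)
    have e1: "mangoldt n * \<xi> n * of_nat n powr (-s1) = complex_of_real a * u"
      using True of_nat_powr_eq_cis[of n s1] by (simp add: s1_def a_def u_def)
    have e2: "mangoldt n * (\<xi> n)\<^sup>2 * of_nat n powr (-s2) = complex_of_real a * u\<^sup>2"
      using True of_nat_powr_eq_cis[of n s2] by (simp add: s2_def a_def u2)
    have "(Re u)\<^sup>2 + (Im u)\<^sup>2 = 1" using nu by (simp add: cmod_def)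
    then have R: "Re (u\<^sup>2) = 2 * (Re u)\<^sup>2 - 1" by (simp add: power2_eq_square)
    have "3 * a + 4 * (a * Re u) + a * Re (u\<^sup>2) = 2 * a * (1 + Re u)\<^sup>2"
      unfolding R by (simp add: power2_eq_square algebra_simps)
    also have "\<dots> \<ge> 0" using a by simp
    finally show ?thesis unfolding e0 e1 e2 by simp
  qed
  have "3 * Re (d0.D s0) + 4 * Re (D s1) + Re (d2.D s2) \<ge> 0"
    by (rule sums_le[OF _ sums_zero S]) (rule P)
  then show ?thesis by (simp add: s0_def s1_def s2_def)
qed

text \<open>A zero at 1 + it would bound the nonnegative combination above by 3/\<epsilon> -
  4/\<epsilon> + O(1), provided that the squared character contributes no pole at 1 + 2it. The
  hypothesis \<open>ex\<close> excludes that pole except where the trivial character at 1 is settled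
  by its residue.\<close>

lemma Lx_line_nonzero:
  assumes z: "Re z = 1" and ex: "z = 1 \<Longrightarrow> trivial_char \<or> \<not> dchar.trivial_char Q (\<lambda>n. (\<xi> n)\<^sup>2)"
  shows "Lx z \<noteq> 0"
proof
  assume L0: "Lx z = 0"
  interpret d0: dchar Q "\<lambda>n. if coprime n Q then 1 else 0" by (rule dchar_trivial)
  interpret d2: dchar Q "\<lambda>n. (\<xi> n)\<^sup>2" by (rule dchar_square)
  define t where "t = Im z"
  have zt: "z = Complex 1 t" using z by (simp add: t_def complex_eq_iff)
  have triv: "\<not> (trivial_char \<and> z = 1)" using L0 Lx_1_trivial by auto
  have z2: "\<not> (d2.trivial_char \<and> Complex 1 (2 * t) = 1)"
    using ex triv by (auto simp: zt complex_eq_iff)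
  have "\<exists>(k::nat) C e. e > 0 \<and> (d0.Lx 1 = 0 \<longrightarrow> k > 0) \<and>
     (\<forall>\<epsilon>. 0 < \<epsilon> \<longrightarrow> \<epsilon> < e \<longrightarrow> Re (d0.D (1 + of_real \<epsilon>)) \<le> ((if d0.trivial_char \<and> 1 = (1::complex) then 1 else 0) - real k) / \<epsilon> + C)"
    by (rule d0.Re_D_upper) simp
  then obtain k0 :: nat and C0 e0 where d0: "e0 > 0"
    "\<forall>\<epsilon>. 0 < \<epsilon> \<longrightarrow> \<epsilon> < e0 \<longrightarrow> Re (d0.D (1 + of_real \<epsilon>)) \<le> ((if d0.trivial_char \<and> 1 = (1::complex) then 1 else 0) - real k0) / \<epsilon> + C0"
    by (elim exE conjE)
  from Re_D_upper[OF z] obtain k1 :: nat and C1 e1 where d1: "e1 > 0" "Lx z = 0 \<longrightarrow> k1 > 0"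
    "\<forall>\<epsilon>. 0 < \<epsilon> \<longrightarrow> \<epsilon> < e1 \<longrightarrow> Re (D (z + of_real \<epsilon>)) \<le> ((if trivial_char \<and> z = 1 then 1 else 0) - real k1) / \<epsilon> + C1"
    by (elim exE conjE)
  have "\<exists>(k::nat) C e. e > 0 \<and> (d2.Lx (Complex 1 (2*t)) = 0 \<longrightarrow> k > 0) \<and>
     (\<forall>\<epsilon>. 0 < \<epsilon> \<longrightarrow> \<epsilon> < e \<longrightarrow> Re (d2.D (Complex 1 (2*t) + of_real \<epsilon>)) \<le> ((if d2.trivial_char \<and> Complex 1 (2*t) = 1 then 1 else 0) - real k) / \<epsilon> + C)"
    by (rule d2.Re_D_upper) simp
  then obtain k2 :: nat and C2 e2 where d2: "e2 > 0"
    "\<forall>\<epsilon>. 0 < \<epsilon> \<longrightarrow> \<epsilon> < e2 \<longrightarrow> Re (d2.D (Complex 1 (2*t) + of_real \<epsilon>)) \<le> ((if d2.trivial_char \<and> Complex 1 (2*t) = 1 then 1 else 0) - real k2) / \<epsilon> + C2"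
    by (elim exE conjE)
  have k1: "k1 > 0" using d1(2) L0 by simp
  \<comment> \<open>An \<epsilon> below 1/M makes 1/\<epsilon> larger than the combined constant
    terms, against the inequality 1/\<epsilon> \<le> 3 C0 + 4 C1 + C2.\<close>
  define M where "M = \<bar>3 * C0 + 4 * C1 + C2\<bar> + 1"
  define m where "m = min (min e0 (min e1 e2)) (1 / M)"
  define \<epsilon> where "\<epsilon> = m / 2"
  have M: "M > 0" by (simp add: M_def)
  have \<epsilon>: "0 < \<epsilon>" "\<epsilon> < e0" "\<epsilon> < e1" "\<epsilon> < e2" "\<epsilon> < 1 / M"
  proof -
    have "m > 0" "m \<le> e0" "m \<le> e1" "m \<le> e2" "m \<le> 1 / M" using d0(1) d1(1) d2(1) M by (auto simp: m_def)
    then show "0 < \<epsilon>" "\<epsilon> < e0" "\<epsilon> < e1" "\<epsilon> < e2" "\<epsilon> < 1 / M" unfolding \<epsilon>_def by linarith+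
  qed
  have b0: "Re (d0.D (1 + of_real \<epsilon>)) \<le> 1 / \<epsilon> + C0"
  proof -
    have "((if d0.trivial_char \<and> 1 = (1::complex) then 1 else 0) - real k0) / \<epsilon> \<le> 1 / \<epsilon>"
      using \<epsilon>(1) by (intro divide_right_mono) auto
    then show ?thesis using d0(2)[rule_format, OF \<epsilon>(1,2)] by linarith
  qed
  have b1: "Re (D (z + of_real \<epsilon>)) \<le> - 1 / \<epsilon> + C1"
  proof -
    have "((if trivial_char \<and> z = 1 then 1 else 0) - real k1) / \<epsilon> \<le> - 1 / \<epsilon>"
      using \<epsilon>(1) k1 triv by (intro divide_right_mono) auto
    then show ?thesis using d1(3)[rule_format, OF \<epsilon>(1,3)] by linarith
  qed
  have b2: "Re (d2.D (Complex 1 (2*t) + of_real \<epsilon>)) \<le> C2"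
  proof -
    have "((if d2.trivial_char \<and> Complex 1 (2*t) = 1 then 1 else 0) - real k2) / \<epsilon> \<le> 0"
      using \<epsilon>(1) z2 by (intro divide_nonpos_pos) auto
    then show ?thesis using d2(2)[rule_format, OF \<epsilon>(1,4)] by linarith
  qed
  have "0 \<le> 3 * Re (d0.D (1 + of_real \<epsilon>)) + 4 * Re (D (z + of_real \<epsilon>)) + Re (d2.D (Complex 1 (2*t) + of_real \<epsilon>))"
    using three_four_one[OF \<epsilon>(1), of t] by (simp add: zt)
  then have "1 / \<epsilon> \<le> 3 * C0 + 4 * C1 + C2" using b0 b1 b2 by linarith
  moreover have "3 * C0 + 4 * C1 + C2 < M" by (simp add: M_def)
  moreover have "M < 1 / \<epsilon>" using \<epsilon>(1,5) M by (simp add: field_simps)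
  ultimately show False by linarith
qed

end

section \<open>Divisor sums of real characters\<close>

text \<open>A divisor of a b splits uniquely as u v, the two parts being recovered as its gcds with
  a and with b.\<close>

lemma sum_divisors_coprime_mult:
  fixes f :: "nat \<Rightarrow> 'a :: comm_semiring_1"
  assumes "coprime a b" "a > 0" "b > 0" and f: "\<And>m n. f (m * n) = f m * f n"
  shows "(\<Sum>d | d dvd a * b. f d) = (\<Sum>d | d dvd a. f d) * (\<Sum>d | d dvd b. f d)"
proof -
  let ?h = "\<lambda>(u, v). u * v :: nat"
  have inj: "inj_on ?h ({d. d dvd a} \<times> {d. d dvd b})"
  proof (rule inj_onI, clarify)
    fix u v u' v' assume h: "u dvd a" "v dvd b" "u' dvd a" "v' dvd b" "u * v = u' * v'"
    have "gcd (u * v) a = u" if "u dvd a" "v dvd b" for u v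
    proof -
      have "coprime v a" using that assms(1) by (meson coprime_commute coprime_divisors dvd_refl)
      then show ?thesis using that(1) by (simp add: gcd_mult_right_right_cancel gcd_nat.absorb1 coprime_commute gcd.commute gcd_mult_left_right_cancel)
    qed
    then have u: "u = u'" using h by metis
    have "gcd (u * v) b = v" if "u dvd a" "v dvd b" for u v
    proof -
      have "coprime u b" using that assms(1) by (meson coprime_divisors dvd_refl)
      then have "gcd (v * u) b = v" using that(2) by (simp add: gcd_mult_right_right_cancel gcd_nat.absorb1 coprime_commute gcd.commute gcd_mult_left_right_cancel)
      then show ?thesis by (simp only: mult.commute)
    qed
    then have "v = v'" using h by metis
    with u show "u = u' \<and> v = v'" by simp
  qed
  have img: "?h ` ({d. d dvd a} \<times> {d. d dvd b}) = {d. d dvd a * b}"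
  proof (intro equalityI subsetI)
    fix d assume "d \<in> {d. d dvd a * b}"
    then obtain u v where "d = u * v" "u dvd a" "v dvd b" using division_decomp[of d a b] by auto
    then show "d \<in> ?h ` ({d. d dvd a} \<times> {d. d dvd b})" by force
  qed (auto intro: mult_dvd_mono)
  have "(\<Sum>d | d dvd a * b. f d) = (\<Sum>d \<in> ?h ` ({d. d dvd a} \<times> {d. d dvd b}). f d)" by (simp only: img)
  also have "\<dots> = (\<Sum>(u, v) \<in> {d. d dvd a} \<times> {d. d dvd b}. f (u * v))"
    by (subst sum.reindex[OF inj]) (simp add: case_prod_unfold)
  also have "\<dots> = (\<Sum>(u, v) \<in> {d. d dvd a} \<times> {d. d dvd b}. f u * f v)" by (simp add: f)
  also have "\<dots> = (\<Sum>d | d dvd a. f d) * (\<Sum>d | d dvd b. f d)" by (simp add: sum_product sum.cartesian_product)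
  finally show ?thesis .
qed

lemma sum_divisors_prime_power:
  fixes p :: nat
  assumes "prime p"
  shows "(\<Sum>d | d dvd p ^ k. f d) = (\<Sum>i\<le>k. f (p ^ i))"
proof -
  have "{d. d dvd p ^ k} = (\<lambda>i. p ^ i) ` {..k}" using divides_primepow_nat[OF assms] by auto
  moreover have "inj_on (\<lambda>i. p ^ i) {..k}" using assms prime_gt_1_nat[OF assms] by (auto intro!: inj_onI)
  ultimately show ?thesis by (simp add: sum.reindex)
qed

lemma sum_pm1_powers:
  assumes "c \<in> {-1, 0, 1 :: real}"
  shows "(\<Sum>i\<le>k. c ^ i) \<ge> 0" "even k \<Longrightarrow> (\<Sum>i\<le>k. c ^ i) \<ge> 1"
proof -
  have "(\<Sum>i\<le>k. (-1::real) ^ i) = (if even k then 1 else 0)" by (induction k) auto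
  moreover have "(\<Sum>i\<le>k. (0::real) ^ i) = 1" by (induction k) auto
  ultimately show "(\<Sum>i\<le>k. c ^ i) \<ge> 0" "even k \<Longrightarrow> (\<Sum>i\<le>k. c ^ i) \<ge> 1" using assms by (auto split: if_splits)
qed

lemma prime_power_decompose_nat:
  fixes n :: nat
  assumes "n > 1"
  shows "\<exists>p k m. prime p \<and> k > 0 \<and> n = p ^ k * m \<and> coprime p m \<and> m < n \<and> m > 0"
proof -
  obtain p where p: "prime p" "p dvd n" using assms prime_factor_nat[of n] by auto
  define k where "k = multiplicity p n"
  have k: "k > 0" using p assms by (simp add: k_def prime_multiplicity_gt_zero_iff)
  obtain m where m: "n = p ^ k * m" "\<not> p dvd m"
    using multiplicity_decompose'[of n p] p assms unfolding k_def by (metis not_less0 not_prime_unit)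
  have "m > 0" using m assms by (cases m) auto
  moreover have "m < n" using m(1) \<open>m > 0\<close> k prime_gt_1_nat[OF p(1)] one_less_power[of p k] by simp
  moreover have "coprime p m" using m p by (simp add: prime_imp_coprime)
  ultimately show ?thesis using p k m by blast
qed

text \<open>The divisor sum is multiplicative, and at p^k it is 1 + c + ... + c^k with c in {-1, 0,
  1}: never negative, and at least 1 for even k. Splitting off one prime power at a time gives the
  induction.\<close>

lemma divisor_sum_real_char:
  fixes \<rho> :: "nat \<Rightarrow> real"
  assumes mult: "\<And>m n. \<rho> (m * n) = \<rho> m * \<rho> n" and val: "\<And>n. \<rho> n \<in> {-1, 0, 1}" and one: "\<rho> 1 = 1"
  shows "n > 0 \<Longrightarrow> (\<Sum>d | d dvd n. \<rho> d) \<ge> 0" and "n > 0 \<Longrightarrow> (\<Sum>d | d dvd n\<^sup>2. \<rho> d) \<ge> 1"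
proof -
  have pow: "\<rho> (p ^ i) = \<rho> p ^ i" for p i by (induction i) (auto simp: mult one[simplified])
  show "(\<Sum>d | d dvd n. \<rho> d) \<ge> 0" if "n > 0" using that
  proof (induction n rule: less_induct)
    case (less n)
    show ?case
    proof (cases "n = 1")
      case True then show ?thesis using one by simp
    next
      case False
      then obtain p k m where pkm: "prime p" "k > 0" "n = p ^ k * m" "coprime p m" "m < n" "m > 0"
        using less.prems prime_power_decompose_nat[of n] by auto
      have "(\<Sum>d | d dvd n. \<rho> d) = (\<Sum>d | d dvd p ^ k. \<rho> d) * (\<Sum>d | d dvd m. \<rho> d)"
        unfolding pkm(3) using pkm prime_gt_0_nat by (intro sum_divisors_coprime_mult mult) auto
      also have "\<dots> = (\<Sum>i\<le>k. \<rho> p ^ i) * (\<Sum>d | d dvd m. \<rho> d)"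
        using pkm(1) by (simp add: sum_divisors_prime_power pow)
      also have "\<dots> \<ge> 0" using sum_pm1_powers(1)[OF val] less.IH[OF pkm(5,6)] by (intro mult_nonneg_nonneg)
      finally show ?thesis .
    qed
  qed
  show "(\<Sum>d | d dvd n\<^sup>2. \<rho> d) \<ge> 1" if "n > 0" using that
  proof (induction n rule: less_induct)
    case (less n)
    show ?case
    proof (cases "n = 1")
      case True then show ?thesis using one by simp
    next
      case False
      then obtain p k m where pkm: "prime p" "k > 0" "n = p ^ k * m" "coprime p m" "m < n" "m > 0"
        using less.prems prime_power_decompose_nat[of n] by auto
      have n2: "n\<^sup>2 = p ^ (2 * k) * m\<^sup>2" by (simp add: pkm(3) power_mult_distrib power_mult[symmetric] mult.commute)
      have "(\<Sum>d | d dvd n\<^sup>2. \<rho> d) = (\<Sum>d | d dvd p ^ (2 * k). \<rho> d) * (\<Sum>d | d dvd m\<^sup>2. \<rho> d)"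
        unfolding n2 using pkm prime_gt_0_nat by (intro sum_divisors_coprime_mult mult) auto
      also have "\<dots> = (\<Sum>i\<le>2 * k. \<rho> p ^ i) * (\<Sum>d | d dvd m\<^sup>2. \<rho> d)"
        using pkm(1) by (simp add: sum_divisors_prime_power pow)
      also have "\<dots> \<ge> 1 * 1"
        using sum_pm1_powers(2)[OF val, of "2 * k" p] less.IH[OF pkm(5,6)] by (intro mult_mono) auto
      finally show ?thesis by simp
    qed
  qed
qed

text \<open>Stated for the square of $y$ because it is applied with $y = \sqrt x$.\<close>

lemma geometric_sum_ge:
  fixes y :: real
  assumes "0 \<le> y" "y \<le> 1"
  shows "(\<Sum>i<Suc d. (y\<^sup>2) ^ i) \<ge> real (Suc d) * y ^ d"
proof (induction d)
  case (Suc d)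
  \<comment> \<open>Bernoulli in the guise of a weighted mean inequality: (d + 2) y is at most (d +
    1) + y^(d+2).\<close>
  have "1 + real (d + 2) * (y - 1) \<le> (1 + (y - 1)) ^ (d + 2)"
    using assms by (intro Bernoulli_inequality) auto
  then have b: "real (d + 2) * y \<le> real (Suc d) + y ^ (d + 2)" by (simp add: algebra_simps)
  have "real (Suc (Suc d)) * y ^ Suc d = y ^ d * (real (d + 2) * y)" by simp
  also have "\<dots> \<le> y ^ d * (real (Suc d) + y ^ (d + 2))" using b assms by (intro mult_left_mono) auto
  also have "\<dots> = real (Suc d) * y ^ d + (y\<^sup>2) ^ Suc d"
    by (simp add: algebra_simps power_add power_mult_distrib power2_eq_square)
  also have "\<dots> \<le> (\<Sum>i<Suc d. (y\<^sup>2) ^ i) + (y\<^sup>2) ^ Suc d" using Suc by simp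
  finally show ?case by simp
qed simp

section \<open>Lambert series and the value at s = 1 for real characters\<close>

text \<open>With S_d = 1 + x + ... + x^(d-1), the quantity times 1 - x is 1/d - x^d / S_d, and it
  decreases exactly when d (d+1) x^d \<le> S_d S_(d+1). The geometric sum bound at y = sqrt x shows
  that the right side is at least d (d+1) x^(d - 1/2).\<close>

lemma lambert_coeff_antimono:
  fixes x :: real
  assumes x: "0 < x" "x < 1" and d: "d > 0"
  shows "1 / (real d * (1 - x)) - x ^ d / (1 - x ^ d) \<ge> 1 / (real (Suc d) * (1 - x)) - x ^ Suc d / (1 - x ^ Suc d)"
    and "1 / (real d * (1 - x)) - x ^ d / (1 - x ^ d) \<ge> 0"
proof -
  define S where "S n = (\<Sum>i<n. x ^ i)" for n
  define y where "y = sqrt x"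
  have y: "0 < y" "y \<le> 1" "y\<^sup>2 = x" using x by (auto simp: y_def)
  have S: "1 - x ^ n = (1 - x) * S n" for n unfolding S_def by (rule one_diff_power_eq)
  have Sge: "S (Suc n) \<ge> real (Suc n) * y ^ n" for n
    using geometric_sum_ge[of y n] y unfolding S_def y(3) by simp
  obtain e where e: "d = Suc e" using d by (cases d) auto
  have Sp: "S (Suc n) > 0" for n using order_less_le_trans[OF _ Sge[of n]] y(1) by simp
  have key: "real d * real (Suc d) * x ^ d \<le> S d * S (Suc d)"
  proof -
    have "x ^ d = y ^ e * y ^ d * y" unfolding y(3)[symmetric] e
      by (simp add: power_mult_distrib power2_eq_square mult_ac)
    also have "\<dots> \<le> y ^ e * y ^ d * 1" using y by (intro mult_left_mono) auto
    finally have "real d * real (Suc d) * x ^ d \<le> (real d * y ^ e) * (real (Suc d) * y ^ d)"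
      by (simp add: mult_ac mult_left_mono)
    also have "\<dots> \<le> S d * S (Suc d)" using Sge[of e] Sge[of d] Sp[of e] y unfolding e by (intro mult_mono) auto
    finally show ?thesis .
  qed
  have d0: "real d > 0" "S d > 0" "S (Suc d) > 0" "1 - x > 0" using d Sp e x by auto
  have "S (Suc d) - x * S d = 1"
    unfolding S_def sum.lessThan_Suc_shift by (simp add: sum_distrib_left)
  then have "x ^ d / S d - x ^ Suc d / S (Suc d) = x ^ d / (S d * S (Suc d))"
    using d0 by (simp add: field_simps)
  also have "\<dots> \<le> 1 / (real d * real (Suc d))"
  proof -
    have "a / P \<le> 1 / R" if "a * R \<le> P" "P > 0" "R > 0" for a P R :: real using that by (simp add: field_simps)
    moreover have "x ^ d * (real d * real (Suc d)) \<le> S d * S (Suc d)" using key by (simp only: mult_ac)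
    ultimately show ?thesis using d0 by simp
  qed
  also have "\<dots> = 1 / real d - 1 / real (Suc d)" using d0 by (simp add: field_simps)
  finally have "1 / real d - x ^ d / S d \<ge> 1 / real (Suc d) - x ^ Suc d / S (Suc d)" by simp
  then have "(1 / real d - x ^ d / S d) / (1 - x) \<ge> (1 / real (Suc d) - x ^ Suc d / S (Suc d)) / (1 - x)"
    using d0 by (intro divide_right_mono) auto
  then show "1 / (real d * (1 - x)) - x ^ d / (1 - x ^ d) \<ge> 1 / (real (Suc d) * (1 - x)) - x ^ Suc d / (1 - x ^ Suc d)"
    unfolding S by (simp add: diff_divide_distrib mult.commute)
  have "real d * x ^ d \<le> S d"
  proof -
    have "S d \<ge> (\<Sum>i<d. x ^ d)" unfolding S_def using x by (intro sum_mono power_decreasing) auto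
    then show ?thesis by simp
  qed
  then have "x ^ d / S d \<le> 1 / real d" using d0 by (simp add: field_simps)
  then have "(1 / real d - x ^ d / S d) / (1 - x) \<ge> 0" using d0 by simp
  then show "1 / (real d * (1 - x)) - x ^ d / (1 - x ^ d) \<ge> 0"
    unfolding S by (simp add: diff_divide_distrib mult.commute)
qed

text \<open>Partial summation as in Dirichlet's test: the decrements of b are nonnegative and
  telescope, so only the first weight survives.\<close>

lemma abel_antimono_bound:
  fixes \<rho> b :: "nat \<Rightarrow> real"
  assumes E: "\<And>n. \<bar>\<Sum>k=1..n. \<rho> k\<bar> \<le> B" and anti: "\<And>d. d > 0 \<Longrightarrow> b (Suc d) \<le> b d" and pos: "\<And>d. d > 0 \<Longrightarrow> b d \<ge> 0"
  shows "\<bar>\<Sum>d=1..n. \<rho> d * b d\<bar> \<le> B * b 1"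
proof -
  define F where "F n = (\<Sum>k=1..n. \<rho> k)" for n
  have EF: "\<bar>F n\<bar> \<le> B" for n using E by (simp add: F_def)
  have Fd: "\<bar>F d * (b d - b (Suc d))\<bar> \<le> B * (b d - b (Suc d))" if "d > 0" for d
    unfolding abs_mult using EF anti[OF that] by (simp add: mult_right_mono)
  have Fb: "\<bar>F d * b d\<bar> \<le> B * b d" if "d > 0" for d
    unfolding abs_mult using EF pos[OF that] by (simp add: mult_right_mono)
  have part: "(\<Sum>d=1..Suc n. \<rho> d * b d) = F (Suc n) * b (Suc n) + (\<Sum>d=1..n. F d * (b d - b (Suc d)))" for n
  proof (induction n)
    case (Suc n)
    have "F (Suc (Suc n)) = F (Suc n) + \<rho> (Suc (Suc n))" by (simp add: F_def)
    then show ?case using Suc by (simp add: algebra_simps)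
  qed (simp add: F_def)
  have tele: "(\<Sum>d=1..n. b d - b (Suc d)) = b 1 - b (Suc n)" for n by (induction n) auto
  show ?thesis
  proof (cases n)
    case 0
    then show ?thesis using pos[of 1] E[of 0] by simp
  next
    case (Suc m)
    have "\<bar>\<Sum>d=1..n. \<rho> d * b d\<bar> \<le> \<bar>F n * b n\<bar> + (\<Sum>d=1..m. \<bar>F d * (b d - b (Suc d))\<bar>)"
      unfolding Suc part by (intro order_trans[OF abs_triangle_ineq] add_mono order_refl sum_abs)
    also have "\<dots> \<le> B * b n + (\<Sum>d=1..m. B * (b d - b (Suc d)))"
      using Suc by (intro add_mono sum_mono Fd Fb) auto
    also have "\<dots> = B * b 1" unfolding sum_distrib_left[symmetric] tele Suc by (simp add: algebra_simps)
    finally show ?thesis .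
  qed
qed

text \<open>Both series are the double sum of \<rho>(d) x^(d k): grouping by n = d k gives a power
  series, while summing the geometric series in k gives the Lambert form.\<close>

lemma lambert_has_sum:
  fixes \<rho> :: "nat \<Rightarrow> real"
  assumes x: "0 < x" "x < 1" and \<rho>: "\<And>n. \<bar>\<rho> n\<bar> \<le> 1"
  shows "\<exists>F. ((\<lambda>n. (\<Sum>d | d dvd n. \<rho> d) * x ^ n) has_sum F) {1..} \<and> ((\<lambda>d. \<rho> d * (x ^ d / (1 - x ^ d))) has_sum F) {1..}"
proof -
  define h where "h = (\<lambda>(d, k). \<rho> d * x ^ (d * k))"
  have geo: "((\<lambda>k. c ^ k) has_sum c / (1 - c)) {1..}" if c: "0 \<le> c" "c < 1" for c :: real
  proof -
    have "(\<lambda>k. c * c ^ k) sums (c * (1 / (1 - c)))" using c by (intro sums_mult geometric_sums) auto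
    then have "((\<lambda>k. c ^ Suc k) has_sum c / (1 - c)) UNIV"
      using c by (intro sums_nonneg_imp_has_sum) auto
    moreover have "bij_betw Suc UNIV {1..}"
      by (rule bij_betwI[of _ _ _ "\<lambda>k. k - 1"]) auto
    ultimately show ?thesis using has_sum_reindex_bij_betw[of Suc UNIV "{1..}" "\<lambda>k. c ^ k" "c / (1 - c)"] by simp
  qed
  have xd: "0 \<le> x ^ d" "x ^ d < 1" if "d \<ge> 1" for d
    using x that by (auto intro: power_Suc_less_one simp: power_less_one_iff Suc_le_eq)
  have inner: "((\<lambda>k. h (d, k)) has_sum \<rho> d * (x ^ d / (1 - x ^ d))) {1..}" if "d \<in> {1..}" for d
    unfolding h_def using has_sum_cmult_right[OF geo[OF xd], of d "\<rho> d"] that by (simp add: power_mult)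
  have inner_abs: "((\<lambda>k. norm (h (d, k))) has_sum \<bar>\<rho> d\<bar> * (x ^ d / (1 - x ^ d))) {1..}" if "d \<in> {1..}" for d
    unfolding h_def using has_sum_cmult_right[OF geo[OF xd], of d "\<bar>\<rho> d\<bar>"] that x by (simp add: power_mult abs_mult)
  have "(\<lambda>z. norm (h z)) summable_on {1..} \<times> {1..}"
  proof (rule summable_on_SigmaI[where g = "\<lambda>d. \<bar>\<rho> d\<bar> * (x ^ d / (1 - x ^ d))"])
    show "((\<lambda>y. norm (h (d, y))) has_sum \<bar>\<rho> d\<bar> * (x ^ d / (1 - x ^ d))) {1..}" if "d \<in> {1..}" for d
      using inner_abs[OF that] .
    show "(\<lambda>d. \<bar>\<rho> d\<bar> * (x ^ d / (1 - x ^ d))) summable_on {1..}"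
    proof (rule summable_on_comparison_test)
      show "(\<lambda>d. (1 / (1 - x)) * x ^ d) summable_on {1..}"
        using geo[of x] x by (intro summable_on_cmult_right) (auto simp: summable_on_def)
      fix d assume d: "d \<in> {1::nat..}"
      have "x ^ d \<le> x ^ 1" using d x by (intro power_decreasing) auto
      then have "x ^ d / (1 - x ^ d) \<le> x ^ d / (1 - x)" using x xd[of d] d by (intro divide_left_mono) auto
      then have "\<bar>\<rho> d\<bar> * (x ^ d / (1 - x ^ d)) \<le> 1 * (x ^ d / (1 - x))"
        using \<rho> x xd[of d] d by (intro mult_mono) auto
      then show "\<bar>\<rho> d\<bar> * (x ^ d / (1 - x ^ d)) \<le> (1 / (1 - x)) * x ^ d" by simp
      show "0 \<le> \<bar>\<rho> d\<bar> * (x ^ d / (1 - x ^ d))" using xd[of d] d by simp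
    qed
  qed auto
  then have "h summable_on {1..} \<times> {1..}" by (rule abs_summable_summable)
  then obtain F where F: "(h has_sum F) ({1..} \<times> {1..})" by (auto simp: summable_on_def)
  have "((\<lambda>n. \<Sum>d | d dvd n. h (d, n div d)) has_sum F) {1..}"
    by (rule has_sum_divisors_rearrange[OF F])
  also have "?this \<longleftrightarrow> ((\<lambda>n. (\<Sum>d | d dvd n. \<rho> d) * x ^ n) has_sum F) {1..}"
    by (intro has_sum_cong) (auto simp: h_def sum_distrib_right intro!: sum.cong)
  finally show ?thesis using has_sum_SigmaD[OF F inner] by auto
qed

context dchar
begin

text \<open>Monsky's argument: the Lambert series $\sum_d \xi(d) x^d / (1 - x^d)$ has nonnegative coefficients, at least $1$ at the
  squares, so it is unbounded as $x \to 1$. If $\sum \xi(d)/d = 0$, one may subtract $\xi(d) / (d (1 - x))$ from each term, and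
  the resulting series is bounded by monotonicity.\<close>

lemma Lr_1_nonzero_real:
  assumes nt: "\<not> trivial_char" and sq: "\<And>n. coprime n Q \<Longrightarrow> (\<xi> n)\<^sup>2 = 1"
  shows "Lr 1 \<noteq> 0"
proof
  assume L0: "Lr 1 = 0"
  define \<rho> where "\<rho> n = Re (\<xi> n)" for n
  have xi: "\<xi> n = of_real (\<rho> n) \<and> \<rho> n \<in> {-1, 0, 1}" for n
  proof (cases "coprime n Q")
    case True
    then have "\<xi> n = 1 \<or> \<xi> n = -1" using sq by (simp add: power2_eq_1_iff)
    then show ?thesis by (auto simp: \<rho>_def)
  qed (auto simp: \<rho>_def not_coprime)
  have mult\<rho>: "\<rho> (m * n) = \<rho> m * \<rho> n" for m n
  proof -
    have "complex_of_real (\<rho> (m * n)) = of_real (\<rho> m * \<rho> n)" using mult[of m n] xi by (metis of_real_mult)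
    then show ?thesis by (simp only: of_real_eq_iff)
  qed
  have val: "\<rho> n \<in> {-1, 0, 1}" for n using xi by blast
  have ab: "\<bar>\<rho> n\<bar> \<le> 1" for n using val[of n] by auto
  have one\<rho>: "\<rho> 1 = 1" using one by (simp add: \<rho>_def)
  have m0: "mean = 0" by (rule mean_nontrivial[OF nt])
  have E: "\<bar>\<Sum>k=1..n. \<rho> k\<bar> \<le> 2 * real Q" for n
  proof -
    have "(\<Sum>k=1..n. \<rho> k) = Re (E n)" by (simp add: E_def m0 \<rho>_def)
    then show ?thesis using norm_E_le[of n] abs_Re_le_cmod[of "E n"] by linarith
  qed
  have harm: "(\<lambda>n. \<rho> n / real n) sums 0"
  proof -
    have "(\<lambda>n. \<xi> n * of_nat n powr (-1)) sums 0" using Lr_sums[of 1] L0 m0 by simp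
    then have "(\<lambda>n. Re (\<xi> n * of_nat n powr (-1))) sums Re 0" by (rule sums_Re)
    moreover have "Re (\<xi> n * of_nat n powr (-1)) = \<rho> n / real n" for n
    proof (cases "n = 0")
      case False
      have "of_nat n powr (-1) = complex_of_real (1 / real n)"
        using False by (simp add: powr_minus divide_inverse)
      then show ?thesis by (simp add: \<rho>_def del: of_real_divide)
    qed simp
    ultimately show ?thesis by simp
  qed
  \<comment> \<open>K squares contribute at least 1/2 each, and K/2 = 2Q + 2 exceeds the upper bound
    2Q.\<close>
  define K where "K = 4 * Q + 4"
  define k2 where "k2 = real (K\<^sup>2)"
  \<comment> \<open>Close enough to 1 that Bernoulli gives x^(K^2) \<ge> 1/2, hence x^(k^2) \<ge>
    1/2 for all k \<le> K.\<close>
  define x where "x = 1 - 1 / (2 * k2)"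
  have K: "K \<ge> 1" by (simp add: K_def)
  have k2: "k2 \<ge> 1" unfolding k2_def using K by (metis of_nat_1 of_nat_le_iff one_le_power)
  then have "1 / (2 * k2) \<le> 1/2" "1 / (2 * k2) > 0" by (auto simp: field_simps)
  then have x: "0 < x" "x < 1" unfolding x_def by linarith+
  have xK: "x ^ (K\<^sup>2) \<ge> 1/2"
  proof -
    have "1 + real (K\<^sup>2) * (x - 1) \<le> (1 + (x - 1)) ^ (K\<^sup>2)" using x by (intro Bernoulli_inequality) auto
    moreover have "k2 * (x - 1) = - 1/2" using k2 by (simp add: x_def)
    then have "real (K\<^sup>2) * (x - 1) = - 1/2" by (simp only: k2_def)
    ultimately show ?thesis by simp
  qed
  define b where "b d = 1 / (real d * (1 - x)) - x ^ d / (1 - x ^ d)" for d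
  from lambert_has_sum[of x \<rho>, OF x ab] obtain F where
    F1: "((\<lambda>n. (\<Sum>d | d dvd n. \<rho> d) * x ^ n) has_sum F) {1..}" and
    F2: "((\<lambda>d. \<rho> d * (x ^ d / (1 - x ^ d))) has_sum F) {1..}" by blast
  have lower: "F \<ge> real K * (1/2)"
  proof -
    define T where "T = (\<lambda>k. k\<^sup>2) ` {1..K}"
    have inj: "inj_on (\<lambda>k::nat. k\<^sup>2) {1..K}" by (auto intro!: inj_onI)
    have "real K * (1/2) \<le> (\<Sum>k=1..K. (\<Sum>d | d dvd k\<^sup>2. \<rho> d) * x ^ (k\<^sup>2))"
    proof -
      have "(\<Sum>d | d dvd k\<^sup>2. \<rho> d) * x ^ (k\<^sup>2) \<ge> 1 * (1/2)" if "k \<in> {1..K}" for k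
      proof -
        have "x ^ (K\<^sup>2) \<le> x ^ (k\<^sup>2)" using x that by (intro power_decreasing power_mono) auto
        then show ?thesis using xK divisor_sum_real_char(2)[of \<rho> k, OF mult\<rho> val one\<rho>] that
          by (intro mult_mono) auto
      qed
      then have "(\<Sum>k=1..K. 1 * (1/2)) \<le> (\<Sum>k=1..K. (\<Sum>d | d dvd k\<^sup>2. \<rho> d) * x ^ (k\<^sup>2))" by (intro sum_mono)
      then show ?thesis by simp
    qed
    also have "\<dots> = (\<Sum>n\<in>T. (\<Sum>d | d dvd n. \<rho> d) * x ^ n)" unfolding T_def by (subst sum.reindex[OF inj]) simp
    also have "\<dots> \<le> F"
    proof (rule finite_sum_le_has_sum[OF F1])
      show "0 \<le> (\<Sum>d | d dvd n. \<rho> d) * x ^ n" if "n \<in> {1..} - T" for n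
        using divisor_sum_real_char(1)[of \<rho> n, OF mult\<rho> val one\<rho>] that x by simp
    qed (auto simp: T_def Suc_le_eq)
    finally show ?thesis .
  qed
  have upper: "\<bar>F\<bar> \<le> 2 * real Q"
  proof -
    have "((\<lambda>d. \<rho> d * (x ^ d / (1 - x ^ d))) has_sum F) UNIV"
      by (rule has_sum_cong_neutral[THEN iffD1, OF _ _ _ F2]) (auto simp: not_le)
    then have F: "(\<lambda>d. \<rho> d * (x ^ d / (1 - x ^ d))) sums F" by (rule has_sum_imp_sums)
    have "(\<lambda>d. \<rho> d / real d * (1 / (1 - x)) - \<rho> d * (x ^ d / (1 - x ^ d))) sums (0 * (1 / (1 - x)) - F)"
      by (intro sums_diff sums_mult2 harm F)
    moreover have "\<rho> d / real d * (1 / (1 - x)) - \<rho> d * (x ^ d / (1 - x ^ d)) = \<rho> d * b d" for d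
      by (simp add: b_def algebra_simps)
    ultimately have "(\<lambda>d. \<rho> d * b d) sums (- F)" by simp
    then have "(\<lambda>n. \<Sum>d<Suc n. \<rho> d * b d) \<longlonglongrightarrow> - F" unfolding sums_def by (rule LIMSEQ_Suc)
    moreover have "(\<Sum>d<Suc n. \<rho> d * b d) = (\<Sum>d=1..n. \<rho> d * b d)" for n
    proof -
      have "{..<Suc n} = insert 0 {1..n}" by auto
      then show ?thesis by (simp add: b_def)
    qed
    ultimately have "(\<lambda>n. \<bar>\<Sum>d=1..n. \<rho> d * b d\<bar>) \<longlonglongrightarrow> \<bar>- F\<bar>" by (intro tendsto_rabs) simp
    moreover have "\<bar>\<Sum>d=1..n. \<rho> d * b d\<bar> \<le> 2 * real Q" for n
    proof -
      have "\<bar>\<Sum>d=1..n. \<rho> d * b d\<bar> \<le> 2 * real Q * b 1"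
        by (rule abel_antimono_bound[OF E]) (use lambert_coeff_antimono[OF x] in \<open>auto simp: b_def\<close>)
      \<comment> \<open>The poles of 1/(1 - x) and x/(1 - x) cancel, which makes the upper bound
        independent of x.\<close>
      moreover have "b 1 = 1" using x by (simp add: b_def diff_divide_distrib[symmetric])
      ultimately show ?thesis by simp
    qed
    ultimately show ?thesis using LIMSEQ_le_const2[of _ "\<bar>- F\<bar>" "2 * real Q"] by auto
  qed
  show False using lower upper by (simp add: K_def)
qed

text \<open>The 3-4-1 inequality leaves open only a nontrivial character with trivial square at s =
  1, which is the case settled by the Lambert series.\<close>

theorem Lx_nonzero_closed:
  assumes "Re z \<ge> 1"
  shows "Lx z \<noteq> 0"
proof (cases "Re z > 1")
  case False
  then have z: "Re z = 1" using assms by simp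
  interpret d2: dchar Q "\<lambda>n. (\<xi> n)\<^sup>2" by (rule dchar_square)
  show ?thesis
  proof (cases "z = 1 \<and> \<not> trivial_char \<and> d2.trivial_char")
    case True
    then have "Lr 1 \<noteq> 0" by (intro Lr_1_nonzero_real) (auto simp: d2.trivial_char_def)
    then show ?thesis using True by (simp add: Lx_def)
  next
    case False
    then show ?thesis by (intro Lx_line_nonzero z) auto
  qed
qed (rule Lx_nonzero)

end

section \<open>Counting primes\<close>

text \<open>From n to n + 1 the quotient by d increases exactly when d divides n + 1, and the von
  Mangoldt values at those d sum to ln(n + 1).\<close>

lemma ln_fact_eq_mangoldt_sum:
  "ln (fact n :: real) = (\<Sum>d=1..n. mangoldt d * real (n div d))"
proof (induction n)
  case (Suc n)
  have div: "real (Suc n div d) = real (n div d) + (if d dvd Suc n then 1 else 0)" for d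
    by (simp add: div_Suc dvd_eq_mod_eq_0)
  have "(\<Sum>d=1..Suc n. mangoldt d * real (Suc n div d)) = (\<Sum>d=1..Suc n. mangoldt d * real (n div d)) + (\<Sum>d=1..Suc n. if d dvd Suc n then mangoldt d else 0)"
    unfolding sum.distrib[symmetric] by (intro sum.cong refl) (simp add: div distrib_left)
  also have "(\<Sum>d=1..Suc n. mangoldt d * real (n div d)) = (\<Sum>d=1..n. mangoldt d * real (n div d))" by simp
  also have "(\<Sum>d=1..Suc n. if d dvd Suc n then mangoldt d else 0) = (\<Sum>d | d dvd Suc n. mangoldt d :: real)"
    by (intro sum.mono_neutral_cong_right) (auto dest: dvd_imp_le intro!: Suc_leI Nat.gr0I)
  also have "\<dots> = ln (real (Suc n))" by (subst mangoldt_sum) auto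
  finally show ?case using Suc.IH by (simp add: ln_mult)
qed simp

definition psi :: "nat \<Rightarrow> real" where "psi n = (\<Sum>k=1..n. mangoldt k)"

text \<open>In the expansion of the logarithm of the central binomial coefficient, d carries the
  weight floor(2n/d) - 2 floor(n/d), which is never negative and equals 1 for n < d \<le> 2n. The
  coefficient itself is at most 4^n.\<close>

lemma psi_double: "psi (2 * n) - psi n \<le> 2 * real n * ln 2"
proof -
  have e1: "ln (fact n :: real) = (\<Sum>d=1..2*n. mangoldt d * real (n div d))"
    unfolding ln_fact_eq_mangoldt_sum by (intro sum.mono_neutral_left) auto
  have "psi (2 * n) - psi n = (\<Sum>d\<in>{Suc n..2*n}. mangoldt d)"
  proof -
    have "{1..2*n} = {1..n} \<union> {Suc n..2*n}" by auto
    then have "psi (2 * n) = psi n + (\<Sum>d\<in>{Suc n..2*n}. mangoldt d)"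
      unfolding psi_def by (simp only:) (rule sum.union_disjoint, auto)
    then show ?thesis by simp
  qed
  also have "\<dots> \<le> (\<Sum>d\<in>{Suc n..2*n}. mangoldt d * (real ((2 * n) div d) - 2 * real (n div d)))"
  proof (rule sum_mono)
    fix d assume d: "d \<in> {Suc n..2*n}"
    then have "(2 * n) div d = 1" "n div d = 0" by (auto simp: div_nat_eqI)
    then show "mangoldt d \<le> mangoldt d * (real ((2 * n) div d) - 2 * real (n div d))" by simp
  qed
  also have "\<dots> \<le> (\<Sum>d=1..2*n. mangoldt d * (real ((2 * n) div d) - 2 * real (n div d)))"
  proof (rule sum_mono2)
    fix d assume "d \<in> {1..2*n} - {Suc n..2*n}"
    have "2 * (n div d) \<le> (2 * n) div d"
    proof (cases "d = 0")
      case False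
      have "(2 * (n div d)) * d \<le> 2 * n" using div_times_less_eq_dividend[of n d] by simp
      then show ?thesis using False by (simp add: less_eq_div_iff_mult_less_eq)
    qed simp
    then have "2 * real (n div d) \<le> real ((2 * n) div d)" by linarith
    then show "0 \<le> mangoldt d * (real ((2 * n) div d) - 2 * real (n div d))" using mangoldt_nonneg[of d] by simp
  qed auto
  also have "\<dots> = ln (fact (2 * n)) - 2 * ln (fact n :: real)"
    unfolding e1 ln_fact_eq_mangoldt_sum[of "2 * n"] by (simp add: right_diff_distrib sum_subtractf sum_distrib_left mult_ac)
  also have "\<dots> = ln (real ((2 * n) choose n))"
    by (simp add: binomial_fact ln_div ln_mult)
  also have "\<dots> \<le> ln (2 ^ (2 * n))"
  proof -
    have "(2 * n) choose n \<le> 2 ^ (2 * n)" by (rule binomial_le_pow2)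
    then have "real ((2 * n) choose n) \<le> 2 ^ (2 * n)" by (metis of_nat_le_iff of_nat_numeral of_nat_power)
    then show ?thesis by (subst ln_le_cancel_iff) auto
  qed
  also have "\<dots> = 2 * real n * ln 2" by (simp add: ln_realpow)
  finally show ?thesis .
qed

text \<open>Halving gives 4m + 2m = 6m for the argument 2m; the slack up to 8m pays for the last
  term when n = 2m + 1 is odd.\<close>

lemma psi_le: "psi n \<le> 4 * real n"
proof (induction n rule: less_induct)
  case (less n)
  show ?case
  proof (cases "n = 0")
    case True then show ?thesis by (simp add: psi_def)
  next
    case False
    define m where "m = n div 2"
    have m: "m < n" using False by (simp add: m_def)
    have l2: "ln 2 \<le> (1::real)" using ln_le_minus_one[of 2] by simp
    have "2 * real m * ln 2 \<le> 2 * real m * 1" using l2 by (intro mult_left_mono) auto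
    then have p2: "psi (2 * m) \<le> 6 * real m" using psi_double[of m] less.IH[OF m] by linarith
    show ?thesis
    proof (cases "even n")
      case True
      then show ?thesis using p2 by (auto simp: m_def)
    next
      case False
      then have n: "n = Suc (2 * m)" by (simp add: m_def)
      have "mangoldt n \<le> ln (real n)" using n by (intro mangoldt_le) simp
      also have "\<dots> \<le> real n - 1" using n by (intro ln_le_minus_one) simp
      finally have "mangoldt n \<le> 2 * real m" by (simp add: n)
      moreover have "psi n = psi (2 * m) + mangoldt n" by (simp add: n psi_def)
      ultimately show ?thesis using p2 n by simp
    qed
  qed
qed

section \<open>Means of the von Mangoldt function against combinations of characters\<close>

text \<open>H continues zeta(s) - 1/(s - 1); the singularity is removable because the residue is
  1.\<close>

lemma zeta_minus_pole_holomorphic: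
  "\<exists>H. H holomorphic_on {s. Re s > 0} \<and> (\<forall>s. s \<noteq> 1 \<longrightarrow> H s = (zeta_reg s - 1) / (s - 1))"
proof -
  have "(\<lambda>z. if z = 1 then deriv zeta_reg 1 else (zeta_reg z - zeta_reg 1) / (z - 1)) holomorphic_on {s. Re s > 0}"
    by (rule pole_lemma_open[OF zeta_reg_holomorphic open_Re_gt])
  then show ?thesis by (intro exI conjI) (auto simp: zeta_reg_1)
qed

text \<open>Each trivial character contributes w_j/(s - 1) to the Dirichlet series, so the total
  pole is c/(s - 1), and subtracting c from the coefficients removes it. As f \<ge> 0, the result is
  bounded below; as f \<le> 1, Chebyshev's bound controls its partial sums.\<close>

theorem weighted_mangoldt_mean:
  fixes f :: "nat \<Rightarrow> real" and w :: "'j \<Rightarrow> complex" and \<xi> :: "'j \<Rightarrow> nat \<Rightarrow> complex"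
  assumes J: "finite J" and ch: "\<And>j. j \<in> J \<Longrightarrow> dchar Q (\<xi> j)"
    and f: "\<And>n. 0 \<le> f n" "\<And>n. f n \<le> 1" and fw: "\<And>n. of_real (f n) = (\<Sum>j\<in>J. w j * \<xi> j n)"
    and c: "of_real c = (\<Sum>j\<in>J. if dchar.trivial_char Q (\<xi> j) then w j else 0)"
  shows "(\<lambda>n. (\<Sum>k=1..n. mangoldt k * f k) / real n) \<longlonglongrightarrow> c"
proof -
  define \<alpha> where "\<alpha> n = mangoldt n * f n - c" for n
  define D where "D j = dchar.D (\<xi> j)" for j
  define Lx where "Lx j = dchar.Lx Q (\<xi> j)" for j
  define triv where "triv j = dchar.trivial_char Q (\<xi> j)" for j
  from zeta_minus_pole_holomorphic obtain H where H: "H holomorphic_on {s. Re s > 0}" "\<forall>s. s \<noteq> 1 \<longrightarrow> H s = (zeta_reg s - 1) / (s - 1)"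
    by (elim exE conjE)
  \<comment> \<open>The continuation in a form without poles: what the trivial characters contribute
    at s = 1 has been cancelled against c/(s - 1).\<close>
  define G where "G s = - (\<Sum>j\<in>J. w j * (deriv (Lx j) s / Lx j s)) - of_real c * H s" for s
  \<comment> \<open>Where no \<open>Lx j\<close> vanishes; the leading half-plane keeps U inside Re
    s > 0 even for empty J.\<close>
  define U where "U = {s. Re s > 0} \<inter> (\<Inter>j\<in>J. {s. Re s > 0} \<inter> Lx j -` (- {0}))"
  have LxJ: "Lx j holomorphic_on {s. Re s > 0}" if "j \<in> J" for j
    unfolding Lx_def using dchar.Lx_holomorphic[OF ch[OF that]] .
  have "open U"
    unfolding U_def using J LxJ
    by (intro open_Int open_Re_gt open_INT continuous_open_preimage ballI holomorphic_on_imp_continuous_on) auto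
  moreover have "{s. Re s \<ge> 1} \<subseteq> U"
    using dchar.Lx_nonzero_closed[OF ch] by (auto simp: U_def Lx_def)
  moreover have "G holomorphic_on U"
  proof -
    have "(\<lambda>s. deriv (Lx j) s / Lx j s) holomorphic_on U" if "j \<in> J" for j
    proof (rule holomorphic_on_divide)
      have sub: "U \<subseteq> {s. Re s > 0}" by (auto simp: U_def)
      show "Lx j holomorphic_on U" using LxJ[OF that] sub holomorphic_on_subset by blast
      have "deriv (Lx j) holomorphic_on {s. Re s > 0}" using LxJ[OF that] open_Re_gt by (rule holomorphic_deriv)
      then show "deriv (Lx j) holomorphic_on U" using sub holomorphic_on_subset by blast
      show "Lx j s \<noteq> 0" if "s \<in> U" for s using that \<open>j \<in> J\<close> unfolding U_def by blast
    qed
    moreover have "H holomorphic_on U" using H(1) by (rule holomorphic_on_subset) (auto simp: U_def)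
    ultimately show ?thesis unfolding G_def
      by (intro holomorphic_on_diff holomorphic_on_minus holomorphic_on_sum holomorphic_on_mult holomorphic_on_const)
  qed
  moreover have "(\<lambda>n. of_real (\<alpha> n) * of_nat n powr (-s)) sums G s" if s: "Re s > 1" for s
  proof -
    have s1: "s \<noteq> 1" using s by auto
    have "(\<lambda>n. mangoldt n * \<xi> j n * of_nat n powr (-s)) sums D j s" if "j \<in> J" for j
      unfolding D_def dchar.D_def[OF ch[OF that]]
      by (rule summable_sums[OF summable_norm_cancel[OF dchar.D_summable[OF ch[OF that] s]]])
    then have "(\<lambda>n. (\<Sum>j\<in>J. w j * (mangoldt n * \<xi> j n * of_nat n powr (-s))) - of_real c * of_nat n powr (-s)) sums
       ((\<Sum>j\<in>J. w j * D j s) - of_real c * (zeta_reg s / (s - 1)))"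
      by (intro sums_diff sums_sum sums_mult zeta_sums s)
    moreover have "(\<Sum>j\<in>J. w j * (mangoldt n * \<xi> j n * of_nat n powr (-s))) - of_real c * of_nat n powr (-s)
        = of_real (\<alpha> n) * of_nat n powr (-s)" for n
    proof -
      have "(\<Sum>j\<in>J. w j * (mangoldt n * \<xi> j n * of_nat n powr (-s))) = (\<Sum>j\<in>J. w j * \<xi> j n) * (mangoldt n * of_nat n powr (-s))"
        unfolding sum_distrib_right by (intro sum.cong refl) (simp only: mult_ac)
      also have "\<dots> = of_real (f n) * mangoldt n * of_nat n powr (-s)" unfolding fw by simp
      finally show ?thesis by (simp add: \<alpha>_def algebra_simps)
    qed
    moreover have "(\<Sum>j\<in>J. w j * D j s) - of_real c * (zeta_reg s / (s - 1)) = G s"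
    proof -
      have "w j * D j s = (if triv j then w j else 0) * (1 / (s - 1)) - w j * (deriv (Lx j) s / Lx j s)" if "j \<in> J" for j
        unfolding D_def Lx_def triv_def dchar.D_eq[OF ch[OF that] s] by (simp add: algebra_simps)
      then have "(\<Sum>j\<in>J. w j * D j s) = (\<Sum>j\<in>J. (if triv j then w j else 0) * (1 / (s - 1)) - w j * (deriv (Lx j) s / Lx j s))"
        by (intro sum.cong refl)
      also have "\<dots> = of_real c * (1 / (s - 1)) - (\<Sum>j\<in>J. w j * (deriv (Lx j) s / Lx j s))"
        unfolding c triv_def by (simp only: sum_subtractf sum_distrib_right)
      finally show ?thesis using H(2)[rule_format, OF s1] s1 by (simp add: G_def diff_divide_distrib right_diff_distrib)
    qed
    ultimately show ?thesis by simp
  qed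
  moreover have "\<alpha> n \<ge> - (\<bar>c\<bar> + 1)" for n
    using mult_nonneg_nonneg[OF mangoldt_nonneg[of n] f(1)[of n]] by (simp add: \<alpha>_def)
  moreover have sum\<alpha>: "sum \<alpha> {1..n} = (\<Sum>k=1..n. mangoldt k * f k) - c * real n" for n
    by (simp add: \<alpha>_def sum_subtractf)
  have "\<bar>sum \<alpha> {1..n}\<bar> \<le> (4 + \<bar>c\<bar>) * real n" for n
  proof -
    have "(\<Sum>k=1..n. mangoldt k * f k) \<le> psi n"
      unfolding psi_def using f mangoldt_nonneg by (intro sum_mono mult_left_le) auto
    moreover have "(\<Sum>k=1..n. mangoldt k * f k) \<ge> 0" using f mangoldt_nonneg by (intro sum_nonneg mult_nonneg_nonneg) auto
    moreover have "\<bar>c * real n\<bar> = \<bar>c\<bar> * real n" by (simp add: abs_mult)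
    ultimately show ?thesis using psi_le[of n] unfolding sum\<alpha> by (simp add: distrib_right)
  qed
  ultimately have "(\<lambda>n. sum \<alpha> {1..n} / real n) \<longlonglongrightarrow> 0"
    by (intro tauberian_bounded_below[where c = "\<bar>c\<bar> + 1" and G = G and U = U]) auto
  then have "(\<lambda>n. sum \<alpha> {1..n} / real n + c) \<longlonglongrightarrow> 0 + c" by (intro tendsto_intros)
  moreover have "\<forall>\<^sub>F n in sequentially. sum \<alpha> {1..n} / real n + c = (\<Sum>k=1..n. mangoldt k * f k) / real n"
    using eventually_gt_at_top[of 0] by eventually_elim (simp add: sum\<alpha>[unfolded One_nat_def] diff_divide_distrib)
  ultimately show ?thesis by (simp add: tendsto_cong)
qed

section \<open>From the von Mangoldt function to counting primes\<close>

definition prime_count :: "nat set \<Rightarrow> nat \<Rightarrow> real" where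
  "prime_count T n = real (card {p. prime p \<and> p \<le> n \<and> p \<in> T})"

lemma finite_primes_le: "finite {p::nat. prime p \<and> p \<le> n \<and> P p}"
  by (rule finite_subset[of _ "{..n}"]) auto

text \<open>An error term that serves all sets T at once: the cost of weighting primes by ln n
  instead of ln p, plus the contribution of proper prime powers.\<close>

definition prime_count_defect :: "nat \<Rightarrow> real" where
  "prime_count_defect n = (\<Sum>p | prime p \<and> p \<le> n. ln (real n) - ln (real p)) + (\<Sum>k | k \<in> {1..n} \<and> \<not> prime k. mangoldt k)"

lemma prime_count_psi_diff:
  "\<bar>prime_count T n * ln (real n) - (\<Sum>k=1..n. mangoldt k * indicator T k)\<bar> \<le> prime_count_defect n"
proof -
  define A where "A = {p. prime p \<and> p \<le> n}"
  define B where "B = {k. k \<in> {1..n} \<and> \<not> prime k}"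
  have AB: "finite A" "finite B" "A \<inter> B = {}" "{1..n} = A \<union> B"
    using finite_primes_le[of n "\<lambda>_. True"] prime_gt_0_nat by (auto simp: A_def B_def Suc_le_eq)
  have "prime_count T n * ln (real n) = (\<Sum>p\<in>A. indicator T p * ln (real n))"
  proof -
    have "{p. prime p \<and> p \<le> n \<and> p \<in> T} = A \<inter> T" by (auto simp: A_def)
    moreover have "(\<Sum>p\<in>A \<inter> T. 1::real) = (\<Sum>p\<in>A. if p \<in> T then 1 else 0)" by (rule sum.inter_restrict[OF AB(1)])
    ultimately have "prime_count T n = (\<Sum>p\<in>A. indicator T p)" unfolding prime_count_def by (simp add: indicator_def of_bool_def)
    then show ?thesis by (simp add: sum_distrib_right)
  qed
  moreover have "(\<Sum>k=1..n. mangoldt k * indicator T k) = (\<Sum>p\<in>A. ln (real p) * indicator T p) + (\<Sum>k\<in>B. mangoldt k * indicator T k)"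
    unfolding AB(4) by (subst sum.union_disjoint) (use AB in \<open>auto simp: A_def\<close>)
  ultimately have eq: "prime_count T n * ln (real n) - (\<Sum>k=1..n. mangoldt k * indicator T k) =
      (\<Sum>p\<in>A. indicator T p * (ln (real n) - ln (real p))) - (\<Sum>k\<in>B. mangoldt k * indicator T k)"
    by (simp add: right_diff_distrib sum_subtractf mult.commute)
  have nA: "0 \<le> ln (real n) - ln (real p)" if "p \<in> A" for p
  proof -
    have "p > 0" "p \<le> n" using that prime_gt_0_nat by (auto simp: A_def)
    then show ?thesis by simp
  qed
  have "0 \<le> (\<Sum>p\<in>A. indicator T p * (ln (real n) - ln (real p)))" by (intro sum_nonneg mult_nonneg_nonneg nA) auto
  moreover have "(\<Sum>p\<in>A. indicator T p * (ln (real n) - ln (real p))) \<le> (\<Sum>p\<in>A. ln (real n) - ln (real p))"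
    using nA by (intro sum_mono mult_left_le_one_le) (auto simp: indicator_def)
  moreover have "0 \<le> (\<Sum>k\<in>B. mangoldt k * indicator T k :: real)" using mangoldt_nonneg by (intro sum_nonneg mult_nonneg_nonneg) auto
  moreover have "(\<Sum>k\<in>B. mangoldt k * indicator T k) \<le> (\<Sum>k\<in>B. mangoldt k :: real)"
    using mangoldt_nonneg by (intro sum_mono mult_left_le) (auto simp: indicator_def)
  moreover have "prime_count_defect n = (\<Sum>p\<in>A. ln (real n) - ln (real p)) + (\<Sum>k\<in>B. mangoldt k)"
    by (simp add: prime_count_defect_def A_def B_def)
  ultimately show ?thesis unfolding eq by linarith
qed

text \<open>A proper prime power p^i \<le> n has p at most sqrt n and i at most log 2 n, and each
  contributes at most ln n.\<close>

lemma nonprime_mangoldt_bound: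
  assumes "n > 0"
  shows "(\<Sum>k | k \<in> {1..n} \<and> \<not> prime k. mangoldt k) \<le> sqrt (real n) * (log 2 (real n) + 1) * ln (real n)"
proof -
  define a where "a = nat \<lfloor>sqrt (real n)\<rfloor>"
  define b where "b = nat \<lfloor>log 2 (real n)\<rfloor>"
  have l0: "log 2 (real n) \<ge> 0" "ln (real n) \<ge> 0" using assms by auto
  define B where "B = {k. k \<in> {1..n} \<and> \<not> prime k \<and> primepow k}"
  have sub: "B \<subseteq> (\<lambda>(p, i). p ^ i) ` ({1..a} \<times> {..b})"
  proof
    fix k assume "k \<in> B"
    then have k: "1 \<le> k" "k \<le> n" "\<not> prime k" "primepow k" by (auto simp: B_def)
    then obtain p i where pi: "prime p" "i > 0" "k = p ^ i" by (auto simp: primepow_def)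
    have "i \<noteq> 1" using pi k(3) by auto
    then have i2: "i \<ge> 2" using pi(2) by simp
    have p1: "p \<ge> 2" using pi(1) prime_ge_2_nat by blast
    have "p ^ 2 \<le> p ^ i" using i2 p1 by (intro power_increasing) auto
    then have "p\<^sup>2 \<le> n" using k(2) pi(3) by simp
    then have "(real p)\<^sup>2 \<le> real n" by (metis of_nat_le_iff of_nat_power)
    then have "real p \<le> sqrt (real n)" by (rule real_le_rsqrt)
    then have "p \<le> a" unfolding a_def by (simp add: le_nat_floor)
    moreover have "2 ^ i \<le> p ^ i" using p1 by (intro power_mono) auto
    then have "2 ^ i \<le> n" using k(2) pi(3) by linarith
    then have "2 ^ i \<le> real n" by (metis of_nat_le_iff of_nat_numeral of_nat_power)
    then have "real i \<le> log 2 (real n)" using assms by (intro le_log_of_power) auto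
    then have "i \<le> b" unfolding b_def by (simp add: le_nat_floor)
    ultimately show "k \<in> (\<lambda>(p, i). p ^ i) ` ({1..a} \<times> {..b})"
      using pi p1 by (intro image_eqI[of _ _ "(p, i)"]) auto
  qed
  have "card B \<le> card ((\<lambda>(p, i). p ^ i) ` ({1..a} \<times> {..b}))" by (intro card_mono sub) auto
  also have "\<dots> \<le> card ({1..a} \<times> {..b})" by (rule card_image_le) auto
  finally have cB: "card B \<le> a * (b + 1)" by simp
  have "(\<Sum>k | k \<in> {1..n} \<and> \<not> prime k. mangoldt k) = (\<Sum>k\<in>B. mangoldt k :: real)"
    by (rule sum.mono_neutral_right) (auto simp: B_def mangoldt_def)
  also have "\<dots> \<le> real (card B) * ln (real n)"
  proof (rule sum_bounded_above)
    fix k assume k: "k \<in> B"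
    then have "mangoldt k \<le> ln (real k)" by (intro mangoldt_le) (auto simp: B_def)
    also have "\<dots> \<le> ln (real n)" using k by (auto simp: B_def)
    finally show "mangoldt k \<le> ln (real n)" .
  qed
  also have "\<dots> \<le> (sqrt (real n) * (log 2 (real n) + 1)) * ln (real n)"
  proof (rule mult_right_mono[OF _ l0(2)])
    have "real (card B) \<le> real a * (real b + 1)" using cB by (metis of_nat_1 of_nat_add of_nat_le_iff of_nat_mult)
    also have "\<dots> \<le> sqrt (real n) * (log 2 (real n) + 1)"
      using l0 by (intro mult_mono add_mono) (auto simp: a_def b_def)
    finally show "real (card B) \<le> sqrt (real n) * (log 2 (real n) + 1)" .
  qed
  finally show ?thesis .
qed

text \<open>Cut at n^(1-\<delta>): below it there are few numbers at all, and above it ln n - ln p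
  is at most \<delta> ln n while Chebyshev's bound limits the number of primes.\<close>

lemma prime_log_defect_bound:
  assumes n: "n > 1" and \<delta>: "0 < \<delta>" "\<delta> \<le> 1/2"
  shows "(\<Sum>p | prime p \<and> p \<le> n. ln (real n) - ln (real p)) \<le> real n powr (1 - \<delta>) * ln (real n) + 8 * \<delta> * real n"
proof -
  define y where "y = real n powr (1 - \<delta>)"
  define A where "A = {p. prime p \<and> p \<le> n \<and> real p \<le> y}"
  define B where "B = {p. prime p \<and> p \<le> n \<and> real p > y}"
  have fin: "finite A" "finite B" "A \<inter> B = {}" unfolding A_def B_def by (auto intro: finite_primes_le)
  have ln0: "ln (real n) > 0" using n by simp
  have lny: "ln y = (1 - \<delta>) * ln (real n)" using n by (simp add: y_def ln_powr)
  have y0: "y > 0" using n by (simp add: y_def)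
  have "(\<Sum>p | prime p \<and> p \<le> n. ln (real n) - ln (real p)) = (\<Sum>p\<in>A \<union> B. ln (real n) - ln (real p))"
    by (rule sum.cong) (auto simp: A_def B_def)
  also have "\<dots> = (\<Sum>p\<in>A. ln (real n) - ln (real p)) + (\<Sum>p\<in>B. ln (real n) - ln (real p))"
    by (rule sum.union_disjoint) (use fin in auto)
  also have "(\<Sum>p\<in>A. ln (real n) - ln (real p)) \<le> real (card A) * ln (real n)"
  proof (rule sum_bounded_above)
    fix p assume "p \<in> A"
    then have "p \<ge> 1" using prime_gt_0_nat by (auto simp: A_def Suc_le_eq)
    then show "ln (real n) - ln (real p) \<le> ln (real n)" by simp
  qed
  also have "real (card A) * ln (real n) \<le> y * ln (real n)"
  proof (rule mult_right_mono)
    have "A \<subseteq> {1..nat \<lfloor>y\<rfloor>}" using prime_gt_0_nat by (auto simp: A_def Suc_le_eq le_nat_floor)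
    then have "card A \<le> card {1..nat \<lfloor>y\<rfloor>}" by (intro card_mono) auto
    then have "real (card A) \<le> real (nat \<lfloor>y\<rfloor>)" by simp
    also have "\<dots> \<le> y" using y0 by (intro of_nat_floor) auto
    finally show "real (card A) \<le> y" .
  qed (use ln0 in simp)
  also have "(\<Sum>p\<in>B. ln (real n) - ln (real p)) \<le> real (card B) * (\<delta> * ln (real n))"
  proof (rule sum_bounded_above)
    fix p assume p: "p \<in> B"
    then have "ln y \<le> ln (real p)" using y0 by (auto simp: B_def)
    then show "ln (real n) - ln (real p) \<le> \<delta> * ln (real n)" unfolding lny by (simp add: algebra_simps)
  qed
  also have "real (card B) * (\<delta> * ln (real n)) \<le> 8 * \<delta> * real n"
  proof -
    \<comment> \<open>For \<delta> \<le> 1/2 each prime above the cut has ln p \<ge> (ln n)/2; with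
      psi n \<le> 4n this gives the constant 8.\<close>
    have "real (card B) * ((1/2) * ln (real n)) \<le> (\<Sum>p\<in>B. mangoldt p)"
    proof (rule sum_bounded_below)
      fix p assume p: "p \<in> B"
      have "(1/2) * ln (real n) \<le> (1 - \<delta>) * ln (real n)" using \<delta> ln0 by (intro mult_right_mono) auto
      also have "\<dots> \<le> ln (real p)" using p y0 by (auto simp: B_def lny[symmetric])
      finally show "(1/2) * ln (real n) \<le> mangoldt p" using p by (simp add: B_def)
    qed
    also have "\<dots> \<le> psi n" unfolding psi_def
      using mangoldt_nonneg prime_gt_0_nat by (intro sum_mono2) (auto simp: B_def Suc_le_eq)
    also have "\<dots> \<le> 4 * real n" by (rule psi_le)
    finally have "real (card B) * ln (real n) \<le> 8 * real n" by simp
    then have "\<delta> * (real (card B) * ln (real n)) \<le> \<delta> * (8 * real n)" using \<delta> by (intro mult_left_mono) auto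
    then show ?thesis by (simp add: mult_ac)
  qed
  finally show ?thesis by (simp add: y_def)
qed

lemma prime_count_defect_small: "(\<lambda>n. prime_count_defect n / real n) \<longlonglongrightarrow> 0"
proof (rule tendstoI)
  fix e :: real assume e: "e > 0"
  define \<delta> where "\<delta> = min (1/2) (e / 32)"
  have \<delta>: "0 < \<delta>" "\<delta> \<le> 1/2" "8 * \<delta> \<le> e / 4" using e by (auto simp: \<delta>_def min_def)
  have "(\<lambda>n. real n powr (1 - \<delta>) * ln (real n) / real n) \<longlonglongrightarrow> 0" using \<delta>(1) by real_asymp
  then have e1: "\<forall>\<^sub>F n in sequentially. real n powr (1 - \<delta>) * ln (real n) / real n < e / 4"
    using e by (intro order_tendstoD) auto
  have "(\<lambda>n. sqrt (real n) * (log 2 (real n) + 1) * ln (real n) / real n) \<longlonglongrightarrow> 0" by real_asymp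
  then have e2: "\<forall>\<^sub>F n in sequentially. sqrt (real n) * (log 2 (real n) + 1) * ln (real n) / real n < e / 4"
    using e by (intro order_tendstoD) auto
  show "\<forall>\<^sub>F n in sequentially. dist (prime_count_defect n / real n) 0 < e"
    using e1 e2 eventually_gt_at_top[of 1]
  proof eventually_elim
    case (elim n)
    have n: "n > 1" "n > 0" "real n > 0" using elim by auto
    have "prime_count_defect n \<ge> 0" using prime_count_psi_diff[of "{}" n] by linarith
    moreover have "prime_count_defect n / real n < e"
    proof -
      have "prime_count_defect n \<le> (real n powr (1 - \<delta>) * ln (real n) + 8 * \<delta> * real n) + sqrt (real n) * (log 2 (real n) + 1) * ln (real n)"
        unfolding prime_count_defect_def by (intro add_mono prime_log_defect_bound nonprime_mangoldt_bound n \<delta>)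
      then have "prime_count_defect n / real n \<le> ((real n powr (1 - \<delta>) * ln (real n) + 8 * \<delta> * real n) + sqrt (real n) * (log 2 (real n) + 1) * ln (real n)) / real n"
        using n by (intro divide_right_mono) auto
      also have "\<dots> = real n powr (1 - \<delta>) * ln (real n) / real n + 8 * \<delta> + sqrt (real n) * (log 2 (real n) + 1) * ln (real n) / real n"
        using n by (simp add: add_divide_distrib)
      also have "\<dots> < e / 4 + e / 4 + e / 4" using elim \<delta>(3) by linarith
      also have "\<dots> < e" using e by simp
      finally show ?thesis .
    qed
    ultimately show ?case using n by simp
  qed
qed

lemma prime_count_asymptotics:
  assumes "(\<lambda>n. (\<Sum>k=1..n. mangoldt k * indicator T k) / real n) \<longlonglongrightarrow> c"
  shows "(\<lambda>n. prime_count T n * ln (real n) / real n) \<longlonglongrightarrow> c"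
proof -
  define P where "P n = (\<Sum>k=1..n. mangoldt k * indicator T k :: real)" for n :: nat
  have "(\<lambda>n. (prime_count T n * ln (real n) - P n) / real n) \<longlonglongrightarrow> 0"
  proof (rule Lim_null_comparison[OF _ prime_count_defect_small])
    show "\<forall>\<^sub>F n in sequentially. norm ((prime_count T n * ln (real n) - P n) / real n) \<le> prime_count_defect n / real n"
      using prime_count_psi_diff[of T] by (intro always_eventually allI) (simp add: P_def divide_right_mono)
  qed
  from tendsto_add[OF this assms[folded P_def]] show ?thesis by (simp add: diff_divide_distrib)
qed

lemma dchar_one: "dchar 1 (\<lambda>_. 1)"
  by unfold_locales auto

lemma prime_number_theorem: "(\<lambda>n. prime_count UNIV n * ln (real n) / real n) \<longlonglongrightarrow> 1"
proof (rule prime_count_asymptotics)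
  have t: "dchar.trivial_char 1 (\<lambda>_. 1)" unfolding dchar.trivial_char_def[OF dchar_one] by simp
  have "(\<lambda>n. (\<Sum>k=1..n. mangoldt k * (\<lambda>_. 1) k) / real n) \<longlonglongrightarrow> (1::real)"
    by (rule weighted_mangoldt_mean[where J = "{()}" and Q = 1 and \<xi> = "\<lambda>_ _. 1" and w = "\<lambda>_. 1"])
       (use dchar_one t in \<open>auto simp del: One_nat_def\<close>)
  then show "(\<lambda>n. (\<Sum>k=1..n. mangoldt k * indicator UNIV k) / real n) \<longlonglongrightarrow> (1::real)" by simp
qed

text \<open>The set in \<open>fin\<close> consists of the primes at which S and T fail to be
  complementary. Up to that bounded error the counts add up to the count of all primes, and dividing
  by the prime number theorem turns the asymptotics into densities.\<close>

theorem density_of_complement: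
  assumes T: "(\<lambda>n. (\<Sum>k=1..n. mangoldt k * indicator T k) / real n) \<longlonglongrightarrow> c"
    and fin: "finite {p. prime p \<and> (p \<in> S \<longleftrightarrow> p \<in> T)}"
  shows "has_natural_density S (1 - c)"
proof -
  define F where "F = {p. prime p \<and> (p \<in> S \<longleftrightarrow> p \<in> T)}"
  define \<pi> where "\<pi> = prime_count UNIV"
  have close: "\<bar>prime_count S n + prime_count T n - \<pi> n\<bar> \<le> real (card F)" for n
  proof -
    define X where "X = {p. prime p \<and> p \<le> n \<and> p \<in> S}"
    define Y where "Y = {p. prime p \<and> p \<le> n \<and> p \<in> T}"
    define A where "A = {p. prime p \<and> p \<le> n \<and> p \<in> UNIV}"
    have f: "finite X" "finite Y" "finite A" unfolding X_def Y_def A_def by (auto intro: finite_primes_le)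
    have "X \<inter> Y \<subseteq> F" "A - (X \<union> Y) \<subseteq> F" by (auto simp: X_def Y_def A_def F_def)
    then have "card (X \<inter> Y) \<le> card F" "card (A - (X \<union> Y)) \<le> card F" using fin by (auto intro!: card_mono simp: F_def)
    moreover have "card X + card Y = card (X \<union> Y) + card (X \<inter> Y)" by (rule card_Un_Int[OF f(1,2)])
    moreover have "card A = card (X \<union> Y) + card (A - (X \<union> Y))"
    proof -
      have "A = (X \<union> Y) \<union> (A - (X \<union> Y))" by (auto simp: X_def Y_def A_def)
      then show ?thesis using f card_Un_disjoint[of "X \<union> Y" "A - (X \<union> Y)"] by auto
    qed
    ultimately have "\<bar>real (card X) + real (card Y) - real (card A)\<bar> \<le> real (card F)" by linarith
    then show ?thesis by (simp add: prime_count_def X_def Y_def A_def \<pi>_def)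
  qed
  have lim1: "(\<lambda>n. \<pi> n * ln (real n) / real n) \<longlonglongrightarrow> 1" unfolding \<pi>_def by (rule prime_number_theorem)
  have limT: "(\<lambda>n. prime_count T n * ln (real n) / real n) \<longlonglongrightarrow> c" by (rule prime_count_asymptotics[OF T])
  have "(\<lambda>n. (prime_count S n + prime_count T n - \<pi> n) * ln (real n) / real n) \<longlonglongrightarrow> 0"
  proof (rule Lim_null_comparison)
    show "\<forall>\<^sub>F n in sequentially. norm ((prime_count S n + prime_count T n - \<pi> n) * ln (real n) / real n) \<le> real (card F) * (ln (real n) / real n)"
      using eventually_gt_at_top[of 0]
    proof eventually_elim
      case (elim n)
      then have l: "ln (real n) \<ge> 0" "ln (real n) / real n \<ge> 0" by simp_all
      then have "norm ((prime_count S n + prime_count T n - \<pi> n) * ln (real n) / real n) = \<bar>prime_count S n + prime_count T n - \<pi> n\<bar> * (ln (real n) / real n)"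
        by (simp add: abs_mult)
      then show ?case using mult_right_mono[OF close[of n] l(2)] by (simp only:)
    qed
    show "(\<lambda>n. real (card F) * (ln (real n) / real n)) \<longlonglongrightarrow> 0" by real_asymp
  qed
  from tendsto_diff[OF tendsto_add[OF this lim1] limT]
  have "(\<lambda>n. (prime_count S n + prime_count T n - \<pi> n) * ln (real n) / real n + \<pi> n * ln (real n) / real n - prime_count T n * ln (real n) / real n) \<longlonglongrightarrow> 0 + 1 - c" .
  then have limS: "(\<lambda>n. prime_count S n * ln (real n) / real n) \<longlonglongrightarrow> 1 - c"
    by (simp add: diff_divide_distrib add_divide_distrib distrib_right left_diff_distrib)
  have "(\<lambda>n. (prime_count S n * ln (real n) / real n) / (\<pi> n * ln (real n) / real n)) \<longlonglongrightarrow> (1 - c) / 1"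
    by (rule tendsto_divide[OF limS lim1]) simp
  moreover have "\<forall>\<^sub>F n in sequentially. (prime_count S n * ln (real n) / real n) / (\<pi> n * ln (real n) / real n) = prime_count S n / \<pi> n"
    using eventually_gt_at_top[of 1] by eventually_elim simp
  ultimately have "(\<lambda>n. prime_count S n / \<pi> n) \<longlonglongrightarrow> 1 - c" by (simp add: tendsto_cong)
  moreover have "filterlim (\<lambda>x::real. nat \<lfloor>x\<rfloor>) sequentially at_top" by real_asymp
  ultimately have "((\<lambda>x::real. prime_count S (nat \<lfloor>x\<rfloor>) / \<pi> (nat \<lfloor>x\<rfloor>)) \<longlongrightarrow> 1 - c) at_top"
    by (rule filterlim_compose)
  moreover have "\<forall>\<^sub>F x::real in at_top. prime_count S (nat \<lfloor>x\<rfloor>) / \<pi> (nat \<lfloor>x\<rfloor>) =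
      real (card {p. prime p \<and> real p \<le> x \<and> p \<in> S}) / real (card {p::nat. prime p \<and> real p \<le> x})"
    using eventually_ge_at_top[of 0]
  proof eventually_elim
    case (elim x)
    then have "p \<le> nat \<lfloor>x\<rfloor> \<longleftrightarrow> real p \<le> x" for p by (simp add: le_nat_iff le_floor_iff)
    then show ?case by (simp add: prime_count_def \<pi>_def)
  qed
  ultimately show ?thesis unfolding has_natural_density_def using tendsto_cong by fast
qed

section \<open>Polynomials attached to residue characters\<close>

text \<open>Lagrange's bound on roots modulo p: degree below n \<le> p with the n distinct roots 0,
  ..., n-1 forces the zero polynomial modulo p. Synthetic division removes the root n at each step,
  and the differences j - n are units modulo p.\<close>

lemma prime_dvd_coeffs_if_dvd_values:
  fixes f :: "int poly"
  assumes p: "prime p" and "n \<le> p" "\<And>i. i \<ge> n \<Longrightarrow> Polynomial.coeff f i = 0" "\<And>j. j < n \<Longrightarrow> int p dvd poly f (int j)"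
  shows "\<exists>g. f = Polynomial.smult (int p) g"
  using assms(2-)
proof (induction n arbitrary: f)
  case 0
  then have "f = 0" by (simp add: poly_eq_iff)
  then show ?case by (intro exI[of _ 0]) simp
next
  case (Suc n)
  define g where "g = synthetic_div f (int n)"
  have fg: "f = [:- int n, 1:] * g + [:poly f (int n):]" unfolding g_def by (rule synthetic_div_correct'[symmetric])
  have "\<exists>h. g = Polynomial.smult (int p) h"
  proof (rule Suc.IH)
    show "Polynomial.coeff g i = 0" if "i \<ge> n" for i
    proof (cases "degree f = 0")
      case True
      then show ?thesis by (simp add: g_def synthetic_div_eq_0_iff[THEN iffD2])
    next
      case False
      have "degree f \<le> n" using Suc.prems(2) by (intro degree_le) auto
      then show ?thesis using that False by (intro coeff_eq_0) (simp add: g_def degree_synthetic_div)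
    qed
    show "int p dvd poly g (int j)" if j: "j < n" for j
    proof -
      have "poly f (int j) = (int j - int n) * poly g (int j) + poly f (int n)"
        by (subst fg) (simp add: algebra_simps)
      then have "(int j - int n) * poly g (int j) = poly f (int j) - poly f (int n)" by simp
      moreover have "int p dvd poly f (int j) - poly f (int n)" using Suc.prems(3)[of j] Suc.prems(3)[of n] j by (intro dvd_diff) auto
      ultimately have "int p dvd (int j - int n) * poly g (int j)" by simp
      moreover have "\<not> int p dvd int j - int n"
      proof
        assume "int p dvd int j - int n"
        then have "int p dvd int (n - j)" using j by (metis dvd_minus_iff minus_diff_eq of_nat_diff less_imp_le)
        then have "p \<le> n - j" using j by (simp only: int_dvd_int_iff) (auto dest: dvd_imp_le)
        then show False using Suc.prems(1) by simp
      qed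
      ultimately show ?thesis using p by (meson prime_dvd_multD prime_nat_int_transfer)
    qed
  qed (use Suc.prems in auto)
  then obtain h where h: "g = Polynomial.smult (int p) h" by blast
  obtain k where k: "poly f (int n) = int p * k" using Suc.prems(3)[of n] by auto
  have "f = Polynomial.smult (int p) ([:- int n, 1:] * h + [:k:])"
    by (subst fg) (simp add: h k smult_add_right)
  then show ?case by blast
qed

lemma int_fermat: "prime p \<Longrightarrow> int p dvd t ^ p - t"
proof -
  assume p: "prime p"
  define n where "n = nat (t mod int p)"
  have n: "int n = t mod int p" using p prime_gt_0_nat by (simp add: n_def)
  have "[n ^ p = n] (mod p)"
  proof (cases "p dvd n")
    case True
    then have "p dvd n ^ p" using p prime_gt_0_nat by (simp add: dvd_power_same dvd_trans dvd_power)
    then show ?thesis using True by (simp add: cong_def mod_eq_0_iff_dvd)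
  next
    case False
    then have "[n ^ (p - 1) * n = 1 * n] (mod p)" using p by (intro cong_mult cong_refl fermat_theorem)
    moreover have "n ^ (p - 1) * n = n ^ p" using prime_gt_0_nat[OF p] by (rule power_minus_mult)
    ultimately show ?thesis by simp
  qed
  then have "[int n ^ p = int n] (mod int p)" by (metis cong_int_iff of_nat_power)
  then have "[(t mod int p) ^ p = t mod int p] (mod int p)" by (simp only: n)
  then have "[t ^ p = t] (mod int p)" by (simp add: cong_def power_mod)
  then show ?thesis by (simp add: cong_iff_dvd_diff)
qed

text \<open>The leading terms cancel, and the difference vanishes modulo p at every residue by
  Fermat. An identity of polynomials is required, as it will be evaluated at algebraic
  integers.\<close>

lemma rising_product_mod_prime:
  assumes p: "prime p"
  shows "\<exists>g :: int poly. (\<Prod>k<p. [:int k, 1:]) = Polynomial.monom 1 p - Polynomial.monom 1 1 + Polynomial.smult (int p) g"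
proof -
  define f where "f = (\<Prod>k<p. [:int k, 1:]) - (Polynomial.monom 1 p - Polynomial.monom 1 1)"
  have p2: "p \<ge> 2" using p prime_ge_2_nat by blast
  have deg: "degree (\<Prod>k<p. [:int k, 1:]) = p" by (subst degree_prod_eq_sum_degree) auto
  have "lead_coeff (\<Prod>k<p. [:int k, 1:]) = 1" by (simp add: lead_coeff_prod)
  then have lc: "Polynomial.coeff (\<Prod>k<p. [:int k, 1:]) p = 1" by (simp add: deg)
  have "\<exists>g. f = Polynomial.smult (int p) g"
  proof (rule prime_dvd_coeffs_if_dvd_values[OF p order_refl])
    show "Polynomial.coeff f i = 0" if "i \<ge> p" for i
    proof (cases "i = p")
      case True then show ?thesis using lc p2 by (simp add: f_def)
    next
      case False
      then have "i > p" using that by simp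
      then have "Polynomial.coeff (\<Prod>k<p. [:int k, 1:]) i = 0" using deg by (intro coeff_eq_0) simp
      then show ?thesis using \<open>i > p\<close> p2 by (simp add: f_def)
    qed
    show "int p dvd poly f (int j)" if "j < p" for j
    proof -
      have "int p dvd (\<Prod>k<p. int j + int k)"
      proof (cases "j = 0")
        case True
        have "(\<Prod>k<p. int j + int k) = 0" using True p2 by (intro prod_zero) (auto intro!: bexI[of _ 0])
        then show ?thesis by (simp only: dvd_0_right)
      next
        case False
        \<comment> \<open>The factor with k = p - j is p itself.\<close>
        have "int j + int (p - j) dvd (\<Prod>k<p. int j + int k)"
          using False p2 by (intro dvd_prodI[of "{..<p}" "p - j" "\<lambda>k. int j + int k"]) auto
        then show ?thesis using that by simp
      qed
      moreover have "poly f (int j) = (\<Prod>k<p. int j + int k) - (int j ^ p - int j)"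
        by (simp add: f_def poly_prod poly_monom add.commute)
      ultimately show ?thesis using int_fermat[OF p, of "int j"] by (simp add: dvd_diff)
    qed
  qed
  then show ?thesis unfolding f_def by (metis add.commute diff_eq_eq)
qed

lemma poly_map_of_int: "poly (map_poly of_int P) (of_int k) = (of_int (poly P k) :: 'a :: comm_ring_1)"
  by (induction P) (auto simp: map_poly_pCons)

section \<open>Conjugate tuples in the ring of a primitive q-th root of unity\<close>

locale prime_cyclotomic =
  fixes q :: nat
  assumes q: "prime q"
begin

definition z :: complex where "z = cis (2 * pi / real q)"

lemma q_pos: "q > 0" "q > 1" using q prime_gt_0_nat prime_gt_1_nat by blast+

lemma z_pow: "z ^ k = cis (2 * pi * real k / real q)"
  by (simp add: z_def Complex.DeMoivre mult_ac)

lemma z_q: "z ^ q = 1"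
  using q_pos by (simp add: z_pow)

lemma z_mod: "z ^ (k mod q) = z ^ k"
proof -
  have "z ^ k = z ^ (q * (k div q) + k mod q)" by simp
  also have "\<dots> = z ^ (k mod q)" by (simp only: power_add power_mult z_q power_one mult_1)
  finally show ?thesis by simp
qed

lemma z_inj: "z ^ i = z ^ j \<Longrightarrow> [i = j] (mod q)"
proof -
  assume "z ^ i = z ^ j"
  then have "z ^ (i mod q) = z ^ (j mod q)" by (simp add: z_mod)
  moreover have "inj_on (\<lambda>k. z ^ k) {..<q}"
    using Complex.bij_betw_roots_unity[OF q_pos(1)] by (simp add: z_pow bij_betw_def)
  ultimately show ?thesis using q_pos by (simp add: inj_on_def cong_def)
qed

text \<open>The trace of z^i is q - 1 or -1, according to whether z^i = 1.\<close>

lemma z_sum: "(\<Sum>a\<in>{1..<q}. (z ^ a) ^ i) \<in> \<int>"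
proof -
  have eq: "(z ^ a) ^ i = (z ^ i) ^ a" for a by (simp add: power_mult[symmetric] mult.commute)
  have "(\<Sum>a<q. (z ^ i) ^ a) \<in> \<int>"
  proof (cases "z ^ i = 1")
    case False
    have "(z ^ i) ^ q = 1" using z_q by (metis mult.commute power_mult power_one)
    then show ?thesis using False by (simp add: geometric_sum)
  qed auto
  moreover have "(\<Sum>a<q. (z ^ i) ^ a) = 1 + (\<Sum>a\<in>{1..<q}. (z ^ i) ^ a)"
    using q_pos sum.atLeast_Suc_lessThan[of 0 q "\<lambda>a. (z ^ i) ^ a"] by (simp add: lessThan_atLeast0)
  ultimately show ?thesis unfolding eq by (metis Ints_1 Ints_diff add_diff_cancel_left')
qed

text \<open>An element $F(z)$ of the ring generated by a primitive $q$-th root of unity $z$, together with its conjugates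
  $F(z^a)$. Keeping the whole tuple avoids Galois theory: a constant tuple is rational because its sum over $a$ is an integer,
  and integral because the same holds for all its powers.\<close>

definition cyc :: "(nat \<Rightarrow> complex) \<Rightarrow> bool" where
  "cyc \<phi> \<longleftrightarrow> (\<exists>F :: complex poly. (\<forall>i. Polynomial.coeff F i \<in> \<int>) \<and> (\<forall>a\<in>{1..<q}. \<phi> a = poly F (z ^ a)))"

lemma cyc_of_int: "cyc (\<lambda>_. of_int k)"
  unfolding cyc_def by (intro exI[of _ "[:of_int k:]"]) (auto simp: coeff_pCons split: nat.splits)

lemma cyc_add: "cyc \<phi> \<Longrightarrow> cyc \<psi> \<Longrightarrow> cyc (\<lambda>a. \<phi> a + \<psi> a)"
  unfolding cyc_def
proof (elim exE conjE)
  fix F G assume "\<forall>i. Polynomial.coeff F i \<in> \<int>" "\<forall>i. Polynomial.coeff G i \<in> \<int>" "\<forall>a\<in>{1..<q}. \<phi> a = poly F (z ^ a)" "\<forall>a\<in>{1..<q}. \<psi> a = poly G (z ^ a)"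
  then show "\<exists>F. (\<forall>i. Polynomial.coeff F i \<in> \<int>) \<and> (\<forall>a\<in>{1..<q}. \<phi> a + \<psi> a = poly F (z ^ a))"
    by (intro exI[of _ "F + G"]) auto
qed

lemma cyc_mult: "cyc \<phi> \<Longrightarrow> cyc \<psi> \<Longrightarrow> cyc (\<lambda>a. \<phi> a * \<psi> a)"
  unfolding cyc_def
proof (elim exE conjE)
  fix F G assume "\<forall>i. Polynomial.coeff F i \<in> \<int>" "\<forall>i. Polynomial.coeff G i \<in> \<int>" "\<forall>a\<in>{1..<q}. \<phi> a = poly F (z ^ a)" "\<forall>a\<in>{1..<q}. \<psi> a = poly G (z ^ a)"
  then show "\<exists>F. (\<forall>i. Polynomial.coeff F i \<in> \<int>) \<and> (\<forall>a\<in>{1..<q}. \<phi> a * \<psi> a = poly F (z ^ a))"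
    by (intro exI[of _ "F * G"]) (auto simp: coeff_mult intro!: Ints_sum Ints_mult)
qed

lemma cyc_cong: "(\<And>a. a \<in> {1..<q} \<Longrightarrow> \<phi> a = \<psi> a) \<Longrightarrow> cyc \<phi> \<longleftrightarrow> cyc \<psi>"
  unfolding cyc_def by auto

lemma cyc_1: "cyc (\<lambda>_. 1)" using cyc_of_int[of 1] by simp
lemma cyc_0: "cyc (\<lambda>_. 0)" using cyc_of_int[of 0] by simp
lemma cyc_of_nat: "cyc (\<lambda>_. of_nat k)" using cyc_of_int[of "int k"] by simp

lemma cyc_minus: "cyc \<phi> \<Longrightarrow> cyc (\<lambda>a. - \<phi> a)"
  using cyc_mult[OF cyc_of_int[of "-1"]] by simp

lemma cyc_diff: "cyc \<phi> \<Longrightarrow> cyc \<psi> \<Longrightarrow> cyc (\<lambda>a. \<phi> a - \<psi> a)"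
  using cyc_add[OF _ cyc_minus] by simp

lemma cyc_power: "cyc \<phi> \<Longrightarrow> cyc (\<lambda>a. \<phi> a ^ n)"
  by (induction n) (auto intro: cyc_1 cyc_mult)

lemma cyc_sum: "(\<And>i. i \<in> I \<Longrightarrow> cyc (\<phi> i)) \<Longrightarrow> cyc (\<lambda>a. \<Sum>i\<in>I. \<phi> i a)"
  by (induction I rule: infinite_finite_induct) (auto intro: cyc_0 cyc_add)

lemma cyc_prod: "(\<And>i. i \<in> I \<Longrightarrow> cyc (\<phi> i)) \<Longrightarrow> cyc (\<lambda>a. \<Prod>i\<in>I. \<phi> i a)"
  by (induction I rule: infinite_finite_induct) (auto intro: cyc_1 cyc_mult)

lemma cyc_root: "cyc (\<lambda>a. z ^ (a * k))"
  unfolding cyc_def by (intro exI[of _ "Polynomial.monom 1 k"]) (auto simp: poly_monom power_mult[symmetric])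

lemma cyc_int_poly: "cyc \<phi> \<Longrightarrow> cyc (\<lambda>a. poly (map_poly of_int (g :: int poly)) (\<phi> a))"
  unfolding poly_altdef by (intro cyc_sum cyc_mult cyc_power) (auto simp: coeff_map_poly intro: cyc_of_int)

lemma cyc_const_Ints:
  assumes "cyc (\<lambda>_. c)"
  shows "c \<in> \<int>"
proof -
  have tr: "of_nat (q - 1) * d \<in> \<int>" if "cyc (\<lambda>_. d)" for d
  proof -
    from that obtain F :: "complex poly" where F: "\<And>i. Polynomial.coeff F i \<in> \<int>" "\<And>a. a \<in> {1..<q} \<Longrightarrow> d = poly F (z ^ a)"
      unfolding cyc_def by blast
    have "of_nat (q - 1) * d = (\<Sum>a\<in>{1..<q}. d)" by simp
    also have "\<dots> = (\<Sum>a\<in>{1..<q}. poly F (z ^ a))" by (rule sum.cong[OF refl F(2)])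
    also have "\<dots> = (\<Sum>i\<le>degree F. Polynomial.coeff F i * (\<Sum>a\<in>{1..<q}. (z ^ a) ^ i))"
      unfolding poly_altdef sum_distrib_left by (rule sum.swap)
    also have "\<dots> \<in> \<int>" by (intro Ints_sum Ints_mult F z_sum)
    finally show ?thesis .
  qed
  have q1: "of_nat (q - 1) \<noteq> (0::complex)" using q_pos by simp
  have "c = of_nat (q - 1) * c / of_nat (q - 1)" using q1 by simp
  moreover have "of_nat (q - 1) * c \<in> \<rat>" using tr[OF assms] Ints_subset_Rats by blast
  ultimately have "c \<in> \<rat>" by (metis Rats_divide Rats_of_nat)
  then obtain u v :: int where uv: "v > 0" "coprime u v" "c = of_int u / of_int v" by (rule Rats_cases')
  \<comment> \<open>Every power of the tuple has an integral trace, so all powers of the denominator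
    v divide q - 1. At n = q this is impossible for v \<ge> 2, because 2^q > q.\<close>
  have dv: "v ^ n dvd int (q - 1)" for n
  proof -
    have "of_nat (q - 1) * c ^ n \<in> \<int>" by (rule tr[OF cyc_power[OF assms]])
    then obtain k where "of_nat (q - 1) * c ^ n = of_int k" by (auto elim: Ints_cases)
    then have "of_int (int (q - 1) * u ^ n) = (of_int (k * v ^ n) :: complex)" using uv by (simp add: power_divide field_simps)
    then have "int (q - 1) * u ^ n = k * v ^ n" by (simp only: of_int_eq_iff)
    then have "v ^ n dvd int (q - 1) * u ^ n" by simp
    moreover have "coprime (v ^ n) (u ^ n)" using uv(2) by (simp add: coprime_commute)
    ultimately show ?thesis by (simp add: coprime_dvd_mult_left_iff)
  qed
  have "v = 1"
  proof (rule ccontr)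
    assume "v \<noteq> 1"
    then have "v \<ge> 2" using uv by simp
    then have "2 ^ q \<le> v ^ q" by (intro power_mono) auto
    moreover have "v ^ q \<le> int (q - 1)" using q_pos by (intro zdvd_imp_le dv) auto
    moreover have "int q < 2 ^ q" using of_nat_less_two_power[of q] by simp
    ultimately show False by linarith
  qed
  then show ?thesis using uv by simp
qed

text \<open>Congruence modulo p in the cyclotomic ring, witnessed by one ring element whose
  conjugates work at all a simultaneously.\<close>

definition cyc_congr :: "nat \<Rightarrow> (nat \<Rightarrow> complex) \<Rightarrow> (nat \<Rightarrow> complex) \<Rightarrow> bool" where
  "cyc_congr p \<phi> \<psi> \<longleftrightarrow> (\<exists>\<chi>'. cyc \<chi>' \<and> (\<forall>a\<in>{1..<q}. \<phi> a = \<psi> a + of_nat p * \<chi>' a))"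

lemma cyc_congr_refl: "(\<And>a. a \<in> {1..<q} \<Longrightarrow> \<phi> a = \<psi> a) \<Longrightarrow> cyc_congr p \<phi> \<psi>"
  unfolding cyc_congr_def by (intro exI[of _ "\<lambda>_. 0"]) (auto intro: cyc_0)

lemma cyc_congr_trans: "cyc_congr p \<phi> \<psi> \<Longrightarrow> cyc_congr p \<psi> \<tau> \<Longrightarrow> cyc_congr p \<phi> \<tau>"
  unfolding cyc_congr_def
proof (elim exE conjE)
  fix f g assume "cyc f" "cyc g" "\<forall>a\<in>{1..<q}. \<phi> a = \<psi> a + of_nat p * f a" "\<forall>a\<in>{1..<q}. \<psi> a = \<tau> a + of_nat p * g a"
  then show "\<exists>\<chi>'. cyc \<chi>' \<and> (\<forall>a\<in>{1..<q}. \<phi> a = \<tau> a + of_nat p * \<chi>' a)"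
    by (intro exI[of _ "\<lambda>a. f a + g a"]) (auto intro: cyc_add simp: algebra_simps)
qed

lemma cyc_congr_add: "cyc_congr p \<phi> \<psi> \<Longrightarrow> cyc_congr p \<phi>' \<psi>' \<Longrightarrow> cyc_congr p (\<lambda>a. \<phi> a + \<phi>' a) (\<lambda>a. \<psi> a + \<psi>' a)"
  unfolding cyc_congr_def
proof (elim exE conjE)
  fix f g assume "cyc f" "cyc g" "\<forall>a\<in>{1..<q}. \<phi> a = \<psi> a + of_nat p * f a" "\<forall>a\<in>{1..<q}. \<phi>' a = \<psi>' a + of_nat p * g a"
  then show "\<exists>\<chi>'. cyc \<chi>' \<and> (\<forall>a\<in>{1..<q}. \<phi> a + \<phi>' a = \<psi> a + \<psi>' a + of_nat p * \<chi>' a)"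
    by (intro exI[of _ "\<lambda>a. f a + g a"]) (auto intro: cyc_add simp: algebra_simps)
qed

lemma cyc_congr_mult: "cyc_congr p \<phi> \<psi> \<Longrightarrow> cyc_congr p \<phi>' \<psi>' \<Longrightarrow> cyc \<psi> \<Longrightarrow> cyc \<psi>' \<Longrightarrow> cyc_congr p (\<lambda>a. \<phi> a * \<phi>' a) (\<lambda>a. \<psi> a * \<psi>' a)"
  unfolding cyc_congr_def
proof (elim exE conjE)
  fix f g assume "cyc \<psi>" "cyc \<psi>'" "cyc f" "cyc g" "\<forall>a\<in>{1..<q}. \<phi> a = \<psi> a + of_nat p * f a" "\<forall>a\<in>{1..<q}. \<phi>' a = \<psi>' a + of_nat p * g a"
  then show "\<exists>\<chi>'. cyc \<chi>' \<and> (\<forall>a\<in>{1..<q}. \<phi> a * \<phi>' a = \<psi> a * \<psi>' a + of_nat p * \<chi>' a)"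
    by (intro exI[of _ "\<lambda>a. \<psi> a * g a + f a * \<psi>' a + of_nat p * (f a * g a)"])
       (auto intro!: cyc_add cyc_mult cyc_of_nat simp: algebra_simps)
qed

lemma cyc_congr_prod:
  "(\<And>i. i \<in> I \<Longrightarrow> cyc_congr p (\<phi> i) (\<psi> i)) \<Longrightarrow> (\<And>i. i \<in> I \<Longrightarrow> cyc (\<psi> i)) \<Longrightarrow>
     cyc_congr p (\<lambda>a. \<Prod>i\<in>I. \<phi> i a) (\<lambda>a. \<Prod>i\<in>I. \<psi> i a)"
proof (induction I rule: infinite_finite_induct)
  case (insert x F)
  have "cyc_congr p (\<lambda>a. \<phi> x a * (\<Prod>i\<in>F. \<phi> i a)) (\<lambda>a. \<psi> x a * (\<Prod>i\<in>F. \<psi> i a))"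
    using insert by (intro cyc_congr_mult cyc_prod) auto
  then show ?case using insert.hyps by simp
qed (auto intro: cyc_congr_refl)

text \<open>The inner binomial coefficients are multiples of p, so the remainder divided by p is
  again an element of the ring.\<close>

lemma cyc_congr_frobenius:
  assumes p: "prime p" and c: "cyc \<phi>" "cyc \<psi>"
  shows "cyc_congr p (\<lambda>a. (\<phi> a + \<psi> a) ^ p) (\<lambda>a. \<phi> a ^ p + \<psi> a ^ p)"
  unfolding cyc_congr_def
proof (intro exI conjI ballI)
  show "cyc (\<lambda>a. \<Sum>k\<in>{1..<p}. of_nat ((p choose k) div p) * \<phi> a ^ k * \<psi> a ^ (p - k))"
    by (intro cyc_sum cyc_mult cyc_power c cyc_of_nat)
  fix a
  have p0: "p > 0" using p prime_gt_0_nat by blast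
  have "(\<phi> a + \<psi> a) ^ p = (\<Sum>k\<le>p. of_nat (p choose k) * \<phi> a ^ k * \<psi> a ^ (p - k))" by (rule binomial_ring)
  also have "{..p} = insert 0 (insert p {1..<p})" using p0 by auto
  also have "(\<Sum>k\<in>\<dots>. of_nat (p choose k) * \<phi> a ^ k * \<psi> a ^ (p - k)) = \<psi> a ^ p + (\<phi> a ^ p + (\<Sum>k\<in>{1..<p}. of_nat (p choose k) * \<phi> a ^ k * \<psi> a ^ (p - k)))"
    using p0 by simp
  also have "(\<Sum>k\<in>{1..<p}. of_nat (p choose k) * \<phi> a ^ k * \<psi> a ^ (p - k)) = (\<Sum>k\<in>{1..<p}. of_nat p * (of_nat ((p choose k) div p) * \<phi> a ^ k * \<psi> a ^ (p - k)))"
  proof (rule sum.cong)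
    fix k assume k: "k \<in> {1..<p}"
    have "p choose k = p * ((p choose k) div p)" using k p p0 dvd_choose_prime[of k p] by simp
    then have "of_nat (p choose k) = (of_nat p * of_nat ((p choose k) div p) :: complex)" by (metis of_nat_mult)
    then show "of_nat (p choose k) * \<phi> a ^ k * \<psi> a ^ (p - k) = of_nat p * (of_nat ((p choose k) div p) * \<phi> a ^ k * \<psi> a ^ (p - k))"
      by (simp only: mult.assoc)
  qed simp
  finally show "(\<phi> a + \<psi> a) ^ p = \<phi> a ^ p + \<psi> a ^ p + of_nat p * (\<Sum>k\<in>{1..<p}. of_nat ((p choose k) div p) * \<phi> a ^ k * \<psi> a ^ (p - k))"
    by (simp add: sum_distrib_left)
qed

lemma cyc_congr_fermat:
  assumes "prime p"
  shows "cyc_congr p (\<lambda>_. of_int t ^ p) (\<lambda>_. of_int t)"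
proof -
  obtain k where k: "t ^ p - t = int p * k" using int_fermat[OF assms] by (auto simp: dvd_def)
  have "(of_int t ^ p :: complex) = of_int (t + int p * k)" using k by (metis of_int_power add_diff_cancel_left' diff_add_cancel add.commute)
  then show ?thesis unfolding cyc_congr_def by (intro exI[of _ "\<lambda>_. of_int k"]) (auto intro: cyc_of_int)
qed

lemma cyc_congr_frobenius_int:
  assumes p: "prime p" and c: "cyc \<phi>" and f: "cyc_congr p (\<lambda>a. \<phi> a ^ p) \<psi>"
  shows "cyc_congr p (\<lambda>a. (of_int t + \<phi> a) ^ p) (\<lambda>a. of_int t + \<psi> a)"
  by (rule cyc_congr_trans[OF cyc_congr_frobenius[OF p cyc_of_int c] cyc_congr_add[OF cyc_congr_fermat[OF p] f]])

text \<open>The way back to the integers: m/p is a constant tuple of the ring, hence an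
  integer.\<close>

lemma dvd_if_cyc_congr_0:
  assumes "p > 0" and "cyc_congr p (\<lambda>_. of_int m) (\<lambda>_. 0)"
  shows "int p dvd m"
proof -
  obtain f where f: "cyc f" "\<And>a. a \<in> {1..<q} \<Longrightarrow> of_int m = of_nat p * f a" using assms(2) by (auto simp: cyc_congr_def)
  have "f a = of_int m / of_nat p" if "a \<in> {1..<q}" for a using f(2)[OF that] assms(1) by simp
  then have "cyc (\<lambda>_. of_int m / of_nat p)" using f(1) cyc_cong[of f "\<lambda>_. of_int m / of_nat p"] by simp
  then have "of_int m / of_nat p \<in> (\<int> :: complex set)" by (rule cyc_const_Ints)
  then obtain k where "of_int m / of_nat p = (of_int k :: complex)" by (auto elim: Ints_cases)
  then have "of_int m = (of_int (int p * k) :: complex)" using assms(1) by (simp add: field_simps)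
  then have "m = int p * k" by (simp only: of_int_eq_iff)
  then show ?thesis by simp
qed

end

lemma bij_mult_mod_prime:
  fixes q :: nat
  assumes q: "prime q" and a: "coprime a q"
  shows "bij_betw (\<lambda>c. a * c mod q) {1..<q} {1..<q}"
proof -
  have inj: "inj_on (\<lambda>c. a * c mod q) {1..<q}"
  proof (rule inj_onI)
    fix x y assume xy: "x \<in> {1..<q}" "y \<in> {1..<q}" "a * x mod q = a * y mod q"
    then have "[a * x = a * y] (mod q)" by (simp add: cong_def)
    then have "[x = y] (mod q)" using a by (simp add: cong_mult_lcancel_nat)
    then show "x = y" using xy by (simp add: cong_def)
  qed
  have "(\<lambda>c. a * c mod q) ` {1..<q} \<subseteq> {1..<q}"
  proof
    fix y assume "y \<in> (\<lambda>c. a * c mod q) ` {1..<q}"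
    then obtain c where c: "1 \<le> c" "c < q" "y = a * c mod q" by auto
    have "\<not> q dvd c" using c by (auto dest: dvd_imp_le)
    moreover have "\<not> q dvd a" using a q by (metis coprime_absorb_right not_prime_unit coprime_commute)
    ultimately have "\<not> q dvd a * c" using q by (simp add: prime_dvd_mult_iff)
    then show "y \<in> {1..<q}" using prime_gt_0_nat[OF q] by (auto simp: c(3) mod_greater_zero_iff_not_dvd Suc_le_eq)
  qed
  then have "(\<lambda>c. a * c mod q) ` {1..<q} = {1..<q}" using inj by (intro endo_inj_surj) auto
  then show ?thesis using inj by (simp add: bij_betw_def)
qed

section \<open>Products over cosets of the kernel of a character\<close>

locale prime_char = prime_cyclotomic q + dchar q \<xi> for q :: nat and \<xi> :: "nat \<Rightarrow> complex"
begin

lemma coprime_residue: "a \<in> {1..<q} \<Longrightarrow> coprime a q"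
  using q by (metis atLeastLessThan_iff coprime_commute dvd_imp_le less_le_trans not_less prime_imp_coprime_nat zero_less_one)

definition H where "H = {h \<in> {1..<q}. \<xi> h = 1}"

text \<open>Unlike for the Gaussian periods $\sum_{h \in H} z^{c h}$, it is immediate that these products separate the cosets of $H$
  for all but finitely many $t$.\<close>

definition \<theta> :: "int \<Rightarrow> nat \<Rightarrow> complex" where "\<theta> t c = (\<Prod>h\<in>H. of_int t + z ^ (c * h))"

lemma finite_H: "finite H" by (simp add: H_def)

lemma theta_mod: "\<theta> t (c mod q) = \<theta> t c"
proof -
  have "z ^ (c mod q * h) = z ^ (c * h)" for h by (metis mod_mult_left_eq z_mod)
  then show ?thesis by (simp add: \<theta>_def)
qed

text \<open>Multiplication by an element of the kernel permutes the residues in H and hence the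
  factors.\<close>

lemma theta_invariant:
  assumes "\<xi> p = 1"
  shows "\<theta> t (c * p) = \<theta> t c"
proof -
  have cp: "coprime p q" using assms not_coprime[of p] by auto
  have bij: "bij_betw (\<lambda>h. p * h mod q) H H"
  proof -
    have b: "bij_betw (\<lambda>c. p * c mod q) {1..<q} {1..<q}" by (rule bij_mult_mod_prime[OF q cp])
    have e: "\<xi> (p * h mod q) = \<xi> h" for h using assms by (simp add: xi_mod mult)
    have img: "(\<lambda>h. p * h mod q) ` H = H"
    proof
      show "(\<lambda>h. p * h mod q) ` H \<subseteq> H" using bij_betwE[OF b] e by (auto simp: H_def)
      show "H \<subseteq> (\<lambda>h. p * h mod q) ` H"
      proof
        fix h assume h: "h \<in> H"
        then have "h \<in> (\<lambda>c. p * c mod q) ` {1..<q}" unfolding bij_betw_imp_surj_on[OF b] H_def by simp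
        then obtain c where c: "c \<in> {1..<q}" "h = p * c mod q" by blast
        then have "c \<in> H" using h e[of c] by (simp add: H_def)
        then show "h \<in> (\<lambda>h. p * h mod q) ` H" using c by blast
      qed
    qed
    moreover have "inj_on (\<lambda>h. p * h mod q) H" using b by (auto simp: bij_betw_def H_def intro: inj_on_subset)
    ultimately show ?thesis by (simp add: bij_betw_def)
  qed
  have "\<theta> t c = (\<Prod>h\<in>H. of_int t + z ^ (c * (p * h mod q)))"
    unfolding \<theta>_def using prod.reindex_bij_betw[OF bij, of "\<lambda>h. of_int t + z ^ (c * h)"] by simp
  also have "\<dots> = \<theta> t (c * p)"
    unfolding \<theta>_def by (intro prod.cong refl) (metis mod_mult_right_eq z_mod mult.assoc)
  finally show ?thesis by simp
qed

lemma cyc_theta: "cyc (\<lambda>a. \<theta> t (a * c))"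
  unfolding \<theta>_def mult.assoc by (intro cyc_prod cyc_add cyc_of_int cyc_root)

text \<open>Frobenius acts factor by factor: t is fixed modulo p by Fermat, and the p-th power of
  z^(c h) is z^(c p h).\<close>

lemma theta_frobenius:
  assumes p: "prime p"
  shows "cyc_congr p (\<lambda>a. \<theta> t (a * c) ^ p) (\<lambda>a. \<theta> t (a * (c * p)))"
proof -
  have "cyc_congr p (\<lambda>a. \<Prod>h\<in>H. (of_int t + z ^ (a * (c * h))) ^ p) (\<lambda>a. \<Prod>h\<in>H. of_int t + z ^ (a * (c * p * h)))"
  proof (rule cyc_congr_prod)
    fix h assume "h \<in> H"
    show "cyc_congr p (\<lambda>a. (of_int t + z ^ (a * (c * h))) ^ p) (\<lambda>a. of_int t + z ^ (a * (c * p * h)))"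
      by (rule cyc_congr_frobenius_int[OF p cyc_root]) (rule cyc_congr_refl, simp add: power_mult[symmetric] mult_ac)
    show "cyc (\<lambda>a. of_int t + z ^ (a * (c * p * h)))" by (intro cyc_add cyc_of_int cyc_root)
  qed
  then show ?thesis by (simp add: \<theta>_def prod_power_distrib mult.assoc)
qed

lemma theta_prod_shift:
  assumes a: "a \<in> {1..<q}"
  shows "(\<Prod>c\<in>{1..<q}. F (\<theta> t (a * c))) = (\<Prod>c\<in>{1..<q}. F (\<theta> t c))"
proof -
  have "(\<Prod>c\<in>{1..<q}. F (\<theta> t (a * c))) = (\<Prod>c\<in>{1..<q}. F (\<theta> t (a * c mod q)))" by (simp add: theta_mod)
  also have "\<dots> = (\<Prod>c\<in>{1..<q}. F (\<theta> t c))"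
    by (rule prod.reindex_bij_betw[OF bij_mult_mod_prime[OF q coprime_residue[OF a]]])
  finally show ?thesis .
qed

text \<open>Coefficients of every partial product lie in the ring. For the full index set
  conjugation merely permutes the factors, so the coefficients are constant tuples and hence
  integers.\<close>

lemma period_poly_exists:
  "\<exists>P :: int poly. map_poly of_int P = (\<Prod>c\<in>{1..<q}. [:\<theta> t c, 1:])"
proof -
  define f where "f X a = (\<Prod>c\<in>X. [:\<theta> t (a * c), 1:])" for X a
  have cf: "cyc (\<lambda>a. Polynomial.coeff (f X a) i)" if "finite X" for X i
    using that
  proof (induction X arbitrary: i rule: finite_induct)
    case empty
    have "(\<lambda>a. Polynomial.coeff (f {} a) i) = (\<lambda>_. of_int (if i = 0 then 1 else 0))"
      by (auto simp: f_def fun_eq_iff coeff_1)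
    then show ?case using cyc_of_int by simp
  next
    case (insert x X)
    have "Polynomial.coeff (f (insert x X) a) i = \<theta> t (a * x) * Polynomial.coeff (f X a) i + (case i of 0 \<Rightarrow> 0 | Suc j \<Rightarrow> Polynomial.coeff (f X a) j)" for a
    proof -
      have "f (insert x X) a = [:\<theta> t (a * x), 1:] * f X a" using insert.hyps by (simp add: f_def)
      then show ?thesis by (cases i) simp_all
    qed
    moreover have "cyc (\<lambda>a. \<theta> t (a * x) * Polynomial.coeff (f X a) i + (case i of 0 \<Rightarrow> 0 | Suc j \<Rightarrow> Polynomial.coeff (f X a) j))"
      using insert.IH by (cases i) (auto intro!: cyc_add cyc_mult cyc_theta cyc_0)
    ultimately show ?case by simp
  qed
  have fe: "f {1..<q} a = f {1..<q} 1" if "a \<in> {1..<q}" for a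
    unfolding f_def using theta_prod_shift[OF that, of "\<lambda>x. [:x, 1:]" t] by simp
  have "cyc (\<lambda>_. Polynomial.coeff (f {1..<q} 1) i)" for i
    by (rule cyc_cong[THEN iffD1, OF _ cf[of "{1..<q}" i]]) (simp_all only: fe finite_atLeastLessThan)
  then have ci: "Polynomial.coeff (f {1..<q} 1) i \<in> \<int>" for i by (rule cyc_const_Ints)
  show ?thesis
  proof (rule intpolyE[of "f {1..<q} 1"])
    fix P assume "f {1..<q} 1 = map_poly of_int P"
    then show ?thesis by (intro exI[of _ P]) (simp add: f_def)
  qed (rule ci)
qed

text \<open>Pairs from different cosets of the kernel. They are ordered, so conjugation permutes the
  factors of the discriminant without introducing a sign.\<close>

definition N where "N = {(c, c') \<in> {1..<q} \<times> {1..<q}. \<xi> c \<noteq> \<xi> c'}"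

text \<open>A discriminant: only its prime divisors can be exceptional.\<close>

definition \<Delta> where "\<Delta> t a = (\<Prod>(c, c')\<in>N. \<theta> t (a * c) - \<theta> t (a * c'))"

lemma finite_N: "finite N" unfolding N_def by (rule finite_subset[of _ "{1..<q} \<times> {1..<q}"]) auto

text \<open>As polynomials in t, the products for two different cosets have different roots, so they
  agree at finitely many t only; any integer outside these finitely many exceptions separates all
  pairs.\<close>

lemma exists_separating: "\<exists>t. \<Delta> t 1 \<noteq> 0"
proof -
  define f where "f c = (\<Prod>h\<in>H. [:z ^ (c * h), 1:])" for c
  have th: "poly (f c) (of_int t) = \<theta> t c" for t c by (simp add: f_def \<theta>_def poly_prod add.commute)
  define B where "B = (\<Union>(c, c')\<in>N. {t :: int. poly (f c - f c') (of_int t) = 0})"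
  have "finite B"
    unfolding B_def
  proof (intro finite_UN_I finite_N)
    fix x assume "x \<in> N"
    then obtain c c' where x: "x = (c, c')" "c \<in> {1..<q}" "c' \<in> {1..<q}" "\<xi> c \<noteq> \<xi> c'" by (auto simp: N_def)
    have "f c - f c' \<noteq> 0"
    proof
      assume "f c - f c' = 0"
      then have eq: "f c = f c'" by simp
      \<comment> \<open>Hence -z^c is a root of \<open>f c\<close>; it is a root of
        \<open>f c'\<close> only if c is congruent to c' h with h in the kernel.\<close>
      have "1 \<in> H" using q_pos one by (simp add: H_def)
      then have "poly (f c) (- (z ^ c)) = 0" using finite_H by (auto simp: f_def poly_prod intro!: prod_zero bexI[of _ 1])
      then have "poly (f c') (- (z ^ c)) = 0" by (simp add: eq)
      then obtain h where h: "h \<in> H" "z ^ (c' * h) = z ^ c" using finite_H by (auto simp: f_def poly_prod)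
      have "\<xi> (c' * h) = \<xi> c" by (rule cong_imp_eq[OF z_inj[OF h(2)]])
      then show False using h(1) x(4) by (simp add: mult H_def)
    qed
    then have "finite {x. poly (f c - f c') x = 0}" by (rule poly_roots_finite)
    then have "finite ((of_int :: int \<Rightarrow> complex) -` {x. poly (f c - f c') x = 0})" by (rule finite_vimageI) (simp add: inj_on_def)
    then show "finite (case x of (c, c') \<Rightarrow> {t :: int. poly (f c - f c') (of_int t) = 0})"
      unfolding x by (simp add: vimage_def)
  qed
  then obtain t where "t \<notin> B" using ex_new_if_finite[of B] infinite_UNIV_int by blast
  then have "\<Delta> t 1 \<noteq> 0" unfolding \<Delta>_def using finite_N by (auto simp: B_def th)
  then show ?thesis by blast
qed

lemma Delta_shift:
  assumes a: "a \<in> {1..<q}"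
  shows "\<Delta> t a = \<Delta> t 1"
proof -
  let ?m = "\<lambda>c. a * c mod q"
  have b: "bij_betw ?m {1..<q} {1..<q}" by (rule bij_mult_mod_prime[OF q coprime_residue[OF a]])
  have xa: "\<xi> a \<noteq> 0" using norm_coprime[OF coprime_residue[OF a]] by auto
  have e: "\<xi> (?m c) = \<xi> (?m c') \<longleftrightarrow> \<xi> c = \<xi> c'" for c c' using xa by (simp add: xi_mod mult)
  have inj: "inj_on (map_prod ?m ?m) N"
    using b by (auto intro!: inj_onI simp: N_def bij_betw_def inj_on_def)
  have "map_prod ?m ?m ` N = N"
  proof
    show "map_prod ?m ?m ` N \<subseteq> N" using bij_betwE[OF b] e by (auto simp: N_def)
    show "N \<subseteq> map_prod ?m ?m ` N"
    proof
      fix x assume x: "x \<in> N"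
      then obtain u v where uv: "x = (u, v)" "u \<in> {1..<q}" "v \<in> {1..<q}" by (auto simp: N_def)
      then have "u \<in> ?m ` {1..<q}" "v \<in> ?m ` {1..<q}" unfolding bij_betw_imp_surj_on[OF b] by simp_all
      then obtain c c' where c: "x = (?m c, ?m c')" "c \<in> {1..<q}" "c' \<in> {1..<q}" using uv(1) by blast
      then have "(c, c') \<in> N" using x e[of c c'] by (simp add: N_def)
      then show "x \<in> map_prod ?m ?m ` N" using c by (auto intro!: image_eqI[of _ _ "(c, c')"])
    qed
  qed
  then have "bij_betw (map_prod ?m ?m) N N" using inj by (simp add: bij_betw_def)
  from prod.reindex_bij_betw[OF this, of "\<lambda>(c, c'). \<theta> t c - \<theta> t c'"]
  show ?thesis by (simp add: \<Delta>_def case_prod_unfold theta_mod)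
qed

lemma cyc_Delta: "cyc (\<Delta> t)"
  unfolding \<Delta>_def[abs_def] case_prod_unfold by (intro cyc_prod cyc_diff cyc_theta)

text \<open>The polynomial is $P(Y) = \prod_c (Y + \theta_c)$ over all $c$, a power of the minimal polynomial. By Frobenius,
  $\theta_c^p \equiv \theta_{cp}$ modulo $p$. If $\xi(p) = 1$ then $\prod_{k<p} (\theta_c + k) \equiv \theta_c^p - \theta_c \equiv 0$, so $p$
  divides $\prod_{k<p} P(k)$. Otherwise, for $A = k + \theta_c$, the difference $\theta_{cp} - \theta_c \equiv A^p - A$ is a multiple of $A$
  and a factor of $\Delta$; so if $p$ divides $P(k) = \prod A$, it divides a power of $\Delta$.\<close>

theorem residue_symbol_polynomial:
  "\<exists>P :: int poly. finite {p. prime p \<and> \<not> ((\<exists>k. int p dvd poly P k) \<longleftrightarrow> \<xi> p = 1)}"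
proof -
  obtain t where t: "\<Delta> t 1 \<noteq> 0" using exists_separating by blast
  obtain P :: "int poly" where P: "map_poly of_int P = (\<Prod>c\<in>{1..<q}. [:\<theta> t c, 1:])" using period_poly_exists by blast
  have Pk: "of_int (poly P k) = (\<Prod>c\<in>{1..<q}. of_int k + \<theta> t (a * c))" if "a \<in> {1..<q}" for a k
  proof -
    have "of_int (poly P k) = (\<Prod>c\<in>{1..<q}. of_int k + \<theta> t c)"
      using poly_map_of_int[of P k, where 'a = complex] unfolding P by (simp add: poly_prod add.commute)
    then show ?thesis using theta_prod_shift[OF that, of "\<lambda>x. of_int k + x" t] by simp
  qed
  have "cyc (\<lambda>_. \<Delta> t 1)" by (rule cyc_cong[THEN iffD1, OF _ cyc_Delta]) (rule Delta_shift)
  then have "\<Delta> t 1 \<in> \<int>" by (rule cyc_const_Ints)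
  then obtain D where D: "\<Delta> t 1 = of_int D" by (auto elim: Ints_cases)
  have D0: "D \<noteq> 0" using t D by auto
  have split: "\<exists>k. int p dvd poly P k" if p: "prime p" and "\<xi> p = 1" for p
  proof -
    from rising_product_mod_prime[OF p] obtain g :: "int poly" where
      g: "(\<Prod>k<p. [:int k, 1:]) = Polynomial.monom 1 p - Polynomial.monom 1 1 + Polynomial.smult (int p) g" by blast
    have id: "(\<Prod>k<p. of_int (int k) + x) = x ^ p + (- x) + of_nat p * poly (map_poly of_int g) x" for x :: complex
    proof -
      have "map_poly of_int (\<Prod>k<p. [:int k, 1:]) = (\<Prod>k<p. [:of_int (int k), 1:] :: complex poly)"
      proof -
        have step: "map_poly of_int ([:int n, 1:] * r) = [:of_int (int n), 1:] * (map_poly of_int r :: complex poly)" for r n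
        proof (rule poly_eqI)
          fix i
          show "Polynomial.coeff (map_poly of_int ([:int n, 1:] * r)) i = Polynomial.coeff ([:of_int (int n), 1:] * (map_poly of_int r :: complex poly)) i"
            by (cases i) (simp_all add: coeff_map_poly)
        qed
        have "map_poly of_int (\<Prod>k<n. [:int k, 1:]) = (\<Prod>k<n. [:of_int (int k), 1:] :: complex poly)" for n
        proof (induction n)
          case (Suc n)
          have "map_poly of_int (\<Prod>k<Suc n. [:int k, 1:]) = map_poly of_int ([:int n, 1:] * (\<Prod>k<n. [:int k, 1:]))"
            by (simp only: prod.lessThan_Suc mult.commute)
          also have "\<dots> = [:of_int (int n), 1:] * (\<Prod>k<n. [:of_int (int k), 1:] :: complex poly)" by (simp only: step Suc)
          finally show ?case by (simp only: prod.lessThan_Suc mult.commute)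
        qed simp
        then show ?thesis .
      qed
      moreover have "map_poly of_int (\<Prod>k<p. [:int k, 1:]) = Polynomial.monom 1 p - Polynomial.monom 1 1 + Polynomial.smult (of_nat p) (map_poly of_int g :: complex poly)"
        unfolding g by (simp add: poly_eq_iff coeff_map_poly)
      ultimately have "poly (\<Prod>k<p. [:of_int (int k), 1:]) x = poly (Polynomial.monom 1 p - Polynomial.monom 1 1 + Polynomial.smult (of_nat p) (map_poly of_int g)) x" by simp
      then show ?thesis by (simp add: poly_prod poly_monom)
    qed
    \<comment> \<open>Multiplying over k first gives the rising product at \<theta>, which is 0
      modulo p; multiplying over c first gives the integers P(k). Interchanging the two yields the
      divisibility.\<close>
    have "cyc_congr p (\<lambda>a. \<Prod>c\<in>{1..<q}. \<Prod>k<p. of_int (int k) + \<theta> t (a * c)) (\<lambda>a. \<Prod>c\<in>{1..<q}. 0)"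
    proof (rule cyc_congr_prod)
      fix c
      have c0: "cyc_congr p (\<lambda>a. \<theta> t (a * c) ^ p + (- \<theta> t (a * c))) (\<lambda>a. \<theta> t (a * c) + (- \<theta> t (a * c)))"
      proof (rule cyc_congr_add)
        have "\<theta> t (a * (c * p)) = \<theta> t (a * c)" for a using theta_invariant[OF that(2), of t "a * c"] by (simp add: mult.assoc)
        then show "cyc_congr p (\<lambda>a. \<theta> t (a * c) ^ p) (\<lambda>a. \<theta> t (a * c))" using theta_frobenius[OF p, of t c] by simp
      qed (rule cyc_congr_refl, simp)
      have "cyc_congr p (\<lambda>a. \<Prod>k<p. of_int (int k) + \<theta> t (a * c)) (\<lambda>a. \<theta> t (a * c) ^ p + (- \<theta> t (a * c)))"
        unfolding cyc_congr_def id by (intro exI[of _ "\<lambda>a. poly (map_poly of_int g) (\<theta> t (a * c))"]) (auto intro: cyc_int_poly cyc_theta)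
      from cyc_congr_trans[OF this c0] show "cyc_congr p (\<lambda>a. \<Prod>k<p. of_int (int k) + \<theta> t (a * c)) (\<lambda>_. 0)" by simp
    qed (rule cyc_0)
    moreover have "(\<Prod>c\<in>{1..<q}. \<Prod>k<p. of_int (int k) + \<theta> t (a * c)) = of_int (\<Prod>k<p. poly P (int k))" if "a \<in> {1..<q}" for a
      by (subst prod.swap) (simp only: Pk[OF that, symmetric] of_int_prod)
    moreover have "(\<Prod>c\<in>{1..<q}. 0) = (0 :: complex)" using q_pos by (intro prod_zero) (auto intro!: bexI[of _ 1])
    ultimately have "cyc_congr p (\<lambda>_. of_int (\<Prod>k<p. poly P (int k))) (\<lambda>_. 0)" unfolding cyc_congr_def by auto
    then have "int p dvd (\<Prod>k<p. poly P (int k))" using prime_gt_0_nat[OF p] by (intro dvd_if_cyc_congr_0)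
    then show ?thesis using p by (subst (asm) prime_dvd_prod_iff) auto
  qed
  have nonsplit: "int p dvd D" if p: "prime p" and "p \<noteq> q" "\<xi> p \<noteq> 1" and k: "int p dvd poly P k" for p k
  proof -
    have cp: "coprime p q" using p q \<open>p \<noteq> q\<close> by (simp add: primes_coprime)
    have pq: "p mod q \<in> {1..<q}"
      using cp q_pos q p \<open>p \<noteq> q\<close> by (auto simp: Suc_le_eq mod_greater_zero_iff_not_dvd primes_dvd_imp_eq)
    have fac: "\<exists>u. cyc u \<and> cyc_congr p (\<lambda>_. of_int D) (\<lambda>a. (of_int k + \<theta> t (a * c)) * u a)" if c: "c \<in> {1..<q}" for c
    proof -
      define c1 where "c1 = c * p mod q"
      have "c1 \<in> {1..<q}" using bij_betwE[OF bij_mult_mod_prime[OF q cp]] c by (auto simp: c1_def mult.commute)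
      moreover have "\<xi> c1 \<noteq> \<xi> c"
      proof -
        have "\<xi> c \<noteq> 0" using norm_coprime[OF coprime_residue[OF c]] by auto
        then show ?thesis using \<open>\<xi> p \<noteq> 1\<close> by (simp add: c1_def xi_mod mult)
      qed
      ultimately have inN: "(c1, c) \<in> N" using c by (simp add: N_def)
      \<comment> \<open>The cofactor of \<theta>_(cp) - \<theta>_c in the discriminant; the pair
        belongs to \<open>N\<close> because \<xi>(p) is not 1.\<close>
      define e where "e a = (\<Prod>(c, c')\<in>N - {(c1, c)}. \<theta> t (a * c) - \<theta> t (a * c'))" for a
      have ce: "cyc e" unfolding e_def[abs_def] case_prod_unfold by (intro cyc_prod cyc_diff cyc_theta)
      have th1: "\<theta> t (a * c1) = \<theta> t (a * (c * p))" for a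
        by (metis c1_def mod_mult_right_eq theta_mod)
      have De: "of_int D = (\<theta> t (a * (c * p)) - \<theta> t (a * c)) * e a" if "a \<in> {1..<q}" for a
      proof -
        have "\<Delta> t a = (\<theta> t (a * c1) - \<theta> t (a * c)) * e a"
          unfolding \<Delta>_def e_def using prod.remove[OF finite_N inN, of "\<lambda>(c, c'). \<theta> t (a * c) - \<theta> t (a * c')"] by simp
        then show ?thesis using Delta_shift[OF that, of t] D th1 by simp
      qed
      define A where "A a = of_int k + \<theta> t (a * c)" for a
      have cA: "cyc A" unfolding A_def[abs_def] by (intro cyc_add cyc_of_int cyc_theta)
      have "cyc_congr p (\<lambda>a. A a ^ p) (\<lambda>a. of_int k + \<theta> t (a * (c * p)))"
        unfolding A_def by (rule cyc_congr_frobenius_int[OF p cyc_theta theta_frobenius[OF p]])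
      then obtain v where v: "cyc v" "\<And>a. a \<in> {1..<q} \<Longrightarrow> A a ^ p = of_int k + \<theta> t (a * (c * p)) + of_nat p * v a"
        unfolding cyc_congr_def by blast
      have "of_int D = A a * ((A a ^ (p - 1) - 1) * e a) + of_nat p * (- v a * e a)" if "a \<in> {1..<q}" for a
      proof -
        have eq1: "\<theta> t (a * (c * p)) - \<theta> t (a * c) = A a ^ p - A a - of_nat p * v a" using v(2)[OF that] by (simp add: A_def)
        have eq2: "A a ^ p = A a * A a ^ (p - 1)" using prime_gt_0_nat[OF p] by (metis power_eq_if not_gr0)
        show ?thesis unfolding De[OF that] eq1 eq2 by (simp add: algebra_simps)
      qed
      moreover have "cyc (\<lambda>a. (A a ^ (p - 1) - 1) * e a)" by (intro cyc_mult cyc_diff cyc_power cA cyc_1 ce)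
      moreover have "cyc (\<lambda>a. - v a * e a)" by (intro cyc_mult cyc_minus v ce)
      ultimately show ?thesis unfolding cyc_congr_def A_def by blast
    qed
    then obtain u where u: "\<And>c. c \<in> {1..<q} \<Longrightarrow> cyc (u c)"
      "\<And>c. c \<in> {1..<q} \<Longrightarrow> cyc_congr p (\<lambda>_. of_int D) (\<lambda>a. (of_int k + \<theta> t (a * c)) * u c a)" by metis
    \<comment> \<open>No single factor k + \<theta>_c is an integer, but the product over all q - 1
      values of c is P(k); so D^(q-1) is a multiple of P(k) modulo p.\<close>
    have "cyc_congr p (\<lambda>a. \<Prod>c\<in>{1..<q}. of_int D) (\<lambda>a. \<Prod>c\<in>{1..<q}. (of_int k + \<theta> t (a * c)) * u c a)"
      by (intro cyc_congr_prod u cyc_mult cyc_add cyc_of_int cyc_theta)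
    moreover have "cyc_congr p (\<lambda>a. \<Prod>c\<in>{1..<q}. (of_int k + \<theta> t (a * c)) * u c a) (\<lambda>_. 0)"
    proof -
      obtain m where m: "poly P k = int p * m" using k by auto
      have "(\<Prod>c\<in>{1..<q}. (of_int k + \<theta> t (a * c)) * u c a) = of_nat p * (of_int m * (\<Prod>c\<in>{1..<q}. u c a))" if "a \<in> {1..<q}" for a
        unfolding prod.distrib Pk[OF that, symmetric] m by simp
      moreover have "cyc (\<lambda>a. of_int m * (\<Prod>c\<in>{1..<q}. u c a))" by (intro cyc_mult cyc_of_int cyc_prod u)
      ultimately show ?thesis unfolding cyc_congr_def by auto
    qed
    ultimately have "cyc_congr p (\<lambda>a. \<Prod>c\<in>{1..<q}. of_int D) (\<lambda>_. 0)" by (rule cyc_congr_trans)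
    then have "cyc_congr p (\<lambda>_. of_int (D ^ (q - 1))) (\<lambda>_. 0)" by simp
    then have "int p dvd D ^ (q - 1)" using prime_gt_0_nat[OF p] by (intro dvd_if_cyc_congr_0)
    then show ?thesis using p prime_dvd_power by (metis prime_nat_int_transfer)
  qed
  have "{p. prime p \<and> \<not> ((\<exists>k. int p dvd poly P k) \<longleftrightarrow> \<xi> p = 1)} \<subseteq> insert q {p. int p dvd D}"
    using split nonsplit by blast
  moreover have "finite {p. int p dvd D}"
  proof (rule finite_subset)
    show "{p. int p dvd D} \<subseteq> {..nat \<bar>D\<bar>}" using D0 by (auto dest!: dvd_imp_le_int)
  qed simp
  ultimately show ?thesis by (intro exI[of _ P]) (auto intro: finite_subset)
qed

end

section \<open>Characters of prescribed order\<close>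

lemma root_unity_power_eq_1:
  assumes "m > 0" "cis (2 * pi / real m) ^ j = 1"
  shows "m dvd j"
proof -
  define w where "w = cis (2 * pi / real m)"
  have pw: "w ^ k = cis (2 * pi * real k / real m)" for k by (simp add: w_def Complex.DeMoivre mult_ac)
  have wm: "w ^ m = 1" using assms(1) by (simp add: pw)
  have "w ^ j = w ^ (m * (j div m) + j mod m)" by simp
  also have "\<dots> = w ^ (j mod m)" by (simp only: power_add power_mult wm power_one mult_1)
  finally have "w ^ (j mod m) = w ^ 0" using assms(2) by (simp add: w_def)
  moreover have "inj_on (\<lambda>k. w ^ k) {..<m}"
    using Complex.bij_betw_roots_unity[OF assms(1)] by (simp add: pw bij_betw_def)
  ultimately have "j mod m = 0" using assms(1) unfolding inj_on_def by auto
  then show ?thesis by auto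
qed

lemma primitive_root_log_exists:
  fixes q g n :: nat
  assumes q: "prime q" and g: "coprime q g" "ord q g = q - 1" and n: "coprime n q"
  shows "\<exists>k. [g ^ k = n] (mod q)"
proof -
  have inj: "inj_on (\<lambda>k. g ^ k mod q) {..<q - 1}"
  proof (rule inj_onI)
    fix i j assume ij: "i \<in> {..<q - 1}" "j \<in> {..<q - 1}" "g ^ i mod q = g ^ j mod q"
    then have "[g ^ i = g ^ j] (mod q)" by (simp add: cong_def)
    then have "[i = j] (mod (q - 1))" using order_divides_expdiff[OF g(1)] g(2) by simp
    then show "i = j" using ij by (simp add: cong_def)
  qed
  have nz: "x mod q \<in> {1..<q}" if "coprime x q" for x
  proof -
    have "\<not> q dvd x" using that q by (metis coprime_absorb_right not_prime_unit coprime_commute)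
    then show ?thesis using prime_gt_0_nat[OF q] by (auto simp: Suc_le_eq mod_greater_zero_iff_not_dvd)
  qed
  have "(\<lambda>k. g ^ k mod q) ` {..<q - 1} = {1..<q}"
  proof (rule card_subset_eq)
    have "coprime (g ^ k) q" for k using g(1) by (simp add: coprime_commute)
    then show "(\<lambda>k. g ^ k mod q) ` {..<q - 1} \<subseteq> {1..<q}" using nz by blast
    show "card ((\<lambda>k. g ^ k mod q) ` {..<q - 1}) = card {1..<q}" unfolding card_image[OF inj] by simp
  qed simp
  then have "n mod q \<in> (\<lambda>k. g ^ k mod q) ` {..<q - 1}" using nz[OF n] by simp
  then show ?thesis by (auto simp: cong_def)
qed

text \<open>The character sends g^k to exp(2 pi i k / m) for a primitive root g; this is well
  defined because k is determined modulo q - 1, a multiple of m. The element g is returned as the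
  witness that the order is exactly m.\<close>

lemma prime_char_of_order_exists:
  fixes q m :: nat
  assumes q: "prime q" and m: "m > 0" "m dvd q - 1"
  shows "\<exists>\<xi> g. dchar q \<xi> \<and> (\<forall>n. coprime n q \<longrightarrow> \<xi> n ^ m = 1) \<and> coprime g q \<and> (\<forall>j. \<xi> g ^ j = 1 \<longrightarrow> m dvd j)"
proof -
  have "q > 1" using q prime_gt_1_nat by blast
  obtain g where "residue_primroot q g" using prime_primitive_root_exists[of q] q \<open>q > 1\<close> by auto
  then have g: "coprime q g" "ord q g = q - 1" using q by (auto simp: residue_primroot_def totient_prime)
  define w where "w = cis (2 * pi / real m)"
  have wm: "w ^ m = 1" using m(1) by (simp add: w_def Complex.DeMoivre)
  have wmod: "w ^ (k mod m) = w ^ k" for k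
  proof -
    have "w ^ k = w ^ (m * (k div m) + k mod m)" by simp
    also have "\<dots> = w ^ (k mod m)" by (simp only: power_add power_mult wm power_one mult_1)
    finally show ?thesis by simp
  qed
  have wcong: "w ^ i = w ^ j" if "[g ^ i = g ^ j] (mod q)" for i j
  proof -
    have "[i = j] (mod (q - 1))" using that order_divides_expdiff[OF g(1)] g(2) by simp
    then have "[i = j] (mod m)" using m(2) cong_dvd_modulus_nat by blast
    then show ?thesis by (metis cong_def wmod)
  qed
  define lg where "lg n = (SOME k. [g ^ k = n] (mod q))" for n
  have lg: "[g ^ lg n = n] (mod q)" if "coprime n q" for n
    unfolding lg_def by (rule someI_ex[OF primitive_root_log_exists[OF q g that]])
  have wlg: "w ^ lg n = w ^ k" if "coprime n q" "[g ^ k = n] (mod q)" for n k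
    by (rule wcong) (use lg[OF that(1)] that(2) in \<open>metis cong_sym cong_trans\<close>)
  define \<xi> where "\<xi> n = (if coprime n q then w ^ lg n else 0)" for n
  have cq: "coprime (n + q) q \<longleftrightarrow> coprime n q" for n by (metis coprime_iff_gcd_eq_1 gcd_add1)
  have "dchar q \<xi>"
  proof
    show "q > 0" using \<open>q > 1\<close> by simp
    show "\<xi> (a * b) = \<xi> a * \<xi> b" for a b
    proof (cases "coprime a q \<and> coprime b q")
      case True
      have "[g ^ (lg a + lg b) = a * b] (mod q)" unfolding power_add using True lg by (intro cong_mult) auto
      then have "w ^ lg (a * b) = w ^ (lg a + lg b)" using True by (intro wlg) auto
      then show ?thesis using True by (simp add: \<xi>_def power_add)
    qed (auto simp: \<xi>_def)
    show "\<xi> (n + q) = \<xi> n" for n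
    proof (cases "coprime n q")
      case True
      have "w ^ lg (n + q) = w ^ lg n"
        by (rule wlg) (use True cq lg[OF True] in \<open>auto simp: cong_def\<close>)
      then show ?thesis using True cq by (simp add: \<xi>_def)
    qed (simp add: \<xi>_def cq)
    show "norm (\<xi> n) = 1" if "coprime n q" for n using that by (simp add: \<xi>_def w_def norm_power)
    show "\<xi> n = 0" if "\<not> coprime n q" for n using that by (simp add: \<xi>_def)
  qed
  moreover have "\<xi> n ^ m = 1" if "coprime n q" for n
    using that wm by (simp add: \<xi>_def) (metis mult.commute power_mult power_one)
  moreover have "coprime g q" using g by (simp add: coprime_commute)
  moreover have "m dvd j" if "\<xi> g ^ j = 1" for j
  proof -
    have "w ^ lg g = w ^ 1" by (rule wlg) (use g in \<open>auto simp: coprime_commute\<close>)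
    then have "\<xi> g = w" using g by (simp add: \<xi>_def coprime_commute)
    then show ?thesis using that root_unity_power_eq_1[OF m(1)] by (simp add: w_def)
  qed
  ultimately show ?thesis by blast
qed

section \<open>Primes congruent to 1 modulo m\<close>

lemma ipoly_add: "poly (map_poly of_int (P + Q)) w = poly (map_poly of_int P) w + poly (map_poly of_int Q) (w :: complex)"
proof -
  have "map_poly of_int (P + Q) = map_poly of_int P + (map_poly of_int Q :: complex poly)"
    by (simp add: poly_eq_iff coeff_map_poly)
  then show ?thesis by simp
qed

lemma ipoly_smult: "poly (map_poly of_int (Polynomial.smult c P)) w = of_int c * poly (map_poly of_int P) (w :: complex)"
proof -
  have "map_poly of_int (Polynomial.smult c P) = Polynomial.smult (of_int c) (map_poly of_int P :: complex poly)"
    by (simp add: poly_eq_iff coeff_map_poly)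
  then show ?thesis by simp
qed

lemma ipoly_mult: "poly (map_poly of_int (P * Q)) w = poly (map_poly of_int P) w * poly (map_poly of_int Q) (w :: complex)"
proof (induction P)
  case (pCons a P)
  then show ?case by (simp add: ipoly_add ipoly_smult map_poly_pCons algebra_simps)
qed simp

lemma ipoly_prod: "poly (map_poly of_int (\<Prod>i\<in>I. P i)) w = (\<Prod>i\<in>I. poly (map_poly of_int (P i)) (w :: complex))"
  by (induction I rule: infinite_finite_induct) (auto simp: ipoly_mult)

text \<open>Dividing A guarantees a cofactor, and dividing the product shows that C has no roots
  besides those of the f d; the induction takes successive lcms.\<close>

lemma common_multiple_poly:
  fixes f :: "'i \<Rightarrow> int poly"
  assumes "finite S" "\<And>d. d \<in> S \<Longrightarrow> f d dvd A"
  shows "\<exists>C. C dvd A \<and> (\<forall>d\<in>S. f d dvd C) \<and> C dvd (\<Prod>d\<in>S. f d)"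
  using assms
proof (induction S rule: finite_induct)
  case empty
  show ?case by (rule exI[of _ 1]) simp
next
  case (insert x S)
  have "\<exists>C. C dvd A \<and> (\<forall>d\<in>S. f d dvd C) \<and> C dvd (\<Prod>d\<in>S. f d)"
    by (rule insert.IH) (rule insert.prems, simp)
  then obtain C where C: "C dvd A" "\<forall>d\<in>S. f d dvd C" "C dvd (\<Prod>d\<in>S. f d)" by (elim exE conjE)
  have "f x dvd A" by (rule insert.prems) simp
  then have "lcm (f x) C dvd A" using C(1) by (rule lcm_least)
  moreover have "\<forall>d\<in>insert x S. f d dvd lcm (f x) C"
  proof
    fix d assume "d \<in> insert x S"
    then consider "d = x" | "d \<in> S" by blast
    then show "f d dvd lcm (f x) C"
    proof cases
      case 2
      then have "f d dvd C" using C(2) by blast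
      then show ?thesis by (rule dvd_trans) (rule dvd_lcm2)
    qed (simp only: dvd_lcm1)
  qed
  moreover have "lcm (f x) C dvd (\<Prod>d\<in>insert x S. f d)"
  proof -
    have "lcm (f x) C dvd f x * C" by (rule lcm_least) (rule dvd_triv_left, rule dvd_triv_right)
    also have "f x * C dvd f x * (\<Prod>d\<in>S. f d)" by (rule mult_dvd_mono[OF dvd_refl C(3)])
    also have "\<dots> = (\<Prod>d\<in>insert x S. f d)" using insert.hyps by simp
    finally show ?thesis .
  qed
  ultimately show ?case by (intro exI[of _ "lcm (f x) C"] conjI)
qed

text \<open>The cofactor $F$ of the least common multiple of the $X^{m/l} - 1$ in $X^m - 1$ plays the role of the cyclotomic
  polynomial: a prime dividing $F(x)$ and some $x^{m/l} - 1$ makes $X^m - 1$ inseparable modulo $p$, so it divides $m x$.\<close>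

lemma exists_large_prime_cong_1:
  fixes m B :: nat
  assumes m: "m > 0"
  shows "\<exists>p. prime p \<and> p > B \<and> m dvd p - 1"
proof -
  define X where "X n = (Polynomial.monom 1 n - 1 :: int poly)" for n
  define S where "S = {l. prime l \<and> l dvd m}"
  have finS: "finite S" unfolding S_def by (rule finite_subset[of _ "{..m}"]) (use m in \<open>auto dest: dvd_imp_le\<close>)
  have Xdvd: "X d dvd X m" if dm: "d dvd m" for d
  proof -
    obtain k where k: "m = d * k" using dm by (elim dvdE)
    have "Polynomial.monom 1 d - 1 dvd (Polynomial.monom 1 d) ^ k - (1 :: int poly) ^ k"
      unfolding power_diff_sumr2 by (rule dvd_triv_left)
    then show ?thesis by (simp add: X_def k monom_power)
  qed
  have "\<exists>C. C dvd X m \<and> (\<forall>l\<in>S. X (m div l) dvd C) \<and> C dvd (\<Prod>l\<in>S. X (m div l))"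
  proof (rule common_multiple_poly[OF finS])
    fix l assume "l \<in> S"
    then have "l dvd m" by (simp add: S_def)
    then show "X (m div l) dvd X m" by (intro Xdvd) (metis dvd_div_mult_self dvd_triv_left)
  qed
  then obtain C where C: "C dvd X m" "\<forall>l\<in>S. X (m div l) dvd C" "C dvd (\<Prod>l\<in>S. X (m div l))" by (elim exE conjE)
  from C(1) obtain F where F: "X m = C * F" by auto
  \<comment> \<open>A primitive m-th root of unity is a root of X^m - 1 but not of C, so it is a
    root of F; this keeps F from being a nonzero constant.\<close>
  define w where "w = cis (2 * pi / real m)"
  have Xw: "poly (map_poly of_int (X n)) w = w ^ n - 1" for n
  proof -
    have "map_poly of_int (X n) = (Polynomial.monom 1 n - 1 :: complex poly)"
      by (simp add: X_def poly_eq_iff coeff_map_poly)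
    then show ?thesis by (simp add: poly_monom)
  qed
  have wl: "w ^ (m div l) \<noteq> 1" if "l \<in> S" for l
  proof
    assume "w ^ (m div l) = 1"
    then have "m dvd m div l" using m root_unity_power_eq_1 by (simp add: w_def)
    moreover have "m div l < m" using that m prime_gt_1_nat[of l] by (auto simp: S_def intro!: div_less_dividend)
    moreover have "m div l > 0" using that m by (auto simp: S_def div_greater_zero_iff dvd_imp_le prime_gt_0_nat)
    ultimately show False by (auto dest: dvd_imp_le)
  qed
  have "poly (map_poly of_int C) w \<noteq> 0"
  proof
    assume "poly (map_poly of_int C) w = 0"
    moreover obtain E where "(\<Prod>l\<in>S. X (m div l)) = C * E" using C(3) by auto
    ultimately have "poly (map_poly of_int (\<Prod>l\<in>S. X (m div l))) w = 0" by (simp add: ipoly_mult)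
    then show False using wl finS by (auto simp: ipoly_prod Xw)
  qed
  moreover have "poly (map_poly of_int (X m)) w = 0"
    unfolding Xw using m by (simp add: w_def Complex.DeMoivre)
  ultimately have Fw: "poly (map_poly of_int F) w = 0" by (simp add: F ipoly_mult)
  have F0: "F \<noteq> [:c:]" if "c \<noteq> 0" for c
    using Fw that by (auto simp: map_poly_pCons)
  have "X m \<noteq> 0"
  proof
    assume "X m = 0"
    then have "Polynomial.coeff (X m) 0 = 0" by simp
    then show False using m by (simp add: X_def)
  qed
  then have Fnz: "F \<noteq> 0" using F by auto
  have fin: "finite {x. poly F x = c}" for c
  proof -
    have "F - [:c:] \<noteq> 0" using F0[of c] Fnz by (cases "c = 0") auto
    then have "finite {x. poly (F - [:c:]) x = 0}" by (rule poly_roots_finite)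
    then show ?thesis by simp
  qed
  \<comment> \<open>For x a multiple of b, a prime not dividing x divides neither m nor B!, so it
    exceeds B. F takes the values 0, 1 and -1 only finitely often, so some multiple gives F(x) a
    prime divisor.\<close>
  define b where "b = m * fact B"
  have b: "b > 0" using m by (simp add: b_def)
  have "inj (\<lambda>j::nat. int (b * Suc j))" using b by (auto intro!: injI)
  then have "infinite (range (\<lambda>j::nat. int (b * Suc j)))" by (rule range_inj_infinite)
  moreover have "finite ({x. poly F x = 0} \<union> {x. poly F x = 1} \<union> {x. poly F x = -1})" using fin by blast
  ultimately obtain x0 where "x0 \<in> range (\<lambda>j::nat. int (b * Suc j))" "x0 \<notin> {x. poly F x = 0} \<union> {x. poly F x = 1} \<union> {x. poly F x = -1}"
    by (meson finite_subset subsetI)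
  then obtain j where j: "poly F (int (b * Suc j)) \<notin> {0, 1, -1}" by auto
  define x where "x = b * Suc j"
  have "nat \<bar>poly F (int x)\<bar> \<noteq> 1" using j by (auto simp: x_def abs_if split: if_splits)
  then obtain p where p: "prime p" "p dvd nat \<bar>poly F (int x)\<bar>" using prime_factor_nat by blast
  then have pF: "int p dvd poly F (int x)" by (metis dvd_abs_iff int_dvd_int_iff nat_0_le abs_ge_zero)
  have Xv: "poly (X n) (int x) = int x ^ n - 1" for n by (simp add: X_def poly_monom)
  have pX: "int p dvd int x ^ m - 1" using pF F Xv[of m] by (metis dvd_mult poly_mult)
  have px: "\<not> p dvd x"
  proof
    assume "p dvd x"
    then have "p dvd x ^ m" using m by (metis dvd_power dvd_trans)
    then have "int p dvd int x ^ m" by (metis int_dvd_int_iff of_nat_power)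
    then have "int p dvd int x ^ m - (int x ^ m - 1)" using pX by (rule dvd_diff)
    then show False using p(1) prime_gt_1_nat[of p] by simp
  qed
  have pm: "\<not> p dvd m" using px by (auto simp: x_def b_def)
  have pB: "p > B"
  proof (rule ccontr)
    assume "\<not> p > B"
    then have "p dvd fact B" using p(1) prime_gt_0_nat by (intro dvd_fact) (auto simp: Suc_le_eq)
    then show False using px by (auto simp: x_def b_def)
  qed
  have cop: "coprime p x" using p(1) px by (simp add: prime_imp_coprime)
  have congX: "[x ^ n = 1] (mod p) \<longleftrightarrow> int p dvd int x ^ n - 1" for n
    using cong_int_iff[of "x ^ n" 1 p] by (simp add: cong_iff_dvd_diff)
  define d where "d = ord p x"
  have dm: "d dvd m" unfolding d_def ord_divides[symmetric] congX by (rule pX)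
  have "d = m"
  proof (rule ccontr)
    assume "d \<noteq> m"
    then have "m div d \<noteq> 1" using dm m by (metis dvd_div_mult_self mult_1)
    then obtain l where l: "prime l" "l dvd m div d" using prime_factor_nat by blast
    have lm: "l dvd m" using l(2) dm by (metis dvd_div_mult_self dvd_mult2)
    have "d dvd m div l"
    proof -
      obtain e where e: "m div d = l * e" using l(2) by auto
      have "m = l * (e * d)" using e dm by (metis dvd_div_mult_self mult.assoc)
      then have "m div l = e * d" using l(1) prime_gt_0_nat by simp
      then show ?thesis by simp
    qed
    then have "int p dvd poly (X (m div l)) (int x)" unfolding d_def ord_divides[symmetric] congX Xv .
    moreover have "X (m div l) dvd C" using C(2) l(1) lm by (simp add: S_def)
    then have "poly (X (m div l)) (int x) dvd poly C (int x)" by (auto elim!: dvdE)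
    ultimately have pC: "int p dvd poly C (int x)" by (rule dvd_trans)
    \<comment> \<open>Product rule on X^m - 1 = C F: if p divides both C(x) and F(x), it divides the
      derivative m x^(m-1), contrary to the choice of x.\<close>
    have "pderiv (X m) = Polynomial.smult (int m) (Polynomial.monom 1 (m - 1))"
      using m by (simp add: X_def pderiv_diff pderiv_monom smult_monom)
    then have "poly (pderiv (X m)) (int x) = int m * int x ^ (m - 1)" by (simp add: poly_monom)
    moreover have "poly (pderiv (X m)) (int x) = poly C (int x) * poly (pderiv F) (int x) + poly F (int x) * poly (pderiv C) (int x)"
      unfolding F by (simp add: pderiv_mult)
    ultimately have "int p dvd int m * int x ^ (m - 1)" using pC pF by (metis dvd_add dvd_mult2)
    then have "p dvd m * x ^ (m - 1)" by (metis int_dvd_int_iff of_nat_mult of_nat_power)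
    then show False using p(1) pm px by (auto simp: prime_dvd_mult_iff dest: prime_dvd_power)
  qed
  moreover have "d dvd totient p" using order_divides_totient[OF cop] by (simp add: d_def)
  ultimately have "m dvd p - 1" using p(1) by (simp add: totient_prime)
  then show ?thesis using p(1) pB by blast
qed

section \<open>Realising every rational density\<close>

lemma exists_distinct_primes_cong_1:
  fixes I :: "nat set"
  assumes "finite I" "\<And>i. i \<in> I \<Longrightarrow> i > 0"
  shows "\<exists>q. inj_on q I \<and> (\<forall>i\<in>I. prime (q i) \<and> i dvd q i - 1)"
  using assms
proof (induction I rule: finite_induct)
  case (insert x I)
  have "\<exists>q. inj_on q I \<and> (\<forall>i\<in>I. prime (q i) \<and> i dvd q i - 1)" using insert.prems by (intro insert.IH) auto
  then obtain q where q: "inj_on q I" "\<And>i. i \<in> I \<Longrightarrow> prime (q i) \<and> i dvd q i - 1" by (elim exE conjE) simp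
  obtain p where p: "prime p" "p > Max (insert 0 (q ` I))" "x dvd p - 1"
    using exists_large_prime_cong_1[of x "Max (insert 0 (q ` I))"] insert.prems[of x] by auto
  have new: "q i \<noteq> p" if "i \<in> I" for i
    using Max_ge[of "insert 0 (q ` I)" "q i"] that insert.hyps p(2) by auto
  have eq: "(q(x := p)) i = q i" if "i \<in> I" for i using that insert.hyps by auto
  have "inj_on (q(x := p)) (insert x I)"
    using q(1) new insert.hyps by (auto simp: inj_on_def)
  moreover have "\<forall>i\<in>insert x I. prime ((q(x := p)) i) \<and> i dvd (q(x := p)) i - 1" using p q(2) by auto
  ultimately show ?case by (intro exI[of _ "q(x := p)"] conjI)
qed simp

lemma telescoping_product:
  fixes k n :: nat
  assumes "k \<ge> 1" "k \<le> n"
  shows "(\<Prod>i\<in>{Suc k..n}. 1 - 1 / real i) = real k / real n"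
  using assms(2)
proof (induction n rule: dec_induct)
  case (step n)
  have "(\<Prod>i\<in>{Suc k..Suc n}. 1 - 1 / real i) = (\<Prod>i\<in>{Suc k..n}. 1 - 1 / real i) * (1 - 1 / real (Suc n))"
    using step.hyps by simp
  also have "\<dots> = real k / real n * (1 - 1 / real (Suc n))" by (simp only: step.IH)
  also have "\<dots> = real k / real (Suc n)" using step.hyps assms(1) by (simp add: field_simps)
  finally show ?case .
qed (use assms in simp)

text \<open>Finite Fourier expansion of the indicator of y \<noteq> 1 on the i-th roots of unity;
  its constant coefficient 1 - 1/i is the mean value.\<close>

lemma root_of_unity_indicator:
  fixes y :: complex
  assumes "i > 0" "y ^ i = 1"
  shows "(\<Sum>j<i. (if j = 0 then 1 - 1 / of_nat i else - 1 / of_nat i) * y ^ j) = (if y = 1 then 0 else 1)"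
proof -
  have "(\<Sum>j<i. (if j = 0 then 1 - 1 / of_nat i else - 1 / of_nat i) * y ^ j) = (\<Sum>j<i. (if j = 0 then 1 else 0) - (1 / of_nat i) * y ^ j)"
    by (rule sum.cong) (auto simp: algebra_simps)
  also have "\<dots> = 1 - (1 / of_nat i) * (\<Sum>j<i. y ^ j)"
    using assms(1) by (simp add: sum_subtractf sum_distrib_left)
  also have "(\<Sum>j<i. y ^ j) = (if y = 1 then of_nat i else 0)"
    using assms(2) by (simp add: geometric_sum)
  finally show ?thesis using assms(1) by simp
qed

section \<open>Independence of characters to distinct prime moduli\<close>

text \<open>Multiplying out the Fourier expansions of the single conditions gives a combination of
  product characters modulo Q. Only the one with all exponents 0 is trivial, so the mean is the
  product of the constant coefficients.\<close>

theorem avoiding_characters_mean: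
  fixes I :: "nat set" and q :: "nat \<Rightarrow> nat" and \<xi> :: "nat \<Rightarrow> nat \<Rightarrow> complex" and g :: "nat \<Rightarrow> nat"
  assumes I: "finite I" "\<And>i. i \<in> I \<Longrightarrow> i > 0" and q: "inj_on q I" "\<And>i. i \<in> I \<Longrightarrow> prime (q i)"
    and ch: "\<And>i. i \<in> I \<Longrightarrow> dchar (q i) (\<xi> i)"
    and ord: "\<And>i n. i \<in> I \<Longrightarrow> coprime n (q i) \<Longrightarrow> \<xi> i n ^ i = 1"
    and g: "\<And>i. i \<in> I \<Longrightarrow> coprime (g i) (q i)" "\<And>i j. i \<in> I \<Longrightarrow> \<xi> i (g i) ^ j = 1 \<Longrightarrow> i dvd j"
  defines "T \<equiv> {n. coprime n (\<Prod>i\<in>I. q i) \<and> (\<forall>i\<in>I. \<xi> i n \<noteq> 1)}"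
  shows "(\<lambda>n. (\<Sum>k=1..n. mangoldt k * indicator T k) / real n) \<longlonglongrightarrow> (\<Prod>i\<in>I. 1 - 1 / real i)"
proof -
  define Q where "Q = (\<Prod>i\<in>I. q i)"
  define J where "J = PiE I (\<lambda>i. {..<i})"
  define c where "c i j = (if j = 0 then 1 - 1 / of_nat i else - 1 / of_nat i :: complex)" for i j :: nat
  define w where "w j = (\<Prod>i\<in>I. c i (j i))" for j
  \<comment> \<open>The explicit 0 is needed because a factor with exponent 0 equals 1 even where
    its character vanishes.\<close>
  define X where "X j n = (if coprime n Q then \<Prod>i\<in>I. \<xi> i n ^ j i else 0)" for j n
  have cop: "coprime n Q \<longleftrightarrow> (\<forall>i\<in>I. coprime n (q i))" for n
    unfolding Q_def using I(1) by (induction I rule: finite_induct) auto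
  have qdvd: "q i dvd Q" if "i \<in> I" for i unfolding Q_def using I(1) that by (rule dvd_prodI)
  have X: "dchar Q (X j)" for j
  proof
    show "Q > 0" unfolding Q_def using q(2) prime_gt_0_nat by (intro prod_pos) auto
    show "X j (a * b) = X j a * X j b" for a b
    proof (cases "coprime a Q \<and> coprime b Q")
      case True
      have "(\<Prod>i\<in>I. \<xi> i (a * b) ^ j i) = (\<Prod>i\<in>I. \<xi> i a ^ j i * \<xi> i b ^ j i)"
        by (rule prod.cong) (auto simp: dchar.mult[OF ch] power_mult_distrib)
      then show ?thesis using True by (simp add: X_def prod.distrib)
    qed (auto simp: X_def)
    have cQ: "coprime (n + Q) Q \<longleftrightarrow> coprime n Q" for n by (metis coprime_iff_gcd_eq_1 gcd_add1)
    show "X j (n + Q) = X j n" for n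
    proof -
      have "\<xi> i (n + Q) = \<xi> i n" if "i \<in> I" for i
        by (rule dchar.cong_imp_eq[OF ch[OF that]]) (use qdvd[OF that] in \<open>auto simp: cong_def elim!: dvdE\<close>)
      then show ?thesis using cQ by (simp add: X_def)
    qed
    show "norm (X j n) = 1" if "coprime n Q" for n
    proof -
      have "norm (\<xi> i n ^ j i) = 1" if "i \<in> I" for i
        using dchar.norm_coprime[OF ch[OF that]] cop \<open>coprime n Q\<close> that by (simp add: norm_power)
      then show ?thesis using that by (simp add: X_def prod_norm[symmetric])
    qed
    show "X j n = 0" if "\<not> coprime n Q" for n using that by (simp add: X_def)
  qed
  have triv: "dchar.trivial_char Q (X j) \<longleftrightarrow> (\<forall>i\<in>I. j i = 0)" if j: "j \<in> J" for j
  proof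
    assume "\<forall>i\<in>I. j i = 0"
    then show "dchar.trivial_char Q (X j)" unfolding dchar.trivial_char_def[OF X] by (simp add: X_def)
  next
    assume tr: "dchar.trivial_char Q (X j)"
    show "\<forall>i\<in>I. j i = 0"
    proof (rule ballI, rule ccontr)
      fix i assume i: "i \<in> I" "j i \<noteq> 0"
      have "\<forall>i\<in>I. \<forall>k\<in>I. i \<noteq> k \<longrightarrow> coprime (q i) (q k)"
        using q by (auto intro!: primes_coprime simp: inj_on_def)
      \<comment> \<open>An x congruent to g i modulo q i and to 1 modulo the other primes isolates
        the i-th exponent; as \<xi> i (g i) has exact order i, that exponent is 0.\<close>
      from chinese_remainder_nat[OF I(1) this, of "\<lambda>k. if k = i then g i else 1"]
      obtain x where x: "\<forall>k\<in>I. [x = (if k = i then g i else 1)] (mod q k)" by blast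
      have xk: "\<xi> k x = \<xi> k (if k = i then g i else 1)" if "k \<in> I" for k
        by (rule dchar.cong_imp_eq[OF ch[OF that]]) (use x that in blast)
      have "coprime x (q k)" if "k \<in> I" for k
      proof -
        have "coprime (if k = i then g i else 1) (q k)" using g(1)[OF i(1)] by auto
        then show ?thesis using x that by (metis cong_imp_coprime cong_sym)
      qed
      then have cx: "coprime x Q" by (simp add: cop)
      have "X j x = (\<Prod>k\<in>I. if k = i then \<xi> i (g i) ^ j i else 1)"
        unfolding X_def using cx xk dchar.one[OF ch] by (auto intro!: prod.cong)
      also have "\<dots> = \<xi> i (g i) ^ j i" using I(1) i(1) by (simp add: prod.delta)
      finally have "\<xi> i (g i) ^ j i = 1" using tr cx unfolding dchar.trivial_char_def[OF X] by metis
      then have "i dvd j i" using g(2) i(1) by blast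
      moreover have "j i < i" using j i(1) by (auto simp: J_def PiE_def Pi_def)
      ultimately show False using i(2) by (auto dest: dvd_imp_le)
    qed
  qed
  have ind: "of_real (indicator T n) = (\<Sum>j\<in>J. w j * X j n)" for n
  proof (cases "coprime n Q")
    case False
    then show ?thesis by (simp add: X_def T_def Q_def indicator_def)
  next
    case True
    have "(\<Sum>j\<in>J. w j * X j n) = (\<Sum>j\<in>J. \<Prod>i\<in>I. c i (j i) * \<xi> i n ^ j i)"
      using True by (simp add: w_def X_def prod.distrib)
    also have "\<dots> = (\<Prod>i\<in>I. \<Sum>k<i. c i k * \<xi> i n ^ k)"
      unfolding J_def by (rule prod_sum_PiE[symmetric]) (use I in auto)
    also have "\<dots> = (\<Prod>i\<in>I. if \<xi> i n = 1 then 0 else 1)"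
      unfolding c_def using True cop I ord by (intro prod.cong refl root_of_unity_indicator) auto
    also have "\<dots> = of_real (indicator T n)"
    proof (cases "\<exists>i\<in>I. \<xi> i n = 1")
      case True
      then have "(\<Prod>i\<in>I. if \<xi> i n = 1 then 0 else 1) = (0::complex)" using I(1) by (intro prod_zero) auto
      then show ?thesis using True by (auto simp: T_def indicator_def)
    next
      case False
      then show ?thesis using True by (auto simp: T_def indicator_def Q_def)
    qed
    finally show ?thesis by simp
  qed
  have cc: "of_real (\<Prod>i\<in>I. 1 - 1 / real i) = (\<Sum>j\<in>J. if dchar.trivial_char Q (X j) then w j else 0)"
  proof -
    define j0 where "j0 = restrict (\<lambda>_. 0::nat) I"
    have j0: "j0 \<in> J" using I(2) by (auto simp: J_def j0_def)
    have "dchar.trivial_char Q (X j) \<longleftrightarrow> j = j0" if "j \<in> J" for j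
    proof -
      have "(\<forall>i\<in>I. j i = 0) \<longleftrightarrow> j = j0"
      proof
        assume a: "\<forall>i\<in>I. j i = 0"
        show "j = j0"
        proof
          fix i show "j i = j0 i" using a that by (cases "i \<in> I") (auto simp: j0_def J_def PiE_def extensional_def)
        qed
      qed (simp add: j0_def)
      then show ?thesis using triv[OF that] by simp
    qed
    then have "(\<Sum>j\<in>J. if dchar.trivial_char Q (X j) then w j else 0) = (\<Sum>j\<in>J. if j = j0 then w j else 0)" by (intro sum.cong) auto
    also have "\<dots> = w j0"
    proof -
      have "finite J" unfolding J_def using I(1) by (intro finite_PiE) auto
      then show ?thesis using j0 by (simp add: sum.delta)
    qed
    also have "\<dots> = of_real (\<Prod>i\<in>I. 1 - 1 / real i)" by (simp add: w_def j0_def c_def)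
    finally show ?thesis by simp
  qed
  show ?thesis
  proof (rule weighted_mangoldt_mean[where J = J and Q = Q and \<xi> = X and w = w])
    show "finite J" unfolding J_def using I(1) by (intro finite_PiE) auto
  qed (use X ind cc in \<open>auto simp: indicator_def\<close>)
qed

lemma prime_divisors_of_values_prod:
  assumes "finite I"
  shows "prime_divisors_of_values (\<Prod>i\<in>I. P i) = (\<Union>i\<in>I. prime_divisors_of_values (P i))"
proof (intro equalityI subsetI)
  fix p assume "p \<in> prime_divisors_of_values (\<Prod>i\<in>I. P i)"
  then obtain k where p: "prime p" "int p dvd (\<Prod>i\<in>I. poly (P i) k)" by (auto simp: prime_divisors_of_values_def poly_prod)
  then obtain i where "i \<in> I" "int p dvd poly (P i) k" using assms by (subst (asm) prime_dvd_prod_iff) auto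
  then show "p \<in> (\<Union>i\<in>I. prime_divisors_of_values (P i))" using p by (auto simp: prime_divisors_of_values_def)
next
  fix p assume "p \<in> (\<Union>i\<in>I. prime_divisors_of_values (P i))"
  then obtain i k where i: "i \<in> I" "prime p" "int p dvd poly (P i) k" by (auto simp: prime_divisors_of_values_def)
  have "poly (P i) k dvd (\<Prod>i\<in>I. poly (P i) k)" using assms i(1) by (rule dvd_prodI)
  then have "int p dvd poly (\<Prod>i\<in>I. P i) k" using i(3) by (simp add: poly_prod dvd_trans)
  then show "p \<in> prime_divisors_of_values (\<Prod>i\<in>I. P i)" using i(2) by (auto simp: prime_divisors_of_values_def)
qed

theorem theorem5:
  fixes r :: rat
  assumes "0 \<le> r" and "r \<le> 1"
  shows "\<exists>P :: int poly. has_natural_density (prime_divisors_of_values P) (of_rat r)"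
proof -
  obtain u v where uv: "quotient_of r = (u, v)" by (cases "quotient_of r")
  have v: "v > 0" using quotient_of_denom_pos[OF uv] .
  have ruv: "r = of_int u / of_int v" using quotient_of_div[OF uv] .
  have u: "0 \<le> u" "u \<le> v" using assms v by (auto simp: ruv field_simps)
  define n where "n = nat v"
  \<comment> \<open>k/n is the density wanted for the complement. For r = 0 the index set below is
    empty, and the empty product, the polynomial 1, has no prime divisors.\<close>
  define k where "k = nat (v - u)"
  have kn: "n > 0" "k \<le> n" using u v by (auto simp: n_def k_def)
  have rk: "(of_rat r :: real) = 1 - real k / real n"
    using u v by (simp add: ruv of_rat_divide n_def k_def field_simps)
  show ?thesis
  proof (cases "k = 0")
    \<comment> \<open>r = 1: the polynomial X takes the value 0, which every prime divides.\<close>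
    case True
    have "(\<lambda>n. (\<Sum>k=1..n. mangoldt k * indicator {} k) / real n) \<longlonglongrightarrow> (0::real)" by simp
    moreover have "{p. prime p \<and> (p \<in> prime_divisors_of_values [:0, 1:] \<longleftrightarrow> p \<in> {})} = {}"
      by (auto simp: prime_divisors_of_values_def)
    then have "finite {p. prime p \<and> (p \<in> prime_divisors_of_values [:0, 1:] \<longleftrightarrow> p \<in> {})}" by (simp only: finite.emptyI)
    ultimately have "has_natural_density (prime_divisors_of_values [:0, 1:]) (1 - 0)"
      by (rule density_of_complement)
    then show ?thesis using True by (intro exI[of _ "[:0, 1:]"]) (simp add: rk)
  next
    case False
    define I where "I = {Suc k..n}"
    have I: "finite I" "\<And>i. i \<in> I \<Longrightarrow> i > 0" by (auto simp: I_def)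
    have "\<exists>q. inj_on q I \<and> (\<forall>i\<in>I. prime (q i) \<and> i dvd q i - 1)"
      by (rule exists_distinct_primes_cong_1[OF I(1)]) (rule I(2))
    then obtain q where
      q0: "inj_on q I" "\<forall>i\<in>I. prime (q i) \<and> i dvd q i - 1" by (elim exE conjE)
    have q: "inj_on q I" "\<And>i. i \<in> I \<Longrightarrow> prime (q i)" "\<And>i. i \<in> I \<Longrightarrow> i dvd q i - 1"
      using q0 by simp_all
    have "\<forall>i\<in>I. \<exists>\<xi> g. dchar (q i) \<xi> \<and> (\<forall>n. coprime n (q i) \<longrightarrow> \<xi> n ^ i = 1) \<and> coprime g (q i) \<and> (\<forall>j. \<xi> g ^ j = 1 \<longrightarrow> i dvd j)"
      using prime_char_of_order_exists q I(2) by simp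
    from bchoice[OF this] obtain \<xi> where "\<forall>i\<in>I. \<exists>g. dchar (q i) (\<xi> i) \<and> (\<forall>n. coprime n (q i) \<longrightarrow> \<xi> i n ^ i = 1) \<and> coprime g (q i) \<and> (\<forall>j. \<xi> i g ^ j = 1 \<longrightarrow> i dvd j)" ..
    from bchoice[OF this] obtain g where
      chg: "\<forall>i\<in>I. dchar (q i) (\<xi> i) \<and> (\<forall>n. coprime n (q i) \<longrightarrow> \<xi> i n ^ i = 1) \<and> coprime (g i) (q i) \<and> (\<forall>j. \<xi> i (g i) ^ j = 1 \<longrightarrow> i dvd j)" ..
    have ch: "\<And>i. i \<in> I \<Longrightarrow> dchar (q i) (\<xi> i)" and ord: "\<And>i n. i \<in> I \<Longrightarrow> coprime n (q i) \<Longrightarrow> \<xi> i n ^ i = 1"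
      and g: "\<And>i. i \<in> I \<Longrightarrow> coprime (g i) (q i)" "\<And>i j. i \<in> I \<Longrightarrow> \<xi> i (g i) ^ j = 1 \<Longrightarrow> i dvd j"
      using chg by blast+
    have "\<forall>i\<in>I. \<exists>P :: int poly. finite {p. prime p \<and> \<not> ((\<exists>k. int p dvd poly P k) \<longleftrightarrow> \<xi> i p = 1)}"
    proof
      fix i assume i: "i \<in> I"
      interpret dchar "q i" "\<xi> i" by (rule ch[OF i])
      interpret prime_char "q i" "\<xi> i" by unfold_locales (rule q(2)[OF i])
      show "\<exists>P :: int poly. finite {p. prime p \<and> \<not> ((\<exists>k. int p dvd poly P k) \<longleftrightarrow> \<xi> i p = 1)}"
        by (rule residue_symbol_polynomial)
    qed
    from bchoice[OF this] obtain P :: "nat \<Rightarrow> int poly" where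
      P: "\<forall>i\<in>I. finite {p. prime p \<and> \<not> ((\<exists>k. int p dvd poly (P i) k) \<longleftrightarrow> \<xi> i p = 1)}" ..
    define Q where "Q = (\<Prod>i\<in>I. q i)"
    define T where "T = {n. coprime n Q \<and> (\<forall>i\<in>I. \<xi> i n \<noteq> 1)}"
    define S where "S = prime_divisors_of_values (\<Prod>i\<in>I. P i)"
    have mean: "(\<lambda>n. (\<Sum>k=1..n. mangoldt k * indicator T k) / real n) \<longlonglongrightarrow> (\<Prod>i\<in>I. 1 - 1 / real i)"
      unfolding T_def Q_def by (rule avoiding_characters_mean[OF I q(1,2) ch ord g])
    \<comment> \<open>Complementarity can fail only at the moduli, where T is cut off by coprimality
      to Q, and at the finitely many exceptional primes of each P_i.\<close>
    have "{p. prime p \<and> (p \<in> S \<longleftrightarrow> p \<in> T)} \<subseteq> {p. p dvd Q} \<union> (\<Union>i\<in>I. {p. prime p \<and> \<not> ((\<exists>k. int p dvd poly (P i) k) \<longleftrightarrow> \<xi> i p = 1)})"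
    proof (rule subsetI, rule ccontr)
      fix p assume p: "p \<in> {p. prime p \<and> (p \<in> S \<longleftrightarrow> p \<in> T)}"
        and np: "p \<notin> {p. p dvd Q} \<union> (\<Union>i\<in>I. {p. prime p \<and> \<not> ((\<exists>k. int p dvd poly (P i) k) \<longleftrightarrow> \<xi> i p = 1)})"
      have pp: "prime p" using p by simp
      have "coprime p Q" using np pp by (simp add: prime_imp_coprime)
      moreover have "(\<exists>k. int p dvd poly (P i) k) \<longleftrightarrow> \<xi> i p = 1" if "i \<in> I" for i using np that pp by blast
      then have "p \<in> S \<longleftrightarrow> (\<exists>i\<in>I. \<xi> i p = 1)"
        unfolding S_def prime_divisors_of_values_prod[OF I(1)] using pp by (auto simp: prime_divisors_of_values_def)
      ultimately show False using p by (auto simp: T_def)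
    qed
    moreover have "Q > 0" unfolding Q_def using q(2) prime_gt_0_nat by (intro prod_pos) auto
    then have "finite {p. p dvd Q}" by simp
    then have "finite ({p. p dvd Q} \<union> (\<Union>i\<in>I. {p. prime p \<and> \<not> ((\<exists>k. int p dvd poly (P i) k) \<longleftrightarrow> \<xi> i p = 1)}))"
      by (intro finite_UnI finite_UN_I I(1) P[rule_format])
    ultimately have "finite {p. prime p \<and> (p \<in> S \<longleftrightarrow> p \<in> T)}" by (rule finite_subset)
    from density_of_complement[OF mean this]
    have "has_natural_density S (1 - (\<Prod>i\<in>I. 1 - 1 / real i))" .
    also have "(\<Prod>i\<in>I. 1 - 1 / real i) = real k / real n"
      unfolding I_def using False kn by (intro telescoping_product) auto
    finally show ?thesis unfolding S_def rk by (rule exI)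
  qed
qed

end
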